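(* 1. There exists a closed solvmanifold $M$ such that $l(M)=\infty$. 2. There exists a closed connected aspherical locally homogeneous space $H\backslash G/\Gamma$ such that the solvable radical of $G$ is abelian and $l(H\backslash G/\Gamma)=\infty$.
   Context: A (closed) solvmanifold is a quotient $R/\Gamma$ of a simply connected solvable Lie group $R$ by a cocompact lattice $\Gamma$. A closed aspherical locally homogeneous space is a double coset space $H\backslash G/\Gamma$ where $G$ is a connected Lie group, $H$ is a maximal compact subgroup of $G$ and $\Gamma$ is a cocompact torsion-free lattice of $G$. Free iterated actions. Given a collection of finite groups $\mathcal{G}=\{G_1,\dots,G_m\}$ (ordered; trivial groups allowed), a free iterated action $\mathcal{G}\curvearrowright M$ on a manifold $M$ is a sequence of surjections $M=M_0\xrightarrow{p_1}M_1\xrightarrow{p_2}\cdots\xrightarrow{p_m}M_m$ together with free (continuous) actions of $G_i$ on $M_{i-1}$ such that $p_i:M_{i-1}\to M_i$ is the orbit map of the action of $G_i$, for $i=1,\dots,m$. Two free iterated actions $\mathcal{G}\curvearrowright M$ and $\mathcal{G}'\curvearrowright M$ (possibly with different numbers of groups $m,m'$), with total projections $p=p_m\circ\cdots\circ p_1:M\to M_m$ and $p'=p'_{m'}\circ\cdots\circ p'_1:M\to M'_{m'}$, are equivalent if there are homeomorphisms $f:M_m\to M'_{m'}$ and $\overline f:M\to M$ with $p'\circ\overline f=f\circ p$. Length. For $\mathcal{G}=\{G_1,\dots,G_m\}$ put $l(\mathcal{G})=m$. Put $l(\mathcal{G}\curvearrowright M)=\min\{l(\mathcal{G}'):\mathcal{G}'\curvearrowright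 M\text{ equivalent to }\mathcal{G}\curvearrowright M\}$, and $l(M)=\max\{l(\mathcal{G}\curvearrowright M)\}$ over all free iterated actions of collections of finite groups on $M$; $l(M)=\infty$ means that the values $l(\mathcal{G}\curvearrowright M)$ are unbounded. *)

theory Defs
  imports
    "HOL-Analysis.Analysis"
    "HOL-Algebra.Solvable_Groups"
    "HOL-Algebra.Group_Action"
begin

section \<open>Lie groups\<close>

text \<open>
  The space \<open>R^n\<close> is the library's \<^const>\<open>Euclidean_space\<close> \<open>n\<close>, i.e. the sequences supported in
  \<open>{..<n}\<close>; this lets the dimension be an ordinary natural number.
\<close>

definition partial_derivative :: "nat \<Rightarrow> ((nat \<Rightarrow> real) \<Rightarrow> real) \<Rightarrow> (nat \<Rightarrow> real) \<Rightarrow> real" where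
  "partial_derivative i f x = deriv (\<lambda>t. f (x(i := t))) (x i)"

fun Ck_on :: "nat \<Rightarrow> nat \<Rightarrow> (nat \<Rightarrow> real) set \<Rightarrow> ((nat \<Rightarrow> real) \<Rightarrow> real) \<Rightarrow> bool" where
  "Ck_on n 0 U f \<longleftrightarrow> continuous_map (subtopology (Euclidean_space n) U) euclideanreal f"
| "Ck_on n (Suc k) U f \<longleftrightarrow>
     continuous_map (subtopology (Euclidean_space n) U) euclideanreal f \<and>
     (\<forall>i<n. (\<forall>x\<in>U. (\<lambda>t. f (x(i := t))) field_differentiable at (x i)) \<and>
            Ck_on n k U (partial_derivative i f))"

definition smooth_map_on ::
    "nat \<Rightarrow> nat \<Rightarrow> (nat \<Rightarrow> real) set \<Rightarrow> ((nat \<Rightarrow> real) \<Rightarrow> (nat \<Rightarrow> real)) \<Rightarrow> bool" where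
  "smooth_map_on m n U f \<longleftrightarrow> (\<forall>j<n. \<forall>k. Ck_on m k U (\<lambda>x. f x j))"

type_synonym 'a chart = "'a set \<times> ('a \<Rightarrow> nat \<Rightarrow> real)"

abbreviation chart_image :: "'a chart \<Rightarrow> (nat \<Rightarrow> real) set" where
  "chart_image c \<equiv> snd c ` fst c"

abbreviation chart_inv :: "'a chart \<Rightarrow> (nat \<Rightarrow> real) \<Rightarrow> 'a" where
  "chart_inv c \<equiv> inv_into (fst c) (snd c)"

definition is_chart :: "'a topology \<Rightarrow> nat \<Rightarrow> 'a chart \<Rightarrow> bool" where
  "is_chart T n c \<longleftrightarrow>
     openin T (fst c) \<and> openin (Euclidean_space n) (chart_image c) \<and>
     homeomorphic_map (subtopology T (fst c))
       (subtopology (Euclidean_space n) (chart_image c)) (snd c)"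

text \<open>The atlas need not be maximal: it only serves to generate the smooth structure.\<close>

locale smooth_manifold =
  fixes T :: "'a topology" and n :: nat and A :: "'a chart set"
  assumes hausdorff: "Hausdorff_space T"
    and second_countable: "second_countable T"
    and charts: "c \<in> A \<Longrightarrow> is_chart T n c"
    and cover: "(\<Union>c\<in>A. fst c) = topspace T"
    and transition_smooth: "c \<in> A \<Longrightarrow> d \<in> A \<Longrightarrow>
      smooth_map_on n n (snd c ` (fst c \<inter> fst d)) (snd d \<circ> chart_inv c)"

text \<open>
  For smoothness of the multiplication, \<open>R^n \<times> R^n\<close> is identified with \<open>R^(2n)\<close> by
  concatenation of coordinates.
\<close>

definition fst_half :: "nat \<Rightarrow> (nat \<Rightarrow> real) \<Rightarrow> (nat \<Rightarrow> real)" where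
  "fst_half n z = (\<lambda>i. if i < n then z i else 0)"

definition snd_half :: "nat \<Rightarrow> (nat \<Rightarrow> real) \<Rightarrow> (nat \<Rightarrow> real)" where
  "snd_half n z = (\<lambda>i. if i < n then z (n + i) else 0)"

locale lie_group = group G + smooth_manifold T n A
  for G :: "('a, 'b) monoid_scheme" (structure) and T :: "'a topology" and n A +
  assumes carrier_eq: "carrier G = topspace T"
    and mult_continuous: "continuous_map (prod_topology T T) T (\<lambda>(x, y). x \<otimes> y)"
    and inv_continuous: "continuous_map T T (\<lambda>x. inv x)"
    and mult_smooth: "c \<in> A \<Longrightarrow> d \<in> A \<Longrightarrow> e \<in> A \<Longrightarrow>
      smooth_map_on (2 * n) n
        {z \<in> topspace (Euclidean_space (2 * n)).
           fst_half n z \<in> chart_image c \<and> snd_half n z \<in> chart_image d \<and>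
           chart_inv c (fst_half n z) \<otimes> chart_inv d (snd_half n z) \<in> fst e}
        (\<lambda>z. snd e (chart_inv c (fst_half n z) \<otimes> chart_inv d (snd_half n z)))"
    and inv_smooth: "c \<in> A \<Longrightarrow> d \<in> A \<Longrightarrow>
      smooth_map_on n n {x \<in> chart_image c. inv (chart_inv c x) \<in> fst d}
        (\<lambda>x. snd d (inv (chart_inv c x)))"

definition simply_connected_space :: "'a topology \<Rightarrow> bool" where
  "simply_connected_space T \<longleftrightarrow>
     path_connected_space T \<and>
     (\<forall>g. pathin T g \<and> g 1 = g 0 \<longrightarrow>
        homotopic_with (\<lambda>h. h 0 = g 0 \<and> h 1 = g 0) (top_of_set {0..1}) T g (\<lambda>_. g 0))"

definition maximal_compact_subgroup ::
    "('a, 'b) monoid_scheme \<Rightarrow> 'a topology \<Rightarrow> 'a set \<Rightarrow> bool" where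
  "maximal_compact_subgroup G T H \<longleftrightarrow>
     subgroup H G \<and> compactin T H \<and>
     (\<forall>K. subgroup K G \<and> compactin T K \<and> H \<subseteq> K \<longrightarrow> K = H)"

definition connected_normal_solvable ::
    "('a, 'b) monoid_scheme \<Rightarrow> 'a topology \<Rightarrow> 'a set \<Rightarrow> bool" where
  "connected_normal_solvable G T N \<longleftrightarrow>
     N \<lhd> G \<and> closedin T N \<and> connectedin T N \<and> solvable (G\<lparr>carrier := N\<rparr>)"

definition is_solvable_radical ::
    "('a, 'b) monoid_scheme \<Rightarrow> 'a topology \<Rightarrow> 'a set \<Rightarrow> bool" where
  "is_solvable_radical G T S \<longleftrightarrow>
     connected_normal_solvable G T S \<and>
     (\<forall>N. connected_normal_solvable G T N \<longrightarrow> N \<subseteq> S)"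


section \<open>Coset spaces\<close>

definition quotient_topology :: "'a topology \<Rightarrow> ('a \<Rightarrow> 'b) \<Rightarrow> 'b topology" where
  "quotient_topology T q =
     topology (\<lambda>U. U \<subseteq> q ` topspace T \<and> openin T {x \<in> topspace T. q x \<in> U})"

lemma openin_quotient_topology:
  "openin (quotient_topology T q) U \<longleftrightarrow>
     U \<subseteq> q ` topspace T \<and> openin T {x \<in> topspace T. q x \<in> U}"
proof -
  have "istopology (\<lambda>U. U \<subseteq> q ` topspace T \<and> openin T {x \<in> topspace T. q x \<in> U})"
    unfolding istopology_def
  proof (intro conjI allI impI; (elim conjE)?)
    fix S S' assume "openin T {x \<in> topspace T. q x \<in> S}" "openin T {x \<in> topspace T. q x \<in> S'}"
    then have "openin T ({x \<in> topspace T. q x \<in> S} \<inter> {x \<in> topspace T. q x \<in> S'})"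
      by (rule openin_Int)
    also have "{x \<in> topspace T. q x \<in> S} \<inter> {x \<in> topspace T. q x \<in> S'} =
        {x \<in> topspace T. q x \<in> S \<inter> S'}" by auto
    finally show "openin T {x \<in> topspace T. q x \<in> S \<inter> S'}" .
  next
    fix \<K> assume K: "\<forall>K\<in>\<K>. K \<subseteq> q ` topspace T \<and> openin T {x \<in> topspace T. q x \<in> K}"
    then have "openin T (\<Union>K\<in>\<K>. {x \<in> topspace T. q x \<in> K})"
      by (intro openin_Union) auto
    also have "(\<Union>K\<in>\<K>. {x \<in> topspace T. q x \<in> K}) = {x \<in> topspace T. q x \<in> \<Union>\<K>}" by auto
    finally show "openin T {x \<in> topspace T. q x \<in> \<Union>\<K>}" .
    show "\<Union>\<K> \<subseteq> q ` topspace T" using K by blast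
  qed auto
  then show ?thesis
    by (simp add: quotient_topology_def)
qed

lemma topspace_quotient_topology [simp]:
  "topspace (quotient_topology T q) = q ` topspace T"
proof
  have "{x \<in> topspace T. q x \<in> q ` topspace T} = topspace T" by auto
  then have "openin (quotient_topology T q) (q ` topspace T)"
    by (simp add: openin_quotient_topology)
  then show "q ` topspace T \<subseteq> topspace (quotient_topology T q)"
    by (rule openin_subset)
  show "topspace (quotient_topology T q) \<subseteq> q ` topspace T"
    by (rule conjunct1 [OF openin_quotient_topology [THEN iffD1, OF openin_topspace]])
qed

lemma quotient_map_quotient_topology: "quotient_map T (quotient_topology T q) q"
  by (simp add: quotient_map_def openin_quotient_topology)

text \<open>\<open>G/\<Gamma>\<close> is the space of cosets \<open>g\<Gamma>\<close>, and \<open>H\G/\<Gamma>\<close> the space of double cosets \<open>Hg\<Gamma>\<close>.\<close>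

definition coset_space ::
    "('a, 'b) monoid_scheme \<Rightarrow> 'a topology \<Rightarrow> 'a set \<Rightarrow> 'a set topology" where
  "coset_space G T \<Gamma> = quotient_topology T (\<lambda>g. g <#\<^bsub>G\<^esub> \<Gamma>)"

definition double_coset_space ::
    "('a, 'b) monoid_scheme \<Rightarrow> 'a topology \<Rightarrow> 'a set \<Rightarrow> 'a set \<Rightarrow> 'a set topology" where
  "double_coset_space G T H \<Gamma> = quotient_topology T (\<lambda>g. H <#>\<^bsub>G\<^esub> (g <#\<^bsub>G\<^esub> \<Gamma>))"

definition cocompact_lattice ::
    "('a, 'b) monoid_scheme \<Rightarrow> 'a topology \<Rightarrow> 'a set \<Rightarrow> bool" where
  "cocompact_lattice G T \<Gamma> \<longleftrightarrow>
     subgroup \<Gamma> G \<and> subtopology T \<Gamma> = discrete_topology \<Gamma> \<and>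
     compact_space (coset_space G T \<Gamma>)"

definition torsion_free :: "('a, 'b) monoid_scheme \<Rightarrow> 'a set \<Rightarrow> bool" where
  "torsion_free G \<Gamma> \<longleftrightarrow>
     (\<forall>g\<in>\<Gamma>. \<forall>k::nat. k > 0 \<and> g [^]\<^bsub>G\<^esub> k = \<one>\<^bsub>G\<^esub> \<longrightarrow> g = \<one>\<^bsub>G\<^esub>)"

text \<open>
  A connected Lie group has at most the cardinality of the continuum, so the element type
  \<open>'a = nat \<Rightarrow> real\<close> represents all of them up to isomorphism.
\<close>

definition closed_solvmanifold :: "'a set topology \<Rightarrow> bool" where
  "closed_solvmanifold M \<longleftrightarrow>
     (\<exists>(R :: 'a monoid) T n A \<Gamma>.
        lie_group R T n A \<and> simply_connected_space T \<and> solvable R \<and>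
        cocompact_lattice R T \<Gamma> \<and> M = coset_space R T \<Gamma>)"

text \<open>The data \<open>(G, H, \<Gamma>)\<close> presenting \<open>H\G/\<Gamma>\<close> as a closed aspherical locally homogeneous space.\<close>

definition aspherical_locally_homogeneous ::
    "('a, 'b) monoid_scheme \<Rightarrow> 'a topology \<Rightarrow> 'a set \<Rightarrow> 'a set \<Rightarrow> bool" where
  "aspherical_locally_homogeneous G T H \<Gamma> \<longleftrightarrow>
     (\<exists>n A. lie_group G T n A) \<and> connected_space T \<and>
     maximal_compact_subgroup G T H \<and> cocompact_lattice G T \<Gamma> \<and> torsion_free G \<Gamma>"


section \<open>Free iterated actions\<close>

definition free_continuous_action ::
    "('g, 'c) monoid_scheme \<Rightarrow> 'a topology \<Rightarrow> ('g \<Rightarrow> 'a \<Rightarrow> 'a) \<Rightarrow> bool" where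
  "free_continuous_action G X \<phi> \<longleftrightarrow>
     group_action G (topspace X) \<phi> \<and>
     (\<forall>g\<in>carrier G. continuous_map X X (\<phi> g)) \<and>
     (\<forall>g\<in>carrier G. \<forall>x\<in>topspace X. \<phi> g x = x \<longrightarrow> g = \<one>\<^bsub>G\<^esub>)"

definition orbit_map ::
    "('g, 'c) monoid_scheme \<Rightarrow> 'a topology \<Rightarrow> ('g \<Rightarrow> 'a \<Rightarrow> 'a) \<Rightarrow> 'b topology \<Rightarrow> ('a \<Rightarrow> 'b) \<Rightarrow> bool"
  where
  "orbit_map G X \<phi> Y p \<longleftrightarrow>
     quotient_map X Y p \<and>
     (\<forall>x\<in>topspace X. \<forall>y\<in>topspace X. p x = p y \<longleftrightarrow> y \<in> orbit G \<phi> x)"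

text \<open>
  The list \<open>groups\<close> is \<open>G_1, \<dots>, G_m\<close>, and for \<open>i < m\<close> the group \<open>groups ! i = G_(i+1)\<close> acts by
  \<open>action i\<close> on \<open>stage i = M_i\<close>, with orbit map \<open>proj i = p_(i+1)\<close> onto \<open>stage (i+1)\<close>.
  Up to isomorphism a finite group has its carrier in \<open>nat\<close>, and up to homeomorphism every
  quotient of \<open>M\<close> lives on a set of representatives in \<open>M\<close>, so fixing these element types
  loses no generality. The components of index beyond \<open>m\<close> are irrelevant.
\<close>

record 'a iterated_action =
  groups :: "nat monoid list"
  stage :: "nat \<Rightarrow> 'a topology"
  action :: "nat \<Rightarrow> nat \<Rightarrow> 'a \<Rightarrow> 'a"
  proj :: "nat \<Rightarrow> 'a \<Rightarrow> 'a"

definition free_iterated_action :: "'a topology \<Rightarrow> 'a iterated_action \<Rightarrow> bool" where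
  "free_iterated_action M a \<longleftrightarrow>
     groups a \<noteq> [] \<and> stage a 0 = M \<and>
     (\<forall>i<length (groups a).
        group (groups a ! i) \<and> finite (carrier (groups a ! i)) \<and>
        free_continuous_action (groups a ! i) (stage a i) (action a i) \<and>
        orbit_map (groups a ! i) (stage a i) (action a i) (stage a (Suc i)) (proj a i))"

primrec proj_upto :: "'a iterated_action \<Rightarrow> nat \<Rightarrow> 'a \<Rightarrow> 'a" where
  "proj_upto a 0 = id"
| "proj_upto a (Suc i) = proj a i \<circ> proj_upto a i"

definition final_stage :: "'a iterated_action \<Rightarrow> 'a topology" where
  "final_stage a = stage a (length (groups a))"

definition total_proj :: "'a iterated_action \<Rightarrow> 'a \<Rightarrow> 'a" where
  "total_proj a = proj_upto a (length (groups a))"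

definition equivalent_actions ::
    "'a topology \<Rightarrow> 'a iterated_action \<Rightarrow> 'a iterated_action \<Rightarrow> bool" where
  "equivalent_actions M a b \<longleftrightarrow>
     (\<exists>f F. homeomorphic_map (final_stage a) (final_stage b) f \<and> homeomorphic_map M M F \<and>
        (\<forall>x\<in>topspace M. total_proj b (F x) = f (total_proj a x)))"

definition action_length :: "'a topology \<Rightarrow> 'a iterated_action \<Rightarrow> nat" where
  "action_length M a =
     (LEAST m. \<exists>b. free_iterated_action M b \<and> equivalent_actions M a b \<and> length (groups b) = m)"

text \<open>In \<open>enat\<close> the supremum is the maximum if the lengths are bounded, and \<open>\<infinity>\<close> otherwise.\<close>

definition iterated_length :: "'a topology \<Rightarrow> enat" where
  "iterated_length M = (SUP a\<in>{a. free_iterated_action M a}. enat (action_length M a))"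

end

theory Submission
  imports Defs
begin

text \<open>
  Both spaces are flat manifolds \<open>M = E/\<Gamma>\<close> with \<open>E = \<real>\<^sup>d \<times> \<real>\<close> and \<open>\<Gamma>\<close> generated by the integral
  translations of \<open>\<real>\<^sup>d\<close> and the screw motion \<open>t (v, s) = (-v, s + 1)\<close>. Halving the first coordinate of
  the lattice gives a free involution of \<open>M\<close> whose quotient is again \<open>M\<close>; iterating it \<open>k\<close> times yields
  a tower in which translation \<open>\<tau>\<^sub>c\<close> of the first coordinate by \<open>c = 2\<^sup>-\<^sup>k\<close> becomes trivial at the bottom.
  In any free iterated action, a deck transformation of one stage normalizes those of the stage above,
  since by connectedness it descends to the action of a single group element. As \<open>\<tau>\<^sub>2\<^sub>c\<close> is the
  commutator of \<open>\<tau>\<^sub>c\<close> and \<open>t\<close>, triviality of \<open>\<tau>\<^sub>c\<close> at one stage implies that of \<open>\<tau>\<^sub>2\<^sub>c\<close> at the stage above;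
  so an action equivalent to the tower has length at least \<open>k\<close>, because \<open>\<tau>\<^sub>c\<close> acts trivially on \<open>M\<close> only
  for integral \<open>c\<close>.

  For \<open>d = 2\<close>, \<open>\<Gamma>\<close> is a lattice in \<open>\<complex> \<rtimes> \<real>\<close> with \<open>s\<close> acting by \<open>e\<^sup>i\<^sup>\<pi>\<^sup>s\<close>. For \<open>d = 4\<close>, it embeds in
  \<open>(\<H> \<times> \<real>) \<rtimes> S\<^sup>3\<close> by sending \<open>t\<close> to \<open>(0, 1, -1)\<close>; the maximal compact subgroup is \<open>S\<^sup>3\<close>, and the radical
  is \<open>\<H> \<times> \<real>\<close> because a solvable normal subgroup has central image in \<open>S\<^sup>3\<close>.
\<close>

section \<open>Towers of free actions\<close>

text \<open>The group is finite, so separating \<open>y\<close> from all translates of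
  \<open>x\<close> involves finitely many pairs of open sets, and their intersections remain open.
  The orbit map is open, because the saturation of an open set is the union of its preimages under
  the group elements; this carries the separation to the quotient.\<close>

lemma Hausdorff_space_orbit_map:
  assumes act: "free_continuous_action G X \<phi>" and fin: "finite (carrier G)"
    and om: "orbit_map G X \<phi> Y p" and H: "Hausdorff_space X"
  shows "Hausdorff_space Y"
  unfolding Hausdorff_space_def
proof (intro allI impI, elim conjE)
  interpret group_action G "topspace X" \<phi>
    using act by (simp add: free_continuous_action_def)
  have q: "quotient_map X Y p"
    and fib: "\<And>x y. x \<in> topspace X \<Longrightarrow> y \<in> topspace X \<Longrightarrow> p x = p y \<longleftrightarrow> y \<in> orbit G \<phi> x"
    using om by (auto simp: orbit_map_def)
  have cont: "\<And>g. g \<in> carrier G \<Longrightarrow> continuous_map X X (\<phi> g)"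
    using act by (auto simp: free_continuous_action_def)
  interpret Gr: group G using group_hom group_hom.axioms(1) by blast
  fix u v assume u: "u \<in> topspace Y" and v: "v \<in> topspace Y" and "u \<noteq> v"
  obtain x y where x: "x \<in> topspace X" "u = p x" and y: "y \<in> topspace X" "v = p y"
    using u v quotient_imp_surjective_map[OF q] by blast
  have ne: "\<phi> g x \<noteq> y" if "g \<in> carrier G" for g
    using fib[OF x(1) y(1)] \<open>u \<noteq> v\<close> x y that by (auto simp: orbit_def)
  have "\<exists>U V. openin X U \<and> openin X V \<and> \<phi> g x \<in> U \<and> y \<in> V \<and> disjnt U V"
    if "g \<in> carrier G" for g
    using H ne[OF that] element_image[OF that x(1)] y(1)
    unfolding Hausdorff_space_def by metis
  then obtain U V where UV: "\<And>g. g \<in> carrier G \<Longrightarrow> openin X (U g) \<and> openin X (V g) \<and>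
      \<phi> g x \<in> U g \<and> y \<in> V g \<and> disjnt (U g) (V g)"
    by metis
  \<comment> \<open>A point of \<open>A\<close> has its \<open>g\<close>-translate in
    \<open>U g\<close>, while \<open>B\<close> is contained in \<open>V g\<close>; so no translate
    of a point of \<open>A\<close> lies in \<open>B\<close>.\<close>
  define A where "A = (\<Inter>g\<in>carrier G. {z \<in> topspace X. \<phi> g z \<in> U g})"
  define B where "B = (\<Inter>g\<in>carrier G. V g)"
  have ne0: "carrier G \<noteq> {}" by blast
  have oA: "openin X A"
    unfolding A_def using fin ne0 UV cont
    by (intro openin_Inter) (auto intro!: openin_continuous_map_preimage)
  have oB: "openin X B"
    unfolding B_def using fin ne0 UV by (intro openin_Inter) auto
  have xA: "x \<in> A" "y \<in> B" using UV x y by (auto simp: A_def B_def)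
  have open_img: "openin Y (p ` W)" if W: "openin X W" for W
  proof -
    have sub: "W \<subseteq> topspace X" using W openin_subset by blast
    have "{z \<in> topspace X. p z \<in> p ` W} = (\<Union>g\<in>carrier G. {z \<in> topspace X. \<phi> g z \<in> W})"
      (is "?L = ?R")
    proof
      show "?L \<subseteq> ?R"
      proof
        fix z assume "z \<in> ?L"
        then obtain w where "w \<in> W" "p z = p w" "z \<in> topspace X" by auto
        then show "z \<in> ?R" using fib[of z w] sub by (auto simp: orbit_def)
      qed
      show "?R \<subseteq> ?L"
        using fib sub by (auto simp: orbit_def image_iff)
    qed
    moreover have "openin X ?R"
      using cont W openin_continuous_map_preimage by (intro openin_Union) fast
    ultimately have "openin X {z \<in> topspace X. p z \<in> p ` W}" by simp
    moreover have "p ` W \<subseteq> topspace Y"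
      using sub quotient_imp_surjective_map[OF q] by blast
    ultimately show ?thesis using q unfolding quotient_map_def by blast
  qed
  have "disjnt (p ` A) (p ` B)"
  proof -
    have False if a: "a \<in> A" and b: "b \<in> B" and e: "p a = p b" for a b
    proof -
      have "a \<in> topspace X" "b \<in> topspace X"
        using a b oA oB openin_subset by blast+
      then obtain g where g: "g \<in> carrier G" "b = \<phi> g a"
        using fib e by (auto simp: orbit_def)
      have "b \<in> U g" using a g by (auto simp: A_def)
      moreover have "b \<in> V g" using b g by (auto simp: B_def)
      ultimately show False using UV[OF g(1)] by (auto simp: disjnt_def)
    qed
    then show ?thesis by (auto simp: disjnt_def)
  qed
  then show "\<exists>U V. openin Y U \<and> openin Y V \<and> u \<in> U \<and> v \<in> V \<and> disjnt U V"
    using open_img oA oB xA x y by blast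
qed

text \<open>Each piece is also open, its complement being the finite union of the other pieces.
  Applied to the sets on which a given group element realizes a translation, this yields one element
  that does so everywhere.\<close>

lemma connected_finite_closed_partition:
  assumes conn: "connected_space X" and fin: "finite I"
    and closed: "\<And>i. i \<in> I \<Longrightarrow> closedin X (A i)"
    and disj: "\<And>i j. i \<in> I \<Longrightarrow> j \<in> I \<Longrightarrow> i \<noteq> j \<Longrightarrow> A i \<inter> A j = {}"
    and cover: "(\<Union>i\<in>I. A i) = topspace X" and ne: "topspace X \<noteq> {}"
  shows "\<exists>i\<in>I. A i = topspace X"
proof -
  obtain i where i: "i \<in> I" "A i \<noteq> {}" using cover ne by blast
  have "topspace X - A i = (\<Union>j\<in>I - {i}. A j)"
    using cover disj i by blast
  moreover have "closedin X (\<Union>j\<in>I - {i}. A j)"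
    using fin closed by (intro closedin_Union) auto
  ultimately have "openin X (A i)"
    using closed[OF i(1)] by (metis openin_closedin_eq closedin_subset)
  then show ?thesis
    using conn closed i by (auto simp: connected_space_clopen_in)
qed

lemma continuous_map_proj_upto:
  assumes "free_iterated_action M a" "i \<le> length (groups a)"
  shows "continuous_map M (stage a i) (proj_upto a i)"
  using assms(2)
proof (induction i)
  case 0
  then show ?case using assms by (simp add: free_iterated_action_def id_def)
next
  case (Suc i)
  then have "quotient_map (stage a i) (stage a (Suc i)) (proj a i)"
    using assms(1) by (auto simp: free_iterated_action_def orbit_map_def)
  with Suc show ?case
    by (metis Suc_leD continuous_map_compose proj_upto.simps(2) quotient_imp_continuous_map)
qed

text \<open>Separation makes the coincidence set of two continuous maps into a stage closed.\<close>

lemma Hausdorff_space_stage: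
  assumes "free_iterated_action M a" "Hausdorff_space M" "i \<le> length (groups a)"
  shows "Hausdorff_space (stage a i)"
  using assms(3)
proof (induction i)
  case 0
  then show ?case using assms by (simp add: free_iterated_action_def)
next
  case (Suc i)
  then show ?case
    using assms(1) unfolding free_iterated_action_def
    by (meson Hausdorff_space_orbit_map Suc_le_lessD Suc_leD)
qed

text \<open>The relation \<open>t \<tau>\<^sub>c = \<tau>\<^sub>-\<^sub>c t\<close> makes \<open>\<tau>\<^sub>2\<^sub>c\<close> a commutator of \<open>\<tau>\<^sub>c\<close> and \<open>t\<close>, so each free action
  in the tower can only undo one doubling of \<open>c\<close>.\<close>

lemma commutator_descends:
  fixes E :: "'e topology" and M :: "'a topology" and \<tau> :: "real \<Rightarrow> 'e \<Rightarrow> 'e"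
  assumes conn: "connected_space E" and \<pi>: "continuous_map E M \<pi>" and M: "Hausdorff_space M"
    and b: "free_iterated_action M b" and F: "continuous_map M M F" "inj_on F (topspace M)"
    and \<tau>_cont: "\<And>c. continuous_map E E (\<tau> c)"
    and \<tau>_add: "\<And>c c' x. x \<in> topspace E \<Longrightarrow> \<tau> c (\<tau> c' x) = \<tau> (c + c') x"
    and \<tau>_0: "\<And>x. x \<in> topspace E \<Longrightarrow> \<tau> 0 x = x"
    and t: "\<And>x. x \<in> topspace E \<Longrightarrow> t x \<in> topspace E"
    and t': "\<And>x. x \<in> topspace E \<Longrightarrow> t' x \<in> topspace E \<and> t (t' x) = x"
    and t\<tau>: "\<And>c x. x \<in> topspace E \<Longrightarrow> t (\<tau> c x) = \<tau> (- c) (t x)"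
    and \<pi>t: "\<And>x. x \<in> topspace E \<Longrightarrow> \<pi> (t x) = \<pi> x"
    and tot: "\<And>x. x \<in> topspace E \<Longrightarrow> total_proj b (F (\<pi> (\<tau> c x))) = total_proj b (F (\<pi> x))"
    and x: "x \<in> topspace E"
  shows "\<pi> (\<tau> (2 ^ length (groups b) * c) x) = \<pi> x"
proof -
  define m where "m = length (groups b)"
  define r where "r i = proj_upto b i \<circ> F \<circ> \<pi>" for i
  have \<tau>_in: "\<tau> c x \<in> topspace E" if "x \<in> topspace E" for c x
    using \<tau>_cont that by (metis continuous_map_image_subset_topspace image_subset_iff)
  have r_cont: "continuous_map E (stage b i) (r i)" if "i \<le> m" for i
    unfolding r_def
    using continuous_map_proj_upto[OF b] that F \<pi> unfolding m_def
    by (meson continuous_map_compose)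
  \<comment> \<open>Climbing from stage \<open>Suc i\<close> to stage \<open>i\<close> costs one
    doubling of \<open>c\<close>: at stage \<open>i\<close>, \<open>\<tau> c\<close> acts as a
    single group element \<open>g\<close>, whose effect cancels in the commutator with
    \<open>t\<close>.\<close>
  have step: "\<forall>x\<in>topspace E. r i (\<tau> (2 * c) x) = r i x"
    if i: "i < m" and P: "\<forall>x\<in>topspace E. r (Suc i) (\<tau> c x) = r (Suc i) x" for i c
  proof (cases "topspace E = {}")
    case False
    let ?G = "groups b ! i" and ?\<phi> = "action b i"
    have act: "free_continuous_action ?G (stage b i) ?\<phi>" and fin: "finite (carrier ?G)"
      and om: "orbit_map ?G (stage b i) ?\<phi> (stage b (Suc i)) (proj b i)"
      using b i by (auto simp: free_iterated_action_def m_def)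
    interpret group_action ?G "topspace (stage b i)" ?\<phi>
      using act by (simp add: free_continuous_action_def)
    interpret Gr: group ?G using group_hom group_hom.axioms(1) by blast
    \<comment> \<open>By freeness a group element is determined by its value at one point, so the
      sets \<open>A g\<close> below are disjoint.\<close>
    have free: "g = h" if g: "g \<in> carrier ?G" "h \<in> carrier ?G" "y \<in> topspace (stage b i)"
        and e: "?\<phi> g y = ?\<phi> h y" for g h y
    proof -
      have "?\<phi> (inv\<^bsub>?G\<^esub> h \<otimes>\<^bsub>?G\<^esub> g) y = y"
        using g e orbit_sym_aux[OF g(2,3)] composition_rule[of y "inv\<^bsub>?G\<^esub> h" g]
        by (simp)
      then have "inv\<^bsub>?G\<^esub> h \<otimes>\<^bsub>?G\<^esub> g = \<one>\<^bsub>?G\<^esub>"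
        using act g by (auto simp: free_continuous_action_def)
      then show ?thesis using g by (metis Gr.inv_closed Gr.inv_equality Gr.inv_inv)
    qed
    have r_in: "r i y \<in> topspace (stage b i)" if "y \<in> topspace E" for y
      using r_cont i that by (metis continuous_map_image_subset_topspace image_subset_iff less_imp_le)
    \<comment> \<open>A priori the element that realizes \<open>\<tau> c\<close> depends on the
      point; connectedness of \<open>E\<close> makes it constant.\<close>
    define A where "A g = {y \<in> topspace E. r i (\<tau> c y) = ?\<phi> g (r i y)}" for g
    have "\<exists>g\<in>carrier ?G. A g = topspace E"
    proof (rule connected_finite_closed_partition[OF conn fin])
      have H: "Hausdorff_space (stage b i)"
        using Hausdorff_space_stage[OF b M] i by (simp add: m_def)
      fix g assume g: "g \<in> carrier ?G"
      have "continuous_map E (stage b i) (\<lambda>y. r i (\<tau> c y))"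
        using continuous_map_compose[OF \<tau>_cont r_cont] i by (simp add: o_def)
      moreover have "continuous_map E (stage b i) (\<lambda>y. ?\<phi> g (r i y))"
        using continuous_map_compose[OF r_cont, of i "stage b i" "?\<phi> g"] act g i
        by (simp add: o_def free_continuous_action_def)
      ultimately show "closedin E (A g)"
        unfolding A_def using closedin_continuous_maps_eq[OF H] by blast
    next
      fix g h assume "g \<in> carrier ?G" "h \<in> carrier ?G" "g \<noteq> h"
      then show "A g \<inter> A h = {}" using free r_in by (fastforce simp: A_def)
    next
      have "\<exists>g\<in>carrier ?G. y \<in> A g" if y: "y \<in> topspace E" for y
      proof -
        have "proj b i (r i y) = proj b i (r i (\<tau> c y))"
          using P y by (simp add: r_def)
        then have "r i (\<tau> c y) \<in> orbit ?G ?\<phi> (r i y)"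
          using om r_in y \<tau>_in unfolding orbit_map_def by blast
        then show ?thesis using y by (auto simp: A_def orbit_def)
      qed
      then show "(\<Union>g\<in>carrier ?G. A g) = topspace E" by (auto simp: A_def)
    qed (fact False)
    then obtain g where g: "\<And>y. y \<in> topspace E \<Longrightarrow> r i (\<tau> c y) = ?\<phi> g (r i y)"
      by (auto simp: A_def)
    have rt: "r i (t y) = r i y" if "y \<in> topspace E" for y
      using \<pi>t that by (simp add: r_def)
    show ?thesis
    proof
      fix x assume x: "x \<in> topspace E"
      \<comment> \<open>The point is chosen so that \<open>t y = \<tau> c x\<close> and
        \<open>\<tau> c y = t' x\<close>. As \<open>r i\<close> does not see \<open>t\<close>,
        applying \<open>g\<close> to \<open>r i y\<close> gives both
        \<open>r i (\<tau> (2 * c) x)\<close> and \<open>r i x\<close>.\<close>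
      define y where "y = \<tau> (- c) (t' x)"
      have y: "y \<in> topspace E" using \<tau>_in t' x by (simp add: y_def)
      have ty: "t y = \<tau> c x" using t\<tau>[of "t' x" "- c"] t' x by (simp add: y_def)
      have "r i (\<tau> (2 * c) x) = r i (\<tau> c (t y))"
        using \<tau>_add[OF x, of c c] by (simp add: ty)
      also have "\<dots> = ?\<phi> g (r i y)" using g rt t y by simp
      also have "\<dots> = r i (\<tau> c y)" using g y by simp
      also have "\<dots> = r i (t' x)" using \<tau>_add t' x \<tau>_0 by (simp add: y_def)
      also have "\<dots> = r i x" using rt t' x by metis
      finally show "r i (\<tau> (2 * c) x) = r i x" .
    qed
  qed simp
  \<comment> \<open>The induction climbs from the last stage, where \<open>tot\<close> applies, to
    stage 0, which is \<open>M\<close> itself with identity projection; there only the injective map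
    \<open>F\<close> has to be removed.\<close>
  have "\<forall>x\<in>topspace E. r (m - k) (\<tau> (2 ^ k * c) x) = r (m - k) x" if "k \<le> m" for k
    using that
  proof (induction k)
    case 0
    then show ?case using tot by (simp add: r_def m_def total_proj_def)
  next
    case (Suc k)
    then have "Suc (m - Suc k) = m - k" by simp
    then show ?case using step[of "m - Suc k" "2 ^ k * c"] Suc by (simp add: mult.assoc)
  qed
  from this[of m] x have "F (\<pi> (\<tau> (2 ^ m * c) x)) = F (\<pi> x)" by (simp add: r_def)
  moreover have "\<pi> y \<in> topspace M" if "y \<in> topspace E" for y
    using \<pi> that by (metis continuous_map_image_subset_topspace image_subset_iff)
  ultimately show ?thesis
    using F(2) \<tau>_in x by (simp add: inj_on_eq_iff m_def)
qed

section \<open>The crystallographic orbit relation and separation of its quotient\<close>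

lemma Euclidean_space_eq: "Euclidean_space n = top_of_set {x. \<forall>i\<ge>n. x i = 0}"
  by (simp add: Euclidean_space_def euclidean_product_topology)

lemma in_Euclidean_space: "x \<in> topspace (Euclidean_space n) \<longleftrightarrow> (\<forall>i\<ge>n. x i = 0)"
  by (simp add: Euclidean_space_eq)

lemma continuous_on_coord [continuous_intros]:
  "continuous_on S (\<lambda>x. x i :: real)"
  by (rule continuous_on_subset[OF continuous_on_product_coordinates]) simp

text \<open>The orbit relation of the crystallographic group generated by the integral translations of the
  first \<open>d\<close> coordinates and the screw motion \<open>(v, s) \<mapsto> (-v, s + 1)\<close>.\<close>

definition flat_rel :: "nat \<Rightarrow> (nat \<Rightarrow> real) \<Rightarrow> (nat \<Rightarrow> real) \<Rightarrow> bool" where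
  "flat_rel d x y \<longleftrightarrow>
     (\<exists>n::int. y d = x d + of_int n \<and> (\<forall>j<d. y j - (if even n then x j else - x j) \<in> \<int>))"

text \<open>The \<open>n\<close>-th power of the screw motion multiplies
  \<open>sin (2 * pi * x j)\<close>, \<open>cos (pi * x d)\<close> and \<open>sin (pi * x d)\<close>
  by the same sign, so the products are invariant. Together the listed functions separate orbits,
  which provides the continuous functions for the Hausdorff property of the quotient.\<close>

lemma flat_rel_invariants:
  "flat_rel d x y \<longleftrightarrow>
     sin (2 * pi * y d) = sin (2 * pi * x d) \<and> cos (2 * pi * y d) = cos (2 * pi * x d) \<and>
     (\<forall>j<d. cos (2 * pi * y j) = cos (2 * pi * x j) \<and>
        cos (pi * y d) * sin (2 * pi * y j) = cos (pi * x d) * sin (2 * pi * x j) \<and>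
        sin (pi * y d) * sin (2 * pi * y j) = sin (pi * x d) * sin (2 * pi * x j))"
proof -
  have per: "v - u \<in> \<int> \<longleftrightarrow> sin (2 * pi * v) = sin (2 * pi * u) \<and> cos (2 * pi * v) = cos (2 * pi * u)"
    for u v :: real
  proof -
    have "v - u \<in> \<int> \<longleftrightarrow> (\<exists>n::int. v = u + of_int n)"
      by (auto simp: Ints_def algebra_simps)
    also have "\<dots> \<longleftrightarrow> (\<exists>n::int. 2 * pi * v = 2 * pi * u + 2 * pi * of_int n)"
      by (simp flip: distrib_left)
    finally show ?thesis by (simp add: sin_cos_eq_iff)
  qed
  have main: "(v - (if even n then u else - u) \<in> \<int>) \<longleftrightarrow>
      cos (2 * pi * v) = cos (2 * pi * u) \<and>
      cos (pi * s') * sin (2 * pi * v) = cos (pi * s) * sin (2 * pi * u) \<and>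
      sin (pi * s') * sin (2 * pi * v) = sin (pi * s) * sin (2 * pi * u)"
    if "s' = s + of_int n" for s s' u v :: real and n :: int
  proof -
    define e :: real where "e = (if even n then 1 else - 1)"
    have e: "e * e = 1" by (simp add: e_def)
    have c: "cos (pi * s') = e * cos (pi * s)" and si: "sin (pi * s') = e * sin (pi * s)"
      by (simp_all add: that distrib_left cos_add sin_add e_def)
    have "(v - (if even n then u else - u) \<in> \<int>) \<longleftrightarrow>
       cos (2 * pi * v) = cos (2 * pi * u) \<and> sin (2 * pi * v) = e * sin (2 * pi * u)"
      by (auto simp: per e_def)
    also have "sin (2 * pi * v) = e * sin (2 * pi * u) \<longleftrightarrow>
       cos (pi * s') * sin (2 * pi * v) = cos (pi * s) * sin (2 * pi * u) \<and>
       sin (pi * s') * sin (2 * pi * v) = sin (pi * s) * sin (2 * pi * u)" (is "?l \<longleftrightarrow> ?r")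
    proof
      assume ?l then show ?r unfolding c si using e by (simp add: algebra_simps flip: mult.assoc)
    next
      assume r: ?r
      have "e * sin (2 * pi * v) = sin (2 * pi * u)"
      \<comment> \<open>Sine and cosine of \<open>pi * s\<close> do not vanish together; whichever
        is nonzero can be cancelled.\<close>
      proof (cases "cos (pi * s) = 0")
        case True
        then have "sin (pi * s) \<noteq> 0" using sin_cos_squared_add[of "pi * s"] by auto
        then show ?thesis using r unfolding si by (simp add: algebra_simps)
      next
        case False
        then show ?thesis using r unfolding c by (simp add: algebra_simps)
      qed
      then show ?l using e by (metis mult.assoc mult_1)
    qed
    finally show ?thesis .
  qed
  have "flat_rel d x y \<longleftrightarrow> (\<exists>n::int. y d = x d + of_int n \<and>
     (\<forall>j<d. cos (2 * pi * y j) = cos (2 * pi * x j) \<and>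
        cos (pi * y d) * sin (2 * pi * y j) = cos (pi * x d) * sin (2 * pi * x j) \<and>
        sin (pi * y d) * sin (2 * pi * y j) = sin (pi * x d) * sin (2 * pi * x j)))"
    unfolding flat_rel_def using main by blast
  also have "\<dots> \<longleftrightarrow> y d - x d \<in> \<int> \<and>
     (\<forall>j<d. cos (2 * pi * y j) = cos (2 * pi * x j) \<and>
        cos (pi * y d) * sin (2 * pi * y j) = cos (pi * x d) * sin (2 * pi * x j) \<and>
        sin (pi * y d) * sin (2 * pi * y j) = sin (pi * x d) * sin (2 * pi * x j))" (is "_ \<longleftrightarrow> _ \<and> ?B")
  proof -
    have "(\<exists>n::int. y d = x d + of_int n) \<longleftrightarrow> y d - x d \<in> \<int>"
      by (auto simp: Ints_def algebra_simps)
    then show ?thesis by blast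
  qed
  finally show ?thesis unfolding per by simp
qed

lemma quotient_map_lift:
  assumes "quotient_map X Y q" "continuous_map X Z f"
    and "\<And>x y. x \<in> topspace X \<Longrightarrow> y \<in> topspace X \<Longrightarrow> q x = q y \<Longrightarrow> f x = f y"
  shows "\<exists>h. continuous_map Y Z h \<and> (\<forall>x\<in>topspace X. h (q x) = f x)"
  by (rule quotient_map_lift_exists[OF assms(1,2)], erule (2) assms(3)) blast

text \<open>A continuous real function that is constant on fibres descends to the quotient, where
  disjoint neighbourhoods of its two values pull back to disjoint open sets.\<close>

lemma Hausdorff_space_quotient_separated:
  assumes q: "quotient_map X Y q"
    and sep: "\<And>x y. x \<in> topspace X \<Longrightarrow> y \<in> topspace X \<Longrightarrow> q x \<noteq> q y \<Longrightarrow>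
      \<exists>g. continuous_map X euclideanreal g \<and> g x \<noteq> g y \<and>
        (\<forall>u\<in>topspace X. \<forall>v\<in>topspace X. q u = q v \<longrightarrow> g u = g v)"
  shows "Hausdorff_space Y"
  unfolding Hausdorff_space_def
proof (intro allI impI, elim conjE)
  fix u v assume "u \<in> topspace Y" "v \<in> topspace Y" "u \<noteq> v"
  then obtain x y where x: "x \<in> topspace X" "u = q x" and y: "y \<in> topspace X" "v = q y"
    using quotient_imp_surjective_map[OF q] by blast
  have "q x \<noteq> q y" using \<open>u \<noteq> v\<close> x y by simp
  from sep[OF x(1) y(1) this] obtain g where g: "continuous_map X euclideanreal g" "g x \<noteq> g y"
     "\<forall>u\<in>topspace X. \<forall>v\<in>topspace X. q u = q v \<longrightarrow> g u = g v"
    by (elim exE conjE) (rule that)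
  have "\<exists>h. continuous_map Y euclideanreal h \<and> (\<forall>x\<in>topspace X. h (q x) = g x)"
    using g(3) by (intro quotient_map_lift[OF q g(1)]) blast
  then obtain h where h: "continuous_map Y euclideanreal h"
      "\<And>x. x \<in> topspace X \<Longrightarrow> h (q x) = g x"
    by blast
  then obtain U V where "open U" "open V" "g x \<in> U" "g y \<in> V" "U \<inter> V = {}"
    using hausdorff[OF g(2)] by blast
  moreover have "openin Y {z \<in> topspace Y. h z \<in> W}" if "open W" for W
    using openin_continuous_map_preimage[OF h(1)] that by (metis open_openin)
  moreover have "h u = g x" "h v = g y" using h(2) x y by auto
  ultimately show "\<exists>U V. openin Y U \<and> openin Y V \<and> u \<in> U \<and> v \<in> V \<and> disjnt U V"
    using \<open>u \<in> topspace Y\<close> \<open>v \<in> topspace Y\<close>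
    by (intro exI[of _ "{z \<in> topspace Y. h z \<in> U}"] exI[of _ "{z \<in> topspace Y. h z \<in> V}"])
       (simp add: disjnt_def set_eq_iff)
qed

lemma Hausdorff_space_flat_quotient:
  assumes q: "quotient_map (Euclidean_space (Suc d)) M \<pi>"
    and fib: "\<And>x y. x \<in> topspace (Euclidean_space (Suc d)) \<Longrightarrow>
      y \<in> topspace (Euclidean_space (Suc d)) \<Longrightarrow> \<pi> x = \<pi> y \<longleftrightarrow> flat_rel d x y"
  shows "Hausdorff_space M"
proof (rule Hausdorff_space_quotient_separated[OF q])
  let ?E = "topspace (Euclidean_space (Suc d))"
  fix x y assume xy: "x \<in> ?E" "y \<in> ?E" "\<pi> x \<noteq> \<pi> y"
  \<comment> \<open>The invariants of \<open>flat_rel_invariants\<close> as a set, so that an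
    inequivalent pair yields one function that tells it apart.\<close>
  define Fs :: "((nat \<Rightarrow> real) \<Rightarrow> real) set" where "Fs =
    {\<lambda>x. sin (2 * pi * x d), \<lambda>x. cos (2 * pi * x d)} \<union>
    (\<Union>j<d. {\<lambda>x. cos (2 * pi * x j), \<lambda>x. cos (pi * x d) * sin (2 * pi * x j),
            \<lambda>x. sin (pi * x d) * sin (2 * pi * x j)})"
  have *: "flat_rel d u v \<longleftrightarrow> (\<forall>g\<in>Fs. g u = g v)" for u v
    unfolding flat_rel_invariants Fs_def by fastforce
  have "continuous_on UNIV g" if "g \<in> Fs" for g
    using that by (auto simp: Fs_def intro!: continuous_intros)
  then have "continuous_map (Euclidean_space (Suc d)) euclideanreal g" if "g \<in> Fs" for g
    using that continuous_on_subset by (fastforce simp: Euclidean_space_eq)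
  moreover obtain g where g: "g \<in> Fs" "g x \<noteq> g y"
    using xy fib[OF xy(1,2)] *[of x y] by auto
  moreover have "\<forall>u\<in>?E. \<forall>v\<in>?E. \<pi> u = \<pi> v \<longrightarrow> g u = g v"
    using fib * g(1) by auto
  ultimately show "\<exists>g. continuous_map (Euclidean_space (Suc d)) euclideanreal g \<and> g x \<noteq> g y \<and>
      (\<forall>u\<in>?E. \<forall>v\<in>?E. \<pi> u = \<pi> v \<longrightarrow> g u = g v)"
    by (intro exI[of _ g] conjI)
qed

section \<open>Free involutions and the tower of doublings\<close>

definition Z2 :: "nat monoid" where
  "Z2 = \<lparr>carrier = {0, 1}, mult = \<lambda>a b. (a + b) mod 2, one = 0\<rparr>"

lemma group_Z2: "group Z2"
  by (rule groupI) (auto simp: Z2_def mod_simps add.assoc)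

lemma finite_Z2: "finite (carrier Z2)"
  by (simp add: Z2_def)

text \<open>The maps are restricted to the space because elements of \<open>BijGroup\<close> have to
  be \<open>undefined\<close> outside it.\<close>

lemma free_continuous_action_involution:
  assumes h: "continuous_map X X h" and hh: "\<And>z. z \<in> topspace X \<Longrightarrow> h (h z) = z"
    and free: "\<And>z. z \<in> topspace X \<Longrightarrow> h z \<noteq> z"
  defines "\<phi> \<equiv> \<lambda>g::nat. restrict (if g = 0 then id else h) (topspace X)"
  shows "free_continuous_action Z2 X \<phi>"
proof -
  have h_in: "h z \<in> topspace X" if "z \<in> topspace X" for z
    using h that by (metis continuous_map_image_subset_topspace image_subset_iff)
  have "bij_betw h (topspace X) (topspace X)"
    by (rule bij_betw_byWitness[where f' = h]) (use h_in hh in auto)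
  then have \<phi>_Bij: "\<phi> g \<in> Bij (topspace X)" for g
    by (auto simp: \<phi>_def Bij_def bij_betw_restrict_eq)
  have "group_action Z2 (topspace X) \<phi>"
    unfolding group_action_def group_hom_def group_hom_axioms_def
  proof (intro conjI group_Z2 group_BijGroup homI)
    fix g assume "g \<in> carrier Z2"
    then show "\<phi> g \<in> carrier (BijGroup (topspace X))" using \<phi>_Bij by (simp add: BijGroup_def)
  next
    fix g g' assume "g \<in> carrier Z2" "g' \<in> carrier Z2"
    then show "\<phi> (g \<otimes>\<^bsub>Z2\<^esub> g') = \<phi> g \<otimes>\<^bsub>BijGroup (topspace X)\<^esub> \<phi> g'"
      using \<phi>_Bij hh h_in
      by (auto simp: BijGroup_def Z2_def \<phi>_def compose_def restrict_def fun_eq_iff)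
  qed
  moreover have "continuous_map X X (\<phi> g)" for g
    using h by (auto simp: \<phi>_def id_def intro: continuous_map_eq)
  ultimately show ?thesis
    using free unfolding free_continuous_action_def by (auto simp: Z2_def \<phi>_def)
qed

text \<open>Only a quotient map and its fibres enter, so that the result covers both the coset space
  (\<open>d = 2\<close>) and the double coset space (\<open>d = 4\<close>). The condition
  \<open>d > 0\<close> makes coordinate 0 a lattice direction, distinct from the screw coordinate
  \<open>d\<close>.\<close>

theorem flat_quotient_length:
  fixes M :: "'a topology"
  assumes q: "quotient_map (Euclidean_space (Suc d)) M \<pi>" and d: "d > 0"
    and fib: "\<And>x y. x \<in> topspace (Euclidean_space (Suc d)) \<Longrightarrow>
      y \<in> topspace (Euclidean_space (Suc d)) \<Longrightarrow> \<pi> x = \<pi> y \<longleftrightarrow> flat_rel d x y"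
  shows "iterated_length M = \<infinity>"
proof -
  let ?T = "Euclidean_space (Suc d)"
  let ?E = "topspace ?T"
  have H: "Hausdorff_space M" by (rule Hausdorff_space_flat_quotient[OF q fib])
  have \<pi>_cont: "continuous_map ?T M \<pi>" using q quotient_imp_continuous_map by blast
  have \<pi>_surj: "\<pi> ` ?E = topspace M" using q quotient_imp_surjective_map by blast
  have \<pi>_in: "\<pi> x \<in> topspace M" if "x \<in> ?E" for x using that \<pi>_surj by blast
  have cont: "continuous_map ?T ?T f" if "continuous_on UNIV f" "\<And>x. x \<in> ?E \<Longrightarrow> f x \<in> ?E" for f
    using that(2) continuous_on_subset[OF that(1)]
    by (auto simp: Euclidean_space_eq continuous_map_in_subtopology)
  have upd_cont: "continuous_on UNIV (\<lambda>x::nat\<Rightarrow>real. x(0 := g (x 0)))"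
    if "continuous_on UNIV g" for g :: "real \<Rightarrow> real"
  proof (rule continuous_on_coordinatewise_then_product)
    fix i show "continuous_on UNIV (\<lambda>x::nat\<Rightarrow>real. (x(0 := g (x 0))) i)"
      using continuous_on_compose2[OF that, of UNIV "\<lambda>x. x 0"]
      by (cases i) (auto intro!: continuous_intros)
  qed
  have upd_in: "x(0 := a) \<in> ?E" if "x \<in> ?E" for x a
    using that d by (auto simp: in_Euclidean_space)
  \<comment> \<open>Halving the lattice in direction 0 and rescaling by \<open>D\<close> gives the
    original relation again; hence \<open>D\<close> induces a projection \<open>P\<close> from
    \<open>M\<close> to \<open>M\<close>.\<close>
  define \<tau> where "\<tau> = (\<lambda>c (x::nat\<Rightarrow>real). x(0 := x 0 + c))"
  define D where "D = (\<lambda>x::nat\<Rightarrow>real. x(0 := 2 * x 0))"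
  have \<tau>_cont: "continuous_map ?T ?T (\<tau> c)" for c
    unfolding \<tau>_def by (rule cont[OF upd_cont upd_in]) (auto intro!: continuous_intros)
  have D_cont: "continuous_map ?T ?T D"
    unfolding D_def by (rule cont[OF upd_cont upd_in]) (auto intro!: continuous_intros)
  have \<tau>_in: "\<tau> c x \<in> ?E" and D_in: "D x \<in> ?E" if "x \<in> ?E" for c x
    using that upd_in by (auto simp: \<tau>_def D_def)
  \<comment> \<open>The fibres of the map induced by \<open>D\<close> are the orbits of the half
    translation, which makes \<open>P\<close> the orbit map of an involution.\<close>
  have half: "flat_rel d (D x) (D y) \<longleftrightarrow> flat_rel d x y \<or> flat_rel d (\<tau> (1/2) x) y" for x y
  proof -
    have dbl: "2 * w \<in> \<int> \<longleftrightarrow> w \<in> \<int> \<or> w + 1/2 \<in> \<int>" for w :: real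
    proof
      assume "2 * w \<in> \<int>"
      then obtain m :: int where m: "2 * w = of_int m" by (auto simp: Ints_def)
      show "w \<in> \<int> \<or> w + 1/2 \<in> \<int>"
      proof (cases "even m")
        case True
        then obtain l where "m = 2 * l" by blast
        with m have "w = of_int l" by simp
        then show ?thesis by simp
      next
        case False
        then obtain l where "m = 2 * l + 1" by (rule oddE)
        with m have "w + 1/2 = of_int (l + 1)" by simp
        then show ?thesis by (metis Ints_of_int)
      qed
    next
      assume "w \<in> \<int> \<or> w + 1/2 \<in> \<int>"
      then obtain m :: int where "w = of_int m \<or> w + 1/2 = of_int m" by (auto simp: Ints_def)
      then have "2 * w = of_int (2 * m) \<or> 2 * w = of_int (2 * m - 1)" by auto
      then show "2 * w \<in> \<int>" by (metis Ints_of_int)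
    qed
    have shift: "w + 1/2 \<in> \<int> \<longleftrightarrow> w - 1/2 \<in> \<int>" for w :: real
      using Ints_add[of "w - 1/2" 1] Ints_diff[of "w + 1/2" 1] by (auto simp: add.commute)
    \<comment> \<open>The first equivalence serves even \<open>n\<close>, the second odd
      \<open>n\<close>, where \<open>x 0\<close> enters with the opposite sign.\<close>
    have eq: "2 * v - 2 * u \<in> \<int> \<longleftrightarrow> v - u \<in> \<int> \<or> v - (u + 1/2) \<in> \<int>"
         "2 * v + 2 * u \<in> \<int> \<longleftrightarrow> v + u \<in> \<int> \<or> v - (- u - 1/2) \<in> \<int>" for u v :: real
      using dbl[of "v - u"] shift[of "v - u"] dbl[of "v + u"] by (simp_all add: algebra_simps)
    have "(\<forall>j<d. D y j - (if even n then D x j else - D x j) \<in> \<int>) \<longleftrightarrow>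
        (\<forall>j<d. y j - (if even n then x j else - x j) \<in> \<int>) \<or>
        (\<forall>j<d. y j - (if even n then \<tau> (1/2) x j else - \<tau> (1/2) x j) \<in> \<int>)" for n :: int
    proof -
      obtain d' where d': "d = Suc d'" using d by (cases d) auto
      show ?thesis
        unfolding d' All_less_Suc2 by (cases "even n") (auto simp: D_def \<tau>_def eq)
    qed
    note * = this
    have "D z d = z d" "\<tau> c z d = z d" for z c using d by (auto simp: D_def \<tau>_def)
    then show ?thesis unfolding flat_rel_def * by (simp only: conj_disj_distribL ex_disj_distrib)
  qed
  have lift: "\<exists>h. continuous_map M M h \<and> (\<forall>x\<in>?E. h (\<pi> x) = \<pi> (f x))"
    if "continuous_map ?T ?T f" and "\<And>x y. x \<in> ?E \<Longrightarrow> y \<in> ?E \<Longrightarrow> flat_rel d x y \<Longrightarrow> flat_rel d (f x) (f y)"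
    for f
  proof -
    have f_in: "f x \<in> ?E" if "x \<in> ?E" for x
      using \<open>continuous_map ?T ?T f\<close> that by (metis continuous_map_image_subset_topspace image_subset_iff)
    have c: "continuous_map ?T M (\<pi> \<circ> f)" using that(1) \<pi>_cont continuous_map_compose by blast
    have "\<exists>h. continuous_map M M h \<and> (\<forall>x\<in>?E. h (\<pi> x) = (\<pi> \<circ> f) x)"
      by (intro quotient_map_lift[OF q c]) (use fib f_in that(2) in simp_all)
    then show ?thesis by simp
  qed
  have "flat_rel d (D x) (D y)" if "flat_rel d x y" for x y using half that by simp
  from lift[OF D_cont this]
  obtain P where P_cont: "continuous_map M M P" and P: "\<And>x. x \<in> ?E \<Longrightarrow> P (\<pi> x) = \<pi> (D x)"
    by auto
  have "flat_rel d (\<tau> (1/2) x) (\<tau> (1/2) y)" if "flat_rel d x y" for x y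
  proof -
    from that obtain n where n: "y d = x d + of_int n" "\<And>j. j < d \<Longrightarrow> y j - (if even n then x j else - x j) \<in> \<int>"
      by (auto simp: flat_rel_def)
    have "y 0 + 1/2 - (if even n then x 0 + 1/2 else - (x 0 + 1/2)) \<in> \<int>"
      using n(2)[OF d] Ints_add[of "y 0 + x 0" 1] by (auto simp: algebra_simps)
    then show ?thesis using n d unfolding flat_rel_def \<tau>_def by (intro exI[of _ n]) auto
  qed
  from lift[OF \<tau>_cont this]
  obtain h where h_cont: "continuous_map M M h" and h: "\<And>x. x \<in> ?E \<Longrightarrow> h (\<pi> x) = \<pi> (\<tau> (1/2) x)"
    by auto
  have one: "\<pi> (\<tau> 1 x) = \<pi> x" if "x \<in> ?E" for x
    using d that \<tau>_in by (subst eq_commute) (auto simp: fib flat_rel_def \<tau>_def intro!: exI[of _ 0])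
  \<comment> \<open>A translation keeps coordinate \<open>d\<close>, so the relation can only hold
    with \<open>n = 0\<close>. In particular the half translation has no fixed points on
    \<open>M\<close>.\<close>
  have \<tau>_eq: "\<pi> (\<tau> c x) = \<pi> x \<longleftrightarrow> c \<in> \<int>" if "x \<in> ?E" for c x
    using d that \<tau>_in by (subst eq_commute) (auto simp: fib flat_rel_def \<tau>_def intro!: exI[of _ 0])
  have hh: "h (h z) = z" if z: "z \<in> topspace M" for z
  proof -
    obtain x where x: "x \<in> ?E" "z = \<pi> x" using z \<pi>_surj by blast
    have "\<tau> (1/2) (\<tau> (1/2) x) = \<tau> 1 x" by (simp add: \<tau>_def fun_eq_iff)
    then show ?thesis using h \<tau>_in one x by simp
  qed
  have half_not_int: "(1/2::real) \<notin> \<int>"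
  proof
    assume "(1/2::real) \<in> \<int>"
    then obtain n :: int where "(1/2::real) = of_int n" by (auto simp: Ints_def)
    then have "of_int (2 * n) = (1::real)" by simp
    then have "2 * n = 1" by linarith
    then show False by presburger
  qed
  have h_free: "h z \<noteq> z" if z: "z \<in> topspace M" for z
  proof -
    obtain x where x: "x \<in> ?E" "z = \<pi> x" using z \<pi>_surj by blast
    then show ?thesis using h \<tau>_eq half_not_int by auto
  qed
  define \<phi> where "\<phi> \<equiv> \<lambda>g::nat. restrict (if g = 0 then id else h) (topspace M)"
  have act: "free_continuous_action Z2 M \<phi>"
    unfolding \<phi>_def by (rule free_continuous_action_involution[OF h_cont hh h_free])
  \<comment> \<open>\<open>P\<close> after \<open>\<pi>\<close> equals \<open>\<pi>\<close> after
    the homeomorphism \<open>D\<close>, and a map is a quotient map if such a composite is.\<close>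
  have P_quot: "quotient_map M M P"
  proof (rule quotient_map_from_composition[OF \<pi>_cont P_cont])
    define D' where "D' = (\<lambda>x::nat\<Rightarrow>real. x(0 := x 0 / 2))"
    have D'_cont: "continuous_map ?T ?T D'"
      unfolding D'_def by (rule cont[OF upd_cont upd_in]) (auto intro!: continuous_intros)
    have "homeomorphic_maps ?T ?T D D'"
      using D_cont D'_cont by (auto simp: homeomorphic_maps_def D_def D'_def)
    then have "quotient_map ?T M (\<pi> \<circ> D)"
      using q homeomorphic_map_maps homeomorphic_map_def quotient_map_compose by blast
    then show "quotient_map ?T M (P \<circ> \<pi>)"
      by (rule quotient_map_eq) (simp add: P)
  qed
  have om: "orbit_map Z2 M \<phi> M P"
    unfolding orbit_map_def
  proof (intro conjI P_quot ballI)
    fix u v assume u: "u \<in> topspace M" and v: "v \<in> topspace M"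
    obtain x y where x: "x \<in> ?E" "u = \<pi> x" and y: "y \<in> ?E" "v = \<pi> y" using u v \<pi>_surj by blast
    have "P u = P v \<longleftrightarrow> \<pi> x = \<pi> y \<or> \<pi> (\<tau> (1/2) x) = \<pi> y"
      using x y by (simp add: P fib D_in \<tau>_in half)
    then have "P u = P v \<longleftrightarrow> v = u \<or> v = h u"
      using x y h by auto
    also have "\<dots> \<longleftrightarrow> v \<in> orbit Z2 \<phi> u"
      using u by (auto simp: orbit_def Z2_def \<phi>_def)
    finally show "P u = P v \<longleftrightarrow> v \<in> orbit Z2 \<phi> u" .
  qed
  define tower :: "nat \<Rightarrow> 'a iterated_action" where
    "tower k = \<lparr>groups = replicate k Z2, stage = \<lambda>_. M, action = \<lambda>_. \<phi>, proj = \<lambda>_. P\<rparr>" for k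
  \<comment> \<open>An iterated action has at least one group, hence \<open>Suc k\<close>.\<close>
  have tower_free: "free_iterated_action M (tower (Suc k))" for k
    using act om group_Z2 finite_Z2
    by (auto simp: free_iterated_action_def tower_def simp del: replicate_Suc)
  have "proj_upto (tower k) i (\<pi> x) = \<pi> (x(0 := 2 ^ i * x 0)) \<and> x(0 := 2 ^ i * x 0) \<in> ?E"
    if "x \<in> ?E" for k i x
    using that by (induction i) (auto simp: P upd_in D_def mult.assoc tower_def)
  then have tower_total: "total_proj (tower k) (\<pi> x) = \<pi> (x(0 := 2 ^ k * x 0))" if "x \<in> ?E" for k x
    using that by (simp add: total_proj_def tower_def)
  \<comment> \<open>\<open>t 1\<close> is the screw motion and \<open>t (-1)\<close> its
    inverse.\<close>
  define t where "t = (\<lambda>e (x::nat\<Rightarrow>real) i. if i < d then - x i else if i = d then x d + e else 0)"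
  have t_in: "t e x \<in> ?E" for e x by (auto simp: t_def in_Euclidean_space)
  \<comment> \<open>With \<open>c = 1 / 2 ^ k\<close> and \<open>m\<close> groups,
    \<open>commutator_descends\<close> makes \<open>2 ^ m / 2 ^ k\<close> an integer; for
    \<open>m < k\<close> it lies strictly between 0 and 1.\<close>
  have len: "k \<le> length (groups b)"
    if b: "free_iterated_action M b" and eq: "equivalent_actions M (tower k) b" for k b
  proof (rule ccontr)
    assume "\<not> k \<le> length (groups b)"
    obtain f F where F: "homeomorphic_map M M F"
      and fF: "\<And>z. z \<in> topspace M \<Longrightarrow> total_proj b (F z) = f (total_proj (tower k) z)"
      using eq by (auto simp: equivalent_actions_def)
    define m where "m = length (groups b)"
    have "\<pi> (\<tau> (2 ^ m * (1 / 2 ^ k)) (\<lambda>_. 0)) = \<pi> (\<lambda>_. 0)"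
      unfolding m_def
    proof (rule commutator_descends[OF connected_Euclidean_space \<pi>_cont H b, where t = "t 1" and t' = "t (-1)"])
      show "continuous_map M M F" "inj_on F (topspace M)"
        using F homeomorphic_eq_everything_map by blast+
      fix c x assume x: "x \<in> ?E"
      show "\<pi> (t 1 x) = \<pi> x"
        using x t_in by (subst eq_commute) (auto simp: fib flat_rel_def t_def intro!: exI[of _ 1])
      show "t 1 (\<tau> c x) = \<tau> (- c) (t 1 x)"
        using x d by (auto simp: t_def \<tau>_def)
      show "t (- 1) x \<in> ?E \<and> t 1 (t (- 1) x) = x"
        using x t_in by (auto simp: t_def in_Euclidean_space fun_eq_iff)
      \<comment> \<open>The \<open>k\<close> doublings of the tower stretch the translation by
        \<open>1 / 2 ^ k\<close> to the integral translation by 1.\<close>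
      have "\<pi> ((\<tau> (1 / 2 ^ k) x)(0 := 2 ^ k * \<tau> (1 / 2 ^ k) x 0)) = \<pi> (\<tau> 1 (x(0 := 2 ^ k * x 0)))"
        by (simp add: \<tau>_def distrib_left)
      then show "total_proj b (F (\<pi> (\<tau> (1 / 2 ^ k) x))) = total_proj b (F (\<pi> x))"
        using x fF[OF \<pi>_in] \<tau>_in tower_total one upd_in by simp
    next
      fix c c' x
      show "continuous_map ?T ?T (\<tau> c)" by (rule \<tau>_cont)
      show "\<tau> c (\<tau> c' x) = \<tau> (c + c') x" "\<tau> 0 x = x" by (simp_all add: \<tau>_def fun_eq_iff)
      show "t 1 x \<in> ?E" by (rule t_in)
      show "(\<lambda>_. 0) \<in> ?E" by (simp add: in_Euclidean_space)
    qed
    then have "2 ^ m * (1 / 2 ^ k) \<in> (\<int>::real set)" using \<tau>_eq by (simp add: in_Euclidean_space)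
    then obtain n :: int where n: "2 ^ m / 2 ^ k = (of_int n :: real)" by (auto simp: Ints_def)
    have "(0::real) < 2 ^ m / 2 ^ k" "2 ^ m / 2 ^ k < (1::real)"
      using \<open>\<not> k \<le> length (groups b)\<close> by (auto simp: m_def)
    then show False unfolding n by simp
  qed
  have "k \<le> action_length M (tower k)" if "free_iterated_action M (tower k)" for k
  proof -
    have "equivalent_actions M (tower k) (tower k)"
      unfolding equivalent_actions_def by (intro exI[of _ id]) auto
    then have "\<exists>m b. free_iterated_action M b \<and> equivalent_actions M (tower k) b \<and> length (groups b) = m"
      using that by blast
    from LeastI_ex[OF this] show ?thesis using len unfolding action_length_def by metis
  qed
  then have "enat (Suc k) \<le> iterated_length M" for k
    unfolding iterated_length_def using tower_free
    by (intro SUP_upper2[where i = "tower (Suc k)"]) auto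
  then show ?thesis
    by (metis enat_ord_simps(1) not_less_eq_eq order_refl enat.exhaust)
qed

section \<open>Smooth functions\<close>

lemma upd_continuous: "continuous_on UNIV (\<lambda>t::real. x(i := t))"
proof (rule continuous_on_coordinatewise_then_product)
  fix j show "continuous_on UNIV (\<lambda>t. (x(i := t)) j)"
    by (cases "j = i") (auto intro: continuous_intros)
qed

text \<open>An update at an index below \<open>n\<close> stays in the Euclidean space, so a
  relatively open \<open>U\<close> contains it for \<open>t\<close> near \<open>x i\<close>. Partial
  derivatives at points of \<open>U\<close> therefore depend only on values in
  \<open>U\<close>.\<close>

lemma eventually_upd_in:
  assumes U: "openin (Euclidean_space n) U" and i: "i < n" and x: "x \<in> U"
  shows "eventually (\<lambda>t. x(i := t) \<in> U) (nhds (x i))"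
proof -
  obtain W where W: "open W" "U = W \<inter> {x. \<forall>i\<ge>n. x i = 0}"
    using U by (auto simp: Euclidean_space_eq openin_open)
  have "open ((\<lambda>t. x(i := t)) -` W)"
    by (rule open_vimage[OF W(1) upd_continuous])
  moreover have "x i \<in> (\<lambda>t. x(i := t)) -` W" using x W by simp
  ultimately have "eventually (\<lambda>t. t \<in> (\<lambda>t. x(i := t)) -` W) (nhds (x i))"
    by (rule eventually_nhds_in_open)
  then show ?thesis
    by eventually_elim (use x i W in auto)
qed

lemma Ck_on_continuous:
  "Ck_on n k U f \<Longrightarrow> continuous_map (subtopology (Euclidean_space n) U) euclideanreal f"
  by (cases k) auto

lemma Ck_on_Suc: "Ck_on n (Suc k) U f \<Longrightarrow> Ck_on n k U f"
  by (induction k arbitrary: f) auto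

text \<open>\<open>partial_derivative\<close> refers to functions on all sequences; openness of
  \<open>U\<close> makes it local, so agreement on \<open>U\<close> passes to all orders.\<close>

lemma Ck_on_cong:
  assumes U: "openin (Euclidean_space n) U" and eq: "\<And>x. x \<in> U \<Longrightarrow> f x = g x" and "Ck_on n k U f"
  shows "Ck_on n k U g"
  using eq assms(3)
proof (induction k arbitrary: f g)
  case 0
  then show ?case
    by (auto intro: continuous_map_eq)
next
  case (Suc k)
  have ev: "eventually (\<lambda>t. f (x(i := t)) = g (x(i := t))) (nhds (x i))" if "x \<in> U" "i < n" for x i
    using eventually_upd_in[OF U that(2,1)] by eventually_elim (rule Suc.prems(1))
  have "continuous_map (subtopology (Euclidean_space n) U) euclideanreal g"
    using Suc.prems by (auto intro: continuous_map_eq)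
  moreover have "(\<lambda>t. g (x(i := t))) field_differentiable at (x i)"
      "partial_derivative i f x = partial_derivative i g x" if "i < n" "x \<in> U" for i x
  proof -
    have "(\<lambda>t. f (x(i := t))) field_differentiable at (x i)" using Suc.prems that by auto
    then obtain D where "((\<lambda>t. f (x(i := t))) has_real_derivative D) (at (x i))"
      unfolding field_differentiable_def by blast
    then have D: "((\<lambda>t. g (x(i := t))) has_real_derivative D) (at (x i))"
      using DERIV_cong_ev[OF refl ev[OF that(2,1)] refl] by simp
    then show "(\<lambda>t. g (x(i := t))) field_differentiable at (x i)"
      unfolding field_differentiable_def by blast
    show "partial_derivative i f x = partial_derivative i g x"
      unfolding partial_derivative_def using deriv_cong_ev[OF ev[OF that(2,1)] refl] .
  qed
  ultimately show ?case
    using Suc.prems(2) Suc.IH by (simp only: Ck_on.simps) blast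
qed

text \<open>Candidates \<open>f'\<close> for the partial derivatives replace the terms built with
  \<open>deriv\<close>; the two agree on \<open>U\<close>, which suffices by
  \<open>Ck_on_cong\<close>.\<close>

lemma Ck_onI_derivatives:
  assumes U: "openin (Euclidean_space n) U"
    and cont: "continuous_map (subtopology (Euclidean_space n) U) euclideanreal f"
    and D: "\<And>i x. i < n \<Longrightarrow> x \<in> U \<Longrightarrow> ((\<lambda>t. f (x(i := t))) has_real_derivative f' i x) (at (x i))"
    and f': "\<And>i. i < n \<Longrightarrow> Ck_on n k U (f' i)"
  shows "Ck_on n (Suc k) U f"
proof -
  have "partial_derivative i f x = f' i x" if "i < n" "x \<in> U" for i x
    using D[OF that] by (simp add: partial_derivative_def DERIV_imp_deriv)
  then have "Ck_on n k U (partial_derivative i f)" if "i < n" for i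
    using that by (intro Ck_on_cong[OF U _ f'[OF that]]) auto
  then show ?thesis
    using cont D by (auto simp: field_differentiable_def)
qed

lemma Ck_on_SucD:
  assumes "Ck_on n (Suc k) U f" "i < n"
  shows "\<And>x. x \<in> U \<Longrightarrow> ((\<lambda>t. f (x(i := t))) has_real_derivative partial_derivative i f x) (at (x i))"
    and "Ck_on n k U (partial_derivative i f)"
  using assms by (auto simp: partial_derivative_def DERIV_deriv_iff_field_differentiable)

lemma Ck_on_const: "openin (Euclidean_space n) U \<Longrightarrow> Ck_on n k U (\<lambda>_. c)"
proof (induction k arbitrary: c)
  case (Suc k)
  then show ?case by (intro Ck_onI_derivatives[where f' = "\<lambda>_ _. 0"]) auto
qed auto

lemma Ck_on_coord:
  assumes "openin (Euclidean_space n) U"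
  shows "Ck_on n k U (\<lambda>x. x j)"
proof -
  have c: "continuous_map (subtopology (Euclidean_space n) U) euclideanreal (\<lambda>x. x j)"
    by (auto simp: Euclidean_space_eq subtopology_subtopology intro: continuous_intros)
  show ?thesis
  proof (cases k)
    case 0 then show ?thesis using c by simp
  next
    case (Suc k')
    have "((\<lambda>t. (x(i := t)) j) has_real_derivative (if i = j then 1 else 0)) (at (x i))" for i and x :: "nat \<Rightarrow> real"
      by (cases "i = j") (auto intro!: derivative_eq_intros)
    then show ?thesis
      unfolding Suc by (intro Ck_onI_derivatives[where f' = "\<lambda>i _. if i = j then 1 else 0"] assms c Ck_on_const)
  qed
qed

lemma Ck_on_add:
  assumes U: "openin (Euclidean_space n) U"
  shows "Ck_on n k U f \<Longrightarrow> Ck_on n k U g \<Longrightarrow> Ck_on n k U (\<lambda>x. f x + g x)"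
proof (induction k arbitrary: f g)
  case (Suc k)
  have "continuous_map (subtopology (Euclidean_space n) U) euclideanreal (\<lambda>x. f x + g x)"
    using Suc.prems by (intro continuous_intros Ck_on_continuous)
  then show ?case
    using Suc.prems
    by (intro Ck_onI_derivatives[where f' = "\<lambda>i x. partial_derivative i f x + partial_derivative i g x"]
          U Suc.IH) (auto intro!: derivative_intros dest: Ck_on_SucD simp del: Ck_on.simps fun_upd_apply)
qed (auto intro: continuous_intros)

lemma Ck_on_mult:
  assumes U: "openin (Euclidean_space n) U"
  shows "Ck_on n k U f \<Longrightarrow> Ck_on n k U g \<Longrightarrow> Ck_on n k U (\<lambda>x. f x * g x)"
proof (induction k arbitrary: f g)
  case (Suc k)
  have "continuous_map (subtopology (Euclidean_space n) U) euclideanreal (\<lambda>x. f x * g x)"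
    using Suc.prems by (intro continuous_intros Ck_on_continuous)
  moreover have "((\<lambda>t. f (x(i := t)) * g (x(i := t))) has_real_derivative
      f x * partial_derivative i g x + partial_derivative i f x * g x) (at (x i))"
    if "i < n" "x \<in> U" for i x
    using DERIV_mult'[OF Ck_on_SucD(1)[OF Suc.prems(1) that] Ck_on_SucD(1)[OF Suc.prems(2) that]]
    by (simp only: fun_upd_triv)
  ultimately show ?case
    using Suc.prems
    by (intro Ck_onI_derivatives[where f' = "\<lambda>i x. f x * partial_derivative i g x + partial_derivative i f x * g x"]
          U Ck_on_add Suc.IH) (blast dest: Ck_on_SucD(2) Ck_on_Suc)+
qed (auto intro: continuous_intros)

text \<open>Sequences of successive derivatives turn the chain rule into an induction on the order.\<close>

lemma Ck_on_compose:
  assumes U: "openin (Euclidean_space n) U" and fS: "\<And>x. x \<in> U \<Longrightarrow> f x \<in> S"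
    and h: "\<And>j t. t \<in> S \<Longrightarrow> (h j has_real_derivative h (Suc j) t) (at t)"
  shows "Ck_on n k U f \<Longrightarrow> Ck_on n k U (\<lambda>x. h j (f x))"
proof (induction k arbitrary: j)
  have c: "continuous_map (subtopology (Euclidean_space n) U) euclideanreal (\<lambda>x. h j (f x))"
    if "continuous_map (subtopology (Euclidean_space n) U) euclideanreal f" for j
  proof -
    have "continuous_on S (h j)" using h DERIV_continuous_on[of S "h j" "h (Suc j)"]
      by (meson DERIV_isCont continuous_at_imp_continuous_on)
    moreover have "continuous_map (subtopology (Euclidean_space n) U) (top_of_set S) f"
      using that fS by (auto simp: continuous_map_in_subtopology)
    ultimately show ?thesis
      using continuous_map_compose[of _ "top_of_set S" f euclideanreal "h j"] by (simp add: o_def)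
  qed
  {
    case 0
    then show ?case using c by simp
  next
    case (Suc k)
    have "((\<lambda>t. h j (f (x(i := t)))) has_real_derivative h (Suc j) (f x) * partial_derivative i f x) (at (x i))"
      if "i < n" "x \<in> U" for i x
    proof (rule DERIV_chain2[OF _ Ck_on_SucD(1)[OF Suc.prems that]])
      show "(h j has_real_derivative h (Suc j) (f x)) (at (f (x(i := x i))))"
        using h[OF fS[OF that(2)]] by (simp only: fun_upd_triv)
    qed
    moreover have "Ck_on n k U (\<lambda>x. h (Suc j) (f x) * partial_derivative i f x)" if "i < n" for i
      using Suc.IH[OF Ck_on_Suc[OF Suc.prems]] Ck_on_SucD(2)[OF Suc.prems that]
      by (intro Ck_on_mult U)
    ultimately show ?case
      using c[OF Ck_on_continuous[OF Suc.prems]]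
      by (intro Ck_onI_derivatives[where f' = "\<lambda>i x. h (Suc j) (f x) * partial_derivative i f x"] U)
  }
qed

text \<open>Openness of the domain is included so that the rules for sums, products and composites
  carry it along.\<close>

definition smooth_fun :: "nat \<Rightarrow> (nat \<Rightarrow> real) set \<Rightarrow> ((nat \<Rightarrow> real) \<Rightarrow> real) \<Rightarrow> bool" where
  "smooth_fun n U f \<longleftrightarrow> openin (Euclidean_space n) U \<and> (\<forall>k. Ck_on n k U f)"

lemma smooth_fun_cong: "smooth_fun n U f \<Longrightarrow> (\<And>x. x \<in> U \<Longrightarrow> f x = g x) \<Longrightarrow> smooth_fun n U g"
  unfolding smooth_fun_def using Ck_on_cong by blast

lemma smooth_fun_const: "openin (Euclidean_space n) U \<Longrightarrow> smooth_fun n U (\<lambda>_. c)"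
  and smooth_fun_coord: "openin (Euclidean_space n) U \<Longrightarrow> smooth_fun n U (\<lambda>x. x j)"
  and smooth_fun_add: "smooth_fun n U f \<Longrightarrow> smooth_fun n U g \<Longrightarrow> smooth_fun n U (\<lambda>x. f x + g x)"
  and smooth_fun_mult: "smooth_fun n U f \<Longrightarrow> smooth_fun n U g \<Longrightarrow> smooth_fun n U (\<lambda>x. f x * g x)"
  by (auto simp: smooth_fun_def Ck_on_const Ck_on_coord Ck_on_add Ck_on_mult)

lemma smooth_fun_uminus: "smooth_fun n U f \<Longrightarrow> smooth_fun n U (\<lambda>x. - f x)"
  using smooth_fun_mult[OF smooth_fun_const[of n U "-1"], of f] by (simp add: smooth_fun_def)

lemma smooth_fun_diff: "smooth_fun n U f \<Longrightarrow> smooth_fun n U g \<Longrightarrow> smooth_fun n U (\<lambda>x. f x - g x)"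
  using smooth_fun_add[OF _ smooth_fun_uminus, of n U f g] by simp

lemma smooth_fun_compose:
  assumes "\<And>j t. t \<in> S \<Longrightarrow> (h j has_real_derivative h (Suc j) t) (at t)"
    and "smooth_fun n U f" "\<And>x. x \<in> U \<Longrightarrow> f x \<in> S"
  shows "smooth_fun n U (\<lambda>x. h 0 (f x))"
  using assms Ck_on_compose[where h = h and S = S and f = f and j = 0] unfolding smooth_fun_def by blast

text \<open>The \<open>j\<close>-th derivative of the sine is the sine shifted by
  \<open>j * (pi / 2)\<close>, which supplies the sequence for the chain rule; the cosine is the
  first shift.\<close>

lemma smooth_fun_sin_cos:
  assumes "smooth_fun n U f"
  shows "smooth_fun n U (\<lambda>x. sin (f x))" "smooth_fun n U (\<lambda>x. cos (f x))"
proof -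
  have "((\<lambda>t. sin (t + real j * (pi / 2))) has_real_derivative sin (t + real (Suc j) * (pi / 2))) (at t)" for j t
  proof -
    have "cos (t + real j * (pi / 2)) = sin (t + real j * (pi / 2) + pi / 2)"
      by (simp add: sin_add)
    also have "t + real j * (pi / 2) + pi / 2 = t + real (Suc j) * (pi / 2)"
      by (simp add: algebra_simps)
    finally show ?thesis
      by (auto intro!: derivative_eq_intros)
  qed
  from smooth_fun_compose[where S = UNIV and h = "\<lambda>j t. sin (t + real j * (pi / 2))", OF this]
  have *: "smooth_fun n U (\<lambda>x. sin (g x))" if "smooth_fun n U g" for g
    using that by simp
  show "smooth_fun n U (\<lambda>x. sin (f x))" using * assms .
  have "smooth_fun n U (\<lambda>x. sin (f x + pi / 2))"
    using assms by (intro * smooth_fun_add smooth_fun_const) (auto simp: smooth_fun_def)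
  then show "smooth_fun n U (\<lambda>x. cos (f x))" by (simp add: sin_add)
qed

text \<open>On the positive reals the successive derivatives of the square root are the powers with
  exponent \<open>1/2 - j\<close>, with falling factorials of \<open>1/2\<close> as coefficients.
  The hemisphere chart of the 3-sphere relies on this.\<close>

lemma smooth_fun_sqrt:
  assumes "smooth_fun n U f" and "\<And>x. x \<in> U \<Longrightarrow> f x > 0"
  shows "smooth_fun n U (\<lambda>x. sqrt (f x))"
proof -
  define h where "h = (\<lambda>j t. (\<Prod>i<j. 1/2 - real i) * t powr (1/2 - real j))"
  have "(h j has_real_derivative h (Suc j) t) (at t)" if "t \<in> {0<..}" for j t
    using that unfolding h_def by (auto intro!: derivative_eq_intros simp: algebra_simps)
  from smooth_fun_compose[where S = "{0<..}" and h = h, OF this assms(1)] assms(2)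
  have "smooth_fun n U (\<lambda>x. h 0 (f x))" by simp
  then show ?thesis
    by (rule smooth_fun_cong) (use assms(2) in \<open>simp add: h_def powr_half_sqrt less_imp_le\<close>)
qed

section \<open>Lie groups with a chart at the identity\<close>

lemma Ck_on_subset:
  assumes "V \<subseteq> U"
  shows "Ck_on n k U f \<Longrightarrow> Ck_on n k V f"
  using assms by (induction k arbitrary: f) (auto intro: continuous_map_from_subtopology_mono)

text \<open>The condition does not depend on the point: it is the case distinction on the coordinate
  index in maps defined coordinate by coordinate.\<close>

lemma smooth_fun_If:
  "(P \<Longrightarrow> smooth_fun n U f) \<Longrightarrow> (\<not> P \<Longrightarrow> smooth_fun n U g) \<Longrightarrow>
     smooth_fun n U (\<lambda>z. if P then f z else g z)"
  by (cases P) simp_all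

lemma second_countable_euclidean:
  "second_countable (euclidean :: 'a::second_countable_topology topology)"
proof -
  obtain B :: "'a set set" where "countable B" "\<And>C. C \<in> B \<Longrightarrow> open C"
    "\<And>S. open S \<Longrightarrow> \<exists>U. U \<subseteq> B \<and> S = \<Union>U"
    using univ_second_countable by blast
  moreover from this have "\<exists>C\<in>B. x \<in> C \<and> C \<subseteq> S" if "open S" "x \<in> S" for S x
    using that by (metis Union_iff Union_upper subsetD)
  ultimately show ?thesis unfolding second_countable_def by (intro exI[of _ B]) auto
qed

text \<open>All coordinates are tested, without a target dimension, because group elements live in
  the ambient sequence space rather than in an open subset of some Euclidean space.\<close>

abbreviation smooth_coords :: "nat \<Rightarrow> (nat \<Rightarrow> real) set \<Rightarrow> ((nat \<Rightarrow> real) \<Rightarrow> nat \<Rightarrow> real) \<Rightarrow> bool" where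
  "smooth_coords m W F \<equiv> \<forall>i. smooth_fun m W (\<lambda>z. F z i)"

lemma smooth_fun_subset:
  "smooth_fun m W f \<Longrightarrow> openin (Euclidean_space m) W' \<Longrightarrow> W' \<subseteq> W \<Longrightarrow> smooth_fun m W' f"
  using Ck_on_subset by (auto simp: smooth_fun_def)

lemma smooth_map_onI: "smooth_coords m W F \<Longrightarrow> smooth_map_on m n W F"
  by (simp add: smooth_map_on_def smooth_fun_def)

lemma smooth_coords_cong:
  "smooth_coords m W F \<Longrightarrow> (\<And>z. z \<in> W \<Longrightarrow> F z = G z) \<Longrightarrow> smooth_coords m W G"
  by (metis smooth_fun_cong)

lemma smooth_coords_continuous_on:
  assumes "smooth_coords m W F"
  shows "continuous_on W F"
proof (rule continuous_on_coordinatewise_then_product)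
  fix i
  have W: "W \<subseteq> {x. \<forall>i\<ge>m. x i = 0}"
    using assms openin_subset[of "Euclidean_space m" W] by (auto simp: smooth_fun_def Euclidean_space_eq)
  have "Ck_on m 0 W (\<lambda>z. F z i)" using assms unfolding smooth_fun_def by blast
  then show "continuous_on W (\<lambda>z. F z i)"
    using W by (simp add: Euclidean_space_eq subtopology_subtopology Int_absorb1)
qed

text \<open>Chart overlaps and the domains of multiplication and inversion in coordinates are such
  preimages, and smoothness on them includes openness.\<close>

lemma smooth_coords_openin_preimage:
  assumes F: "smooth_coords m W F" and X: "F ` W \<subseteq> X" and O: "openin (top_of_set X) S"
  shows "openin (Euclidean_space m) {z \<in> W. F z \<in> S}"
proof -
  have W: "openin (Euclidean_space m) W" using F by (simp add: smooth_fun_def)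
  have "openin (top_of_set W) (W \<inter> F -` S)"
    using smooth_coords_continuous_on[OF F] X O by (metis continuous_openin_preimage image_subset_iff_funcset)
  moreover have "W \<inter> F -` S = {z \<in> W. F z \<in> S}" by auto
  ultimately show ?thesis
    using W openin_trans by (auto simp: Euclidean_space_eq)
qed

text \<open>The left translates of the chart \<open>\<phi>\<close> at the identity, with inverse \<open>\<psi>\<close>, form the atlas. Smoothness is
  expressed through composition with arbitrary smooth families of points, so that it can be
  checked coordinatewise in the ambient sequence space.\<close>

locale coordinate_lie_group = group G
  for G :: "(nat \<Rightarrow> real, 'b) monoid_scheme" (structure) +
  fixes n :: nat and U V :: "(nat \<Rightarrow> real) set" and \<phi> \<psi> \<iota> :: "(nat \<Rightarrow> real) \<Rightarrow> nat \<Rightarrow> real"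
  assumes mult_cont: "continuous_on (carrier G \<times> carrier G) (\<lambda>(x, y). x \<otimes> y)"
    and \<iota>_cont: "continuous_on (carrier G) \<iota>"
    and \<iota>: "x \<in> carrier G \<Longrightarrow> inv x = \<iota> x"
    and U: "openin (top_of_set (carrier G)) U" "\<one> \<in> U"
    and V: "openin (Euclidean_space n) V"
    and \<phi>_cont: "continuous_on U \<phi>" and \<phi>_in: "x \<in> U \<Longrightarrow> \<phi> x \<in> V"
    and \<psi>_in: "y \<in> V \<Longrightarrow> \<psi> y \<in> U"
    and \<psi>\<phi>: "x \<in> U \<Longrightarrow> \<psi> (\<phi> x) = x" and \<phi>\<psi>: "y \<in> V \<Longrightarrow> \<phi> (\<psi> y) = y"
    and smooth_mult: "smooth_coords m W f \<Longrightarrow> smooth_coords m W g \<Longrightarrow> f ` W \<subseteq> carrier G \<Longrightarrow>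
      g ` W \<subseteq> carrier G \<Longrightarrow> smooth_coords m W (\<lambda>z. f z \<otimes> g z)"
    and smooth_\<iota>: "smooth_coords m W f \<Longrightarrow> f ` W \<subseteq> carrier G \<Longrightarrow> smooth_coords m W (\<lambda>z. \<iota> (f z))"
    and smooth_\<phi>: "smooth_coords m W f \<Longrightarrow> f ` W \<subseteq> U \<Longrightarrow> smooth_coords m W (\<lambda>z. \<phi> (f z))"
    and smooth_\<psi>: "smooth_coords m W f \<Longrightarrow> f ` W \<subseteq> V \<Longrightarrow> smooth_coords m W (\<lambda>z. \<psi> (f z))"
begin

text \<open>The domain is the left translate of \<open>U\<close> by \<open>g\<close>, and the
  inverse chart sends \<open>y\<close> to \<open>g \<otimes> \<psi> y\<close>.\<close>

definition "tchart g = ({x \<in> carrier G. inv g \<otimes> x \<in> U}, \<lambda>x. \<phi> (inv g \<otimes> x))"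

lemma U_sub: "U \<subseteq> carrier G"
  using openin_subset[OF U(1)] by simp

lemma V_sub: "V \<subseteq> topspace (Euclidean_space n)"
  using openin_subset[OF V] .

lemma \<psi>_carrier [simp]: "y \<in> V \<Longrightarrow> \<psi> y \<in> carrier G"
  using \<psi>_in U_sub by blast

lemma inv_mult_cancel [simp]:
  "g \<in> carrier G \<Longrightarrow> x \<in> carrier G \<Longrightarrow> inv g \<otimes> (g \<otimes> x) = x"
  "g \<in> carrier G \<Longrightarrow> x \<in> carrier G \<Longrightarrow> g \<otimes> (inv g \<otimes> x) = x"
  by (simp_all flip: m_assoc)

lemma tchart_inv_in: "g \<in> carrier G \<Longrightarrow> y \<in> V \<Longrightarrow> g \<otimes> \<psi> y \<in> fst (tchart g)"
  by (simp add: tchart_def \<psi>_in)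

lemma snd_tchart_inv: "g \<in> carrier G \<Longrightarrow> y \<in> V \<Longrightarrow> snd (tchart g) (g \<otimes> \<psi> y) = y"
  by (simp add: tchart_def \<phi>\<psi>)

lemma tchart_inv_snd: "g \<in> carrier G \<Longrightarrow> x \<in> fst (tchart g) \<Longrightarrow> g \<otimes> \<psi> (snd (tchart g) x) = x"
  by (auto simp: tchart_def \<psi>\<phi>)

lemma snd_tchart_in: "x \<in> fst (tchart g) \<Longrightarrow> snd (tchart g) x \<in> V"
  by (auto simp: tchart_def \<phi>_in)

lemma tchart_imageI:
  assumes "g \<in> carrier G" "y \<in> V" "g \<otimes> \<psi> y \<in> S" shows "y \<in> snd (tchart g) ` S"
  by (rule image_eqI[where x = "g \<otimes> \<psi> y"]) (simp_all add: snd_tchart_inv assms)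

lemma chart_image_tchart: "g \<in> carrier G \<Longrightarrow> chart_image (tchart g) = V"
  using snd_tchart_in by (auto intro: tchart_imageI tchart_inv_in)

lemma chart_inv_tchart:
  assumes "g \<in> carrier G" "y \<in> V" shows "chart_inv (tchart g) y = g \<otimes> \<psi> y"
proof (rule inv_into_f_eq)
  show "inj_on (snd (tchart g)) (fst (tchart g))"
    using tchart_inv_snd[OF assms(1)] by (metis inj_onI)
qed (use assms tchart_inv_in snd_tchart_inv in auto)

lemma translate_cont: "g \<in> carrier G \<Longrightarrow> continuous_on (carrier G) (\<lambda>x. g \<otimes> x)"
  using continuous_on_compose2[OF mult_cont continuous_on_Pair[OF continuous_on_const continuous_on_id]]
  by auto

lemma openin_tchart: "g \<in> carrier G \<Longrightarrow> openin (top_of_set (carrier G)) (fst (tchart g))"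
proof -
  assume g: "g \<in> carrier G"
  have "openin (top_of_set (carrier G)) (carrier G \<inter> (\<lambda>x. inv g \<otimes> x) -` U)"
    using g by (intro continuous_openin_preimage[OF translate_cont _ U(1)]) auto
  then show ?thesis by (simp add: tchart_def vimage_def Int_def)
qed

lemma smooth_coords_const: "openin (Euclidean_space m) W \<Longrightarrow> smooth_coords m W (\<lambda>_. c)"
  by (simp add: smooth_fun_const)

lemma smooth_coords_id: "openin (Euclidean_space m) W \<Longrightarrow> smooth_coords m W (\<lambda>z. z)"
  by (simp add: smooth_fun_coord)

lemma smooth_coords_tchart_inv:
  assumes "g \<in> carrier G" "smooth_coords m W f" "f ` W \<subseteq> V"
  shows "smooth_coords m W (\<lambda>z. g \<otimes> \<psi> (f z))"
  using assms by (intro smooth_mult smooth_\<psi> smooth_coords_const)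
    (auto simp: smooth_fun_def image_subset_iff)

lemma smooth_coords_tchart:
  assumes "g \<in> carrier G" "smooth_coords m W f" "f ` W \<subseteq> fst (tchart g)"
  shows "smooth_coords m W (\<lambda>z. snd (tchart g) (f z))"
proof -
  have "smooth_coords m W (\<lambda>z. inv g \<otimes> f z)"
    using assms by (intro smooth_mult smooth_coords_const)
      (auto simp: smooth_fun_def image_subset_iff tchart_def)
  then show ?thesis
    using smooth_\<phi>[of m W "\<lambda>z. inv g \<otimes> f z"] assms(3) by (auto simp: tchart_def)
qed

text \<open>Continuity of the inverse chart comes from its smoothness, applied to the identity
  family on \<open>V\<close>.\<close>

lemma is_chart_tchart:
  assumes g: "g \<in> carrier G" shows "is_chart (top_of_set (carrier G)) n (tchart g)"
proof -
  let ?c = "tchart g"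
  have sub: "fst ?c \<subseteq> carrier G" by (auto simp: tchart_def)
  have V': "V \<subseteq> {x. \<forall>i\<ge>n. x i = 0}" using V_sub by (auto simp: Euclidean_space_eq)
  have "continuous_on (fst ?c) (snd ?c)"
    unfolding tchart_def using g
    by (auto intro!: continuous_on_compose2[OF \<phi>_cont] continuous_on_subset[OF translate_cont])
  moreover have "continuous_on V (\<lambda>y. g \<otimes> \<psi> y)"
    by (intro smooth_coords_continuous_on[where m = n] smooth_coords_tchart_inv smooth_coords_id V g) auto
  ultimately have "homeomorphic_maps (top_of_set (fst ?c)) (top_of_set V) (snd ?c) (\<lambda>y. g \<otimes> \<psi> y)"
    using tchart_inv_in[OF g] snd_tchart_inv[OF g] tchart_inv_snd[OF g] snd_tchart_in
    by (auto simp: homeomorphic_maps_def)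
  then have "homeomorphic_map (top_of_set (fst ?c)) (top_of_set V) (snd ?c)"
    using homeomorphic_map_maps by blast
  moreover have "subtopology (top_of_set (carrier G)) (fst ?c) = top_of_set (fst ?c)"
    using sub by (simp add: subtopology_subtopology Int_absorb1)
  moreover have "subtopology (Euclidean_space n) V = top_of_set V"
    using V' by (simp add: Euclidean_space_eq subtopology_subtopology Int_absorb1)
  ultimately show ?thesis
    using openin_tchart[OF g] V by (simp add: is_chart_def chart_image_tchart[OF g])
qed

text \<open>In coordinates, transition maps, multiplication and inversion are composites of
  \<open>\<psi>\<close>, group operations and \<open>\<phi>\<close>, each of which preserves smooth
  families by assumption.\<close>

theorem lie_group_tcharts: "lie_group G (top_of_set (carrier G)) n (tchart ` carrier G)"
proof -
  let ?T = "top_of_set (carrier G)"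
  have "smooth_manifold ?T n (tchart ` carrier G)"
  proof
    show "Hausdorff_space ?T" by (simp add: Hausdorff_space_subtopology)
    show "second_countable ?T"
      by (intro second_countable_subtopology second_countable_euclidean)
    show "is_chart ?T n c" if "c \<in> tchart ` carrier G" for c using that is_chart_tchart by blast
    have "g \<in> fst (tchart g)" if "g \<in> carrier G" for g using that U(2) by (simp add: tchart_def)
    then show "(\<Union>c\<in>tchart ` carrier G. fst c) = topspace ?T" by (auto simp: tchart_def)
    fix c d assume "c \<in> tchart ` carrier G" "d \<in> tchart ` carrier G"
    then obtain g h where g: "g \<in> carrier G" "c = tchart g" and h: "h \<in> carrier G" "d = tchart h" by blast
    define W where "W = {y \<in> V. g \<otimes> \<psi> y \<in> fst d}"
    have W_eq: "snd c ` (fst c \<inter> fst d) = W"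
    proof
      show "snd c ` (fst c \<inter> fst d) \<subseteq> W"
        unfolding W_def g(2) using tchart_inv_snd[OF g(1)] snd_tchart_in by auto
      show "W \<subseteq> snd c ` (fst c \<inter> fst d)"
        unfolding W_def g(2)
        using tchart_inv_in[OF g(1)] by (auto intro: tchart_imageI[OF g(1)])
    qed
    have sm: "smooth_coords n V (\<lambda>y. g \<otimes> \<psi> y)"
      by (intro smooth_coords_tchart_inv smooth_coords_id V g) auto
    have W: "openin (Euclidean_space n) W"
      unfolding W_def h(2)
      by (rule smooth_coords_openin_preimage[OF sm _ openin_tchart[OF h(1)]]) (use g in auto)
    have "smooth_coords n W (\<lambda>y. snd d (g \<otimes> \<psi> y))"
      unfolding h(2) by (rule smooth_coords_tchart[OF h(1)])
        (use smooth_fun_subset[OF _ W] sm in \<open>auto simp: W_def h\<close>)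
    then have "smooth_coords n W (snd d \<circ> chart_inv c)"
      by (rule smooth_coords_cong) (simp add: W_def g chart_inv_tchart)
    then show "smooth_map_on n n (snd c ` (fst c \<inter> fst d)) (snd d \<circ> chart_inv c)"
      unfolding W_eq by (rule smooth_map_onI)
  qed
  moreover have "lie_group_axioms G ?T n (tchart ` carrier G)"
  proof
    show "carrier G = topspace ?T" by simp
    show "continuous_map (prod_topology ?T ?T) ?T (\<lambda>(x, y). x \<otimes> y)"
      using mult_cont by (auto simp: prod_topology_subtopology_eu continuous_map_in_subtopology)
    show "continuous_map ?T ?T (\<lambda>x. inv x)"
      using \<iota>_cont \<iota> by (auto cong: continuous_on_cong)
  next
    fix c d e assume "c \<in> tchart ` carrier G" "d \<in> tchart ` carrier G" "e \<in> tchart ` carrier G"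
    then obtain g h k where g: "g \<in> carrier G" "c = tchart g" and h: "h \<in> carrier G" "d = tchart h"
      and k: "k \<in> carrier G" "e = tchart k" by blast
    let ?E = "Euclidean_space (2 * n)"
    \<comment> \<open>The coordinate pairs with both halves in \<open>V\<close> form an open set, on
      which the product \<open>F\<close> is smooth; \<open>W\<close> then selects the pairs whose
      product lies in the third chart.\<close>
    define W0 where "W0 = {z \<in> topspace ?E. fst_half n z \<in> V \<and> snd_half n z \<in> V}"
    define F where "F = (\<lambda>z. (g \<otimes> \<psi> (fst_half n z)) \<otimes> (h \<otimes> \<psi> (snd_half n z)))"
    have sm1: "smooth_coords (2 * n) W (fst_half n)" "smooth_coords (2 * n) W (snd_half n)"
      if "openin ?E W" for W
      unfolding fst_half_def snd_half_def
      by (intro allI smooth_fun_If smooth_fun_const smooth_fun_coord that)+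
    have X: "fst_half n ` S \<subseteq> {x. \<forall>i\<ge>n. x i = 0}" "snd_half n ` S \<subseteq> {x. \<forall>i\<ge>n. x i = 0}" for S
      by (auto simp: fst_half_def snd_half_def)
    have V': "openin (top_of_set {x. \<forall>i\<ge>n. x i = 0}) V" using V by (simp add: Euclidean_space_eq)
    have "W0 = {z \<in> topspace ?E. fst_half n z \<in> V} \<inter> {z \<in> topspace ?E. snd_half n z \<in> V}"
      by (auto simp: W0_def)
    moreover have "openin ?E {z \<in> topspace ?E. fst_half n z \<in> V}"
      by (rule smooth_coords_openin_preimage[OF sm1(1)[OF openin_topspace] X(1) V'])
    moreover have "openin ?E {z \<in> topspace ?E. snd_half n z \<in> V}"
      by (rule smooth_coords_openin_preimage[OF sm1(2)[OF openin_topspace] X(2) V'])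
    ultimately have W0: "openin ?E W0" by (simp only: openin_Int)
    have sm: "smooth_coords (2 * n) W0 F"
      unfolding F_def by (intro smooth_mult smooth_coords_tchart_inv sm1 W0 g h) (auto simp: W0_def g h)
    define W where "W = {z \<in> W0. F z \<in> fst e}"
    have W: "openin ?E W"
      unfolding W_def k(2)
      by (rule smooth_coords_openin_preimage[OF sm _ openin_tchart[OF k(1)]])
         (auto simp: F_def W0_def g h)
    have W_eq: "{z \<in> topspace ?E. fst_half n z \<in> chart_image c \<and> snd_half n z \<in> chart_image d \<and>
           chart_inv c (fst_half n z) \<otimes> chart_inv d (snd_half n z) \<in> fst e} = W"
      by (auto simp: W_def W0_def F_def g h chart_image_tchart chart_inv_tchart)
    have "smooth_coords (2 * n) W (\<lambda>z. snd e (F z))"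
      unfolding k(2) by (rule smooth_coords_tchart[OF k(1)])
        (use smooth_fun_subset[OF _ W] sm in \<open>auto simp: W_def k\<close>)
    then have "smooth_coords (2 * n) W (\<lambda>z. snd e (chart_inv c (fst_half n z) \<otimes> chart_inv d (snd_half n z)))"
      by (rule smooth_coords_cong) (simp add: W_def W0_def F_def g h chart_inv_tchart)
    then show "smooth_map_on (2 * n) n {z \<in> topspace ?E.
        fst_half n z \<in> chart_image c \<and> snd_half n z \<in> chart_image d \<and>
           chart_inv c (fst_half n z) \<otimes> chart_inv d (snd_half n z) \<in> fst e}
        (\<lambda>z. snd e (chart_inv c (fst_half n z) \<otimes> chart_inv d (snd_half n z)))"
      unfolding W_eq by (rule smooth_map_onI)
  next
    fix c d assume "c \<in> tchart ` carrier G" "d \<in> tchart ` carrier G"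
    then obtain g h where g: "g \<in> carrier G" "c = tchart g" and h: "h \<in> carrier G" "d = tchart h" by blast
    \<comment> \<open>The smoothness assumption concerns \<open>\<iota>\<close>, which agrees with
      the inverse on the carrier.\<close>
    define F where "F = (\<lambda>y. \<iota> (g \<otimes> \<psi> y))"
    have sm: "smooth_coords n V F"
      unfolding F_def
      by (intro smooth_\<iota> smooth_coords_tchart_inv smooth_coords_id V g) (use g in auto)
    have F_inv: "F y = inv (g \<otimes> \<psi> y)" if "y \<in> V" for y using that g \<iota> by (simp add: F_def)
    define W where "W = {y \<in> V. F y \<in> fst d}"
    have W: "openin (Euclidean_space n) W"
      unfolding W_def h(2)
      by (rule smooth_coords_openin_preimage[OF sm _ openin_tchart[OF h(1)]]) (use g F_inv in auto)
    have W_eq: "{x \<in> chart_image c. inv (chart_inv c x) \<in> fst d} = W"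
      by (auto simp: W_def F_inv g chart_image_tchart chart_inv_tchart)
    have "smooth_coords n W (\<lambda>z. snd d (F z))"
      unfolding h(2) by (rule smooth_coords_tchart[OF h(1)])
        (use smooth_fun_subset[OF _ W] sm in \<open>auto simp: W_def h\<close>)
    then have "smooth_coords n W (\<lambda>x. snd d (inv (chart_inv c x)))"
      by (rule smooth_coords_cong) (simp add: W_def F_inv g chart_inv_tchart)
    then show "smooth_map_on n n {x \<in> chart_image c. inv (chart_inv c x) \<in> fst d}
        (\<lambda>x. snd d (inv (chart_inv c x)))"
      unfolding W_eq by (rule smooth_map_onI)
  qed
  ultimately show ?thesis
    using group_axioms by (simp add: lie_group_def)
qed

end

section \<open>The solvmanifold\<close>

lemma continuous_on_If_const:
  "(P \<Longrightarrow> continuous_on S f) \<Longrightarrow> (\<not> P \<Longrightarrow> continuous_on S g) \<Longrightarrow>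
     continuous_on S (\<lambda>z. if P then f z else g z)"
  by (cases P) simp_all

text \<open>The open box of radius 1 in the first \<open>N\<close> coordinates isolates a point,
  since distinct integers differ by at least 1. The remaining coordinates only have to be determined
  by these.\<close>

lemma discrete_subtopology_integral:
  fixes X :: "(nat \<Rightarrow> real) set"
  assumes "S \<subseteq> X" and int: "\<And>a i. a \<in> S \<Longrightarrow> i < N \<Longrightarrow> a i \<in> \<int>"
    and eq: "\<And>a b. a \<in> S \<Longrightarrow> b \<in> S \<Longrightarrow> (\<And>i. i < N \<Longrightarrow> a i = b i) \<Longrightarrow> a = b"
  shows "subtopology (top_of_set X) S = discrete_topology S"
proof -
  have "openin (top_of_set S) {a}" if a: "a \<in> S" for a
  proof -
    define W where "W = (\<Inter>i<N. {x::nat\<Rightarrow>real. \<bar>x i - a i\<bar> < 1})"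
    have "open W"
      unfolding W_def by (intro open_INT finite_lessThan ballI open_Collect_less continuous_intros)
    moreover have "S \<inter> W = {a}"
    proof
      show "S \<inter> W \<subseteq> {a}"
      proof
        fix b assume b: "b \<in> S \<inter> W"
        have "a i = b i" if i: "i < N" for i
        proof -
          obtain k l :: int where "a i = of_int k" "b i = of_int l"
            using int[OF a i] int[of b i] b i by (auto simp: Ints_def)
          moreover have "\<bar>b i - a i\<bar> < 1" using b i by (auto simp: W_def)
          ultimately have "real_of_int \<bar>l - k\<bar> < 1" by simp
          then have "\<bar>l - k\<bar> < 1" by linarith
          with \<open>a i = of_int k\<close> \<open>b i = of_int l\<close> show ?thesis by simp
        qed
        then show "b \<in> {a}" using eq[OF a] b by blast
      qed
      show "{a} \<subseteq> S \<inter> W" using a by (auto simp: W_def)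
    qed
    ultimately show ?thesis by (metis openin_open_Int)
  qed
  then have "discrete_topology S = top_of_set S"
    by (simp add: discrete_topology_unique)
  then show ?thesis
    using \<open>S \<subseteq> X\<close> by (simp add: subtopology_subtopology Int_absorb1)
qed

text \<open>Tychonoff's theorem for a product of compact intervals.\<close>

lemma compact_box_seq: "compact {x::nat\<Rightarrow>real. \<forall>i. a i \<le> x i \<and> x i \<le> b i}"
proof -
  have "{x::nat\<Rightarrow>real. \<forall>i. a i \<le> x i \<and> x i \<le> b i} = PiE UNIV (\<lambda>i. {a i..b i})"
    by (auto simp: PiE_def)
  moreover have "compactin (product_topology (\<lambda>i. euclidean) UNIV) (PiE UNIV (\<lambda>i. {a i..b i}))"
    by (simp add: compactin_PiE)
  ultimately show ?thesis by (simp add: euclidean_product_topology)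
qed

text \<open>The screw motion is used first, to bring coordinate \<open>d\<close> to its fractional
  part; its sign then acts on the other coordinates before these are reduced modulo 1. The closed
  bounds describe a compact box.\<close>

lemma flat_rel_fundamental_domain:
  "\<exists>c. flat_rel d x c \<and> (\<forall>i. 0 \<le> c i \<and> c i \<le> (if i \<le> d then 1 else 0))"
proof -
  define n where "n = - \<lfloor>x d\<rfloor>"
  define e where "e = (\<lambda>j. if even n then x j else - x j)"
  define c where "c = (\<lambda>i. if i < d then frac (e i) else if i = d then frac (x d) else 0)"
  have "c d = x d + of_int n" by (simp add: c_def n_def frac_def)
  moreover have "\<forall>j<d. c j - (if even n then x j else - x j) \<in> \<int>"
    by (auto simp: c_def e_def frac_def)
  ultimately have "flat_rel d x c" unfolding flat_rel_def by blast
  moreover have "\<forall>i. 0 \<le> c i \<and> c i \<le> (if i \<le> d then 1 else 0)"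
    by (auto simp: c_def less_imp_le[OF frac_lt_1])
  ultimately show ?thesis by blast
qed

lemma (in group) l_coset_eq_iff:
  assumes H: "subgroup H G" and x: "x \<in> carrier G" and y: "y \<in> carrier G"
  shows "x <# H = y <# H \<longleftrightarrow> (\<exists>h\<in>H. y = x \<otimes> h)"
proof
  assume "x <# H = y <# H"
  moreover have "y \<in> y <# H"
    using y subgroup.one_closed[OF H] by (force simp: l_coset_def)
  ultimately show "\<exists>h\<in>H. y = x \<otimes> h" by (auto simp: l_coset_def)
next
  assume "\<exists>h\<in>H. y = x \<otimes> h"
  then obtain h where h: "h \<in> H" "y = x \<otimes> h" by blast
  note HC = subgroup.mem_carrier[OF H]
  have hc: "h \<in> carrier G" using HC h(1) .
  show "x <# H = y <# H"
  proof
    show "x <# H \<subseteq> y <# H"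
    proof
      fix z assume "z \<in> x <# H"
      then obtain k where k: "k \<in> H" "z = x \<otimes> k" by (auto simp: l_coset_def)
      have "h \<otimes> (inv h \<otimes> k) = k" using hc HC[OF k(1)] by (simp flip: m_assoc)
      then have "z = y \<otimes> (inv h \<otimes> k)" using h k hc HC[OF k(1)] x by (simp add: m_assoc)
      then show "z \<in> y <# H" using subgroup.m_closed[OF H subgroup.m_inv_closed[OF H h(1)] k(1)]
        by (auto simp: l_coset_def)
    qed
    show "y <# H \<subseteq> x <# H"
      using h hc HC x subgroup.m_closed[OF H h(1)] by (auto simp: l_coset_def m_assoc)
  qed
qed

text \<open>At an integer \<open>t\<close>, rotation by \<open>pi * t\<close> is plus or minus the
  identity and so preserves integral vectors.\<close>

lemma sin_cos_pi_Ints: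
  assumes "t \<in> \<int>"
  obtains n where "t = of_int n" "sin (pi * t) = 0" "cos (pi * t) = (if even n then 1 else - 1)"
proof -
  obtain n where "t = of_int n" using assms by (auto simp: Ints_def)
  then show ?thesis by (intro that[of n]) simp_all
qed

section \<open>The screw group, its lattice and the coset space\<close>

definition rmult :: "(nat \<Rightarrow> real) \<Rightarrow> (nat \<Rightarrow> real) \<Rightarrow> nat \<Rightarrow> real" where
  "rmult x y = (\<lambda>i. if i = 0 then x 0 * cos (pi * y 2) - x 1 * sin (pi * y 2) + y 0
     else if i = 1 then x 0 * sin (pi * y 2) + x 1 * cos (pi * y 2) + y 1
     else if i = 2 then x 2 + y 2 else 0)"

text \<open>With \<open>z\<close> in coordinates 0 and 1 and \<open>s\<close> in coordinate 2, the
  inverse of \<open>(z, s)\<close> is \<open>(-z exp(-i pi s), -s)\<close>.\<close>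

definition rinv :: "(nat \<Rightarrow> real) \<Rightarrow> nat \<Rightarrow> real" where
  "rinv x = (\<lambda>i. if i = 0 then - (x 0 * cos (pi * x 2) + x 1 * sin (pi * x 2))
     else if i = 1 then x 0 * sin (pi * x 2) - x 1 * cos (pi * x 2)
     else if i = 2 then - x 2 else 0)"

text \<open>The semidirect product of \<open>\<complex>\<close> by \<open>\<real>\<close> with \<open>(z, s) (w, r) = (z e\<^sup>i\<^sup>\<pi>\<^sup>r + w, s + r)\<close>.\<close>

definition screw_group :: "(nat \<Rightarrow> real) monoid" where
  "screw_group = \<lparr>carrier = topspace (Euclidean_space 3), mult = rmult, one = \<lambda>_. 0\<rparr>"

lemma screw_group_simps [simp]:
  "carrier screw_group = topspace (Euclidean_space 3)" "mult screw_group = rmult"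
  "one screw_group = (\<lambda>_. 0)"
  by (simp_all add: screw_group_def)

abbreviation "screw_lattice \<equiv> {x \<in> carrier screw_group. x 0 \<in> \<int> \<and> x 1 \<in> \<int> \<and> x 2 \<in> \<int>}"

lemma screw_eqI:
  assumes "x \<in> topspace (Euclidean_space 3)" "y \<in> topspace (Euclidean_space 3)"
    and "x 0 = y 0" "x 1 = y 1" "x 2 = y (2::nat)"
  shows "x = y"
proof
  fix i :: nat
  have "i = 0 \<or> i = 1 \<or> i = 2 \<or> i \<ge> 3" by linarith
  then show "x i = y i" using assms by (auto simp: in_Euclidean_space)
qed

lemma rmult_in [simp]: "rmult x y \<in> topspace (Euclidean_space 3)"
  and rinv_in [simp]: "rinv x \<in> topspace (Euclidean_space 3)"
  by (auto simp: in_Euclidean_space rmult_def rinv_def)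

lemma rinv_mult:
  assumes "x \<in> topspace (Euclidean_space 3)" shows "rmult (rinv x) x = (\<lambda>_. 0)"
proof (rule screw_eqI)
  have *: "u * cos t * cos t + u * sin t * sin t = u" for u t :: real
    by (metis mult.assoc distrib_left mult.right_neutral power2_eq_square sin_cos_squared_add2)
  show "rmult (rinv x) x 0 = 0" "rmult (rinv x) x 1 = 0"
    using *[of "x 0" "pi * x 2"] *[of "x 1" "pi * x 2"] by (simp_all add: rmult_def rinv_def algebra_simps)
qed (auto simp: rmult_def rinv_def in_Euclidean_space)

lemma group_screw_group: "group screw_group"
proof (rule groupI)
  fix x y z :: "nat \<Rightarrow> real"
  have "rmult (rmult x y) z = rmult x (rmult y z)"
    by (rule screw_eqI[OF rmult_in rmult_in]) (simp_all add: rmult_def sin_add cos_add algebra_simps)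
  then show "x \<otimes>\<^bsub>screw_group\<^esub> y \<otimes>\<^bsub>screw_group\<^esub> z = x \<otimes>\<^bsub>screw_group\<^esub> (y \<otimes>\<^bsub>screw_group\<^esub> z)"
    by simp
next
  fix x assume x: "x \<in> carrier screw_group"
  then show "\<exists>y\<in>carrier screw_group. y \<otimes>\<^bsub>screw_group\<^esub> x = \<one>\<^bsub>screw_group\<^esub>"
    using rinv_mult by (intro bexI[of _ "rinv x"]) auto
  have "rmult (\<lambda>_. 0) x = x"
    using x by (intro screw_eqI[OF rmult_in]) (simp_all add: rmult_def)
  then show "\<one>\<^bsub>screw_group\<^esub> \<otimes>\<^bsub>screw_group\<^esub> x = x" by simp
next
  show "x \<otimes>\<^bsub>screw_group\<^esub> y \<in> carrier screw_group" for x y by simp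
  show "\<one>\<^bsub>screw_group\<^esub> \<in> carrier screw_group" by (simp add: in_Euclidean_space)
qed

lemma smooth_fun_openin: "smooth_fun m W f \<Longrightarrow> openin (Euclidean_space m) W"
  by (simp add: smooth_fun_def)

lemmas smooth_intros = smooth_fun_If smooth_fun_add smooth_fun_diff smooth_fun_mult smooth_fun_uminus
  smooth_fun_sin_cos smooth_fun_const

lemma continuous_on_fst_coord: "continuous_on S (\<lambda>p. fst p i :: real)"
  by (rule continuous_on_product_then_coordinatewise[OF continuous_on_fst[OF continuous_on_id]])

lemma continuous_on_snd_coord: "continuous_on S (\<lambda>p. snd p i :: real)"
  by (rule continuous_on_product_then_coordinatewise[OF continuous_on_snd[OF continuous_on_id]])

lemmas coord_continuous_intros = continuous_on_If_const
  continuous_on_add continuous_on_diff continuous_on_mult continuous_on_minus continuous_on_const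
  continuous_on_sin continuous_on_cos continuous_on_fst_coord continuous_on_snd_coord
  continuous_on_coord

lemma screw_inv: "x \<in> carrier screw_group \<Longrightarrow> inv\<^bsub>screw_group\<^esub> x = rinv x"
  using rinv_mult by (intro group.inv_equality[OF group_screw_group]) auto

text \<open>The carrier is a Euclidean space, so the identity is a global chart.\<close>

lemma coordinate_lie_group_screw_group:
  "coordinate_lie_group screw_group 3 (carrier screw_group) (topspace (Euclidean_space 3)) id id rinv"
proof (intro coordinate_lie_group.intro group_screw_group coordinate_lie_group_axioms.intro)
  show "continuous_on (carrier screw_group \<times> carrier screw_group) (\<lambda>(x, y). x \<otimes>\<^bsub>screw_group\<^esub> y)"
    unfolding screw_group_simps case_prod_unfold rmult_def
    by (rule continuous_on_coordinatewise_then_product) (intro coord_continuous_intros)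
  show "continuous_on (carrier screw_group) rinv"
    unfolding rinv_def
    by (rule continuous_on_coordinatewise_then_product) (intro coord_continuous_intros)
  show "inv\<^bsub>screw_group\<^esub> x = rinv x" if "x \<in> carrier screw_group" for x
    using screw_inv that .
  show "\<one>\<^bsub>screw_group\<^esub> \<in> carrier screw_group" by (simp add: in_Euclidean_space)
  fix m W and f g :: "(nat \<Rightarrow> real) \<Rightarrow> nat \<Rightarrow> real"
  assume f: "smooth_coords m W f"
  have W: "openin (Euclidean_space m) W" using f smooth_fun_openin by blast
  note f' = f[rule_format]
  show "smooth_coords m W (\<lambda>z. rinv (f z))"
    unfolding rinv_def by (intro allI smooth_intros f' W)
  assume g: "smooth_coords m W g"
  note g' = g[rule_format]
  show "smooth_coords m W (\<lambda>z. f z \<otimes>\<^bsub>screw_group\<^esub> g z)"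
    unfolding screw_group_simps rmult_def
    by (intro allI smooth_intros f' g' W)
qed (auto intro: continuous_intros)

lemma screw_lattice_subgroup: "subgroup screw_lattice screw_group"
proof (rule group.subgroupI[OF group_screw_group])
  show "screw_lattice \<noteq> {}" by (auto simp: in_Euclidean_space intro!: exI[of _ "\<lambda>_. 0"])
next
  fix x assume x: "x \<in> screw_lattice"
  then have "x 2 \<in> \<int>" by simp
  then show "inv\<^bsub>screw_group\<^esub> x \<in> screw_lattice"
  proof (rule sin_cos_pi_Ints)
    fix n assume n: "x 2 = real_of_int n" "sin (pi * x 2) = 0" "cos (pi * x 2) = (if even n then 1 else - 1)"
    have "rinv x 0 \<in> \<int>" "rinv x 1 \<in> \<int>" "rinv x 2 \<in> \<int>"
      using x n by (auto simp: rinv_def)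
    then show ?thesis using x by (simp add: screw_inv)
  qed
next
  fix x y assume x: "x \<in> screw_lattice" and y: "y \<in> screw_lattice"
  then have "y 2 \<in> \<int>" by simp
  then show "x \<otimes>\<^bsub>screw_group\<^esub> y \<in> screw_lattice"
  proof (rule sin_cos_pi_Ints)
    fix n assume n: "y 2 = real_of_int n" "sin (pi * y 2) = 0" "cos (pi * y 2) = (if even n then 1 else - 1)"
    have "rmult x y 0 \<in> \<int>" "rmult x y 1 \<in> \<int>" "rmult x y 2 \<in> \<int>"
      using x y n by (auto simp: rmult_def)
    then show ?thesis by simp
  qed
qed auto

text \<open>Right multiplication by a lattice element with last coordinate \<open>n\<close> rotates
  the complex part by \<open>pi * n\<close>, which is a sign, and then adds an integral vector:
  these are the moves of \<open>flat_rel\<close>.\<close>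

lemma screw_coset_eq:
  assumes x: "x \<in> carrier screw_group" and y: "y \<in> carrier screw_group"
  shows "x <#\<^bsub>screw_group\<^esub> screw_lattice = y <#\<^bsub>screw_group\<^esub> screw_lattice \<longleftrightarrow> flat_rel 2 x y"
proof -
  have "x <#\<^bsub>screw_group\<^esub> screw_lattice = y <#\<^bsub>screw_group\<^esub> screw_lattice \<longleftrightarrow>
      (\<exists>h\<in>screw_lattice. y = rmult x h)"
    using group.l_coset_eq_iff[OF group_screw_group screw_lattice_subgroup x y]
    by simp
  also have "\<dots> \<longleftrightarrow> flat_rel 2 x y"
  proof
    assume "\<exists>h\<in>screw_lattice. y = rmult x h"
    then obtain h where h: "h \<in> screw_lattice" "y = rmult x h" by blast
    then have "h 2 \<in> \<int>" by simp
    then show "flat_rel 2 x y"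
    proof (rule sin_cos_pi_Ints)
      fix n assume n: "h 2 = real_of_int n" "sin (pi * h 2) = 0" "cos (pi * h 2) = (if even n then 1 else - 1)"
      show ?thesis
        unfolding flat_rel_def
        by (rule exI[of _ n]) (use h n in \<open>auto simp: rmult_def less_2_cases_iff\<close>)
    qed
  next
    assume "flat_rel 2 x y"
    then obtain n where n: "y 2 = x 2 + of_int n" "\<forall>j<2. y j - (if even n then x j else - x j) \<in> \<int>"
      by (auto simp: flat_rel_def)
    \<comment> \<open>The solution of \<open>y = rmult x h\<close> whose last coordinate is
      \<open>n\<close>.\<close>
    define h where "h = (\<lambda>i. if i < 2 then y i - (if even n then x i else - x i) else if i = 2 then of_int n else 0)"
    have "h \<in> screw_lattice" using n(2) by (auto simp: h_def in_Euclidean_space)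
    moreover have "y = rmult x h"
      by (rule screw_eqI[OF _ rmult_in]) (use y n in \<open>auto simp: rmult_def h_def\<close>)
    ultimately show "\<exists>h\<in>screw_lattice. y = rmult x h" by blast
  qed
  finally show ?thesis .
qed

text \<open>The compact box of \<open>flat_rel_fundamental_domain\<close> already maps onto the
  quotient.\<close>

lemma compact_space_flat_quotient:
  assumes q: "quotient_map (Euclidean_space (Suc d)) M \<pi>"
    and fib: "\<And>x y. x \<in> topspace (Euclidean_space (Suc d)) \<Longrightarrow>
      y \<in> topspace (Euclidean_space (Suc d)) \<Longrightarrow> \<pi> x = \<pi> y \<longleftrightarrow> flat_rel d x y"
  shows "compact_space M"
proof -
  let ?E = "topspace (Euclidean_space (Suc d))"
  let ?C = "{x::nat\<Rightarrow>real. \<forall>i. 0 \<le> x i \<and> x i \<le> (if i \<le> d then 1 else 0)}"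
  have C: "?C \<subseteq> ?E"
  proof
    fix x assume x: "x \<in> ?C"
    have "x i = 0" if "i \<ge> Suc d" for i
    proof -
      have "0 \<le> x i \<and> x i \<le> (if i \<le> d then 1 else 0)" using x by blast
      then show ?thesis using that by simp
    qed
    then show "x \<in> ?E" by (simp add: in_Euclidean_space)
  qed
  then have "compactin (Euclidean_space (Suc d)) ?C"
    using compact_box_seq[of "\<lambda>_. 0" "\<lambda>i. if i \<le> d then 1 else 0"]
    by (simp add: Euclidean_space_eq compactin_subtopology)
  then have "compactin M (\<pi> ` ?C)"
    using image_compactin quotient_imp_continuous_map[OF q] by blast
  moreover have "topspace M \<subseteq> \<pi> ` ?C"
  proof
    fix z assume "z \<in> topspace M"
    then obtain x where x: "x \<in> ?E" "z = \<pi> x" using quotient_imp_surjective_map[OF q] by blast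
    obtain c where c: "flat_rel d x c" "c \<in> ?C" using flat_rel_fundamental_domain[of d x] by blast
    then have "\<pi> x = \<pi> c" using x C fib[of x c] by blast
    then show "z \<in> \<pi> ` ?C" using x(2) c(2) by simp
  qed
  ultimately have "topspace M = \<pi> ` ?C"
    by (intro subset_antisym compactin_subset_topspace)
  with \<open>compactin M (\<pi> ` ?C)\<close> show ?thesis by (simp only: compact_space_def)
qed

text \<open>The straight-line contraction to the base point keeps both ends of the loop
  fixed.\<close>

lemma simply_connected_Euclidean_space: "simply_connected_space (Euclidean_space n)"
  unfolding simply_connected_space_def
proof (intro conjI allI impI path_connected_Euclidean_space, elim conjE)
  fix g assume g: "pathin (Euclidean_space n) g" "g 1 = g 0"
  have gc: "continuous_on {0..1} g" and g_in: "\<And>t. t \<in> {0..1} \<Longrightarrow> g t \<in> topspace (Euclidean_space n)"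
    using g by (auto simp: pathin_def Euclidean_space_eq)
  define h where "h = (\<lambda>(s::real, t::real) i. (1 - s) * g t i + s * g 0 i)"
  have g2: "continuous_on ({0..1} \<times> {0..1}) (\<lambda>p. g (snd p))"
    by (intro continuous_on_compose2[OF gc] continuous_intros) auto
  have "continuous_on ({0..1} \<times> {0..1}) h"
    unfolding h_def case_prod_unfold
    by (rule continuous_on_coordinatewise_then_product)
       (intro continuous_intros continuous_on_product_then_coordinatewise[OF g2])
  moreover have "h p \<in> topspace (Euclidean_space n)" if "p \<in> {0..1} \<times> {0..1}" for p
    using g_in[of "snd p"] g_in[of 0] that by (auto simp: h_def in_Euclidean_space)
  ultimately have "continuous_map (prod_topology (top_of_set {0..1}) (top_of_set {0..1})) (Euclidean_space n) h"
    by (auto simp: Euclidean_space_eq)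
  then show "homotopic_with (\<lambda>h. h 0 = g 0 \<and> h 1 = g 0) (top_of_set {0..1}) (Euclidean_space n) g (\<lambda>_. g 0)"
    unfolding homotopic_with_def
    by (intro exI[of _ h]) (auto simp: h_def g(2) fun_eq_iff algebra_simps)
qed

section \<open>Solvability of the screw group\<close>

lemma (in group) derived_singleton_one: "(\<And>x y. x \<in> H \<Longrightarrow> y \<in> H \<Longrightarrow> x \<otimes> y = y \<otimes> x) \<Longrightarrow>
    H \<subseteq> carrier G \<Longrightarrow> derived G H = {\<one>}"
proof -
  assume comm: "\<And>x y. x \<in> H \<Longrightarrow> y \<in> H \<Longrightarrow> x \<otimes> y = y \<otimes> x" and H: "H \<subseteq> carrier G"
  have "x \<otimes> y \<otimes> inv x \<otimes> inv y = \<one>" if "x \<in> H" "y \<in> H" for x y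
  proof -
    have "x \<in> carrier G" "y \<in> carrier G" using that H by auto
    moreover from this have "x \<otimes> y \<otimes> inv x = y" using comm[OF that] by (simp add: m_assoc)
    ultimately show ?thesis by simp
  qed
  then have "derived_set G H \<subseteq> {\<one>}" by auto
  then have "derived G H \<subseteq> {\<one>}"
    unfolding derived_def by (rule generate_subgroup_incl[OF _ triv_subgroup])
  then show ?thesis using subgroup.one_closed[OF derived_is_subgroup[OF H]] by blast
qed

text \<open>The last coordinate is additive, so commutators lie in the abelian subgroup
  \<open>?K\<close> where it vanishes, and the second derived subgroup is trivial.\<close>

lemma solvable_screw_group: "solvable screw_group"
proof -
  interpret group screw_group by (rule group_screw_group)
  let ?K = "{x \<in> carrier screw_group. x 2 = 0}"
  have K: "subgroup ?K screw_group"
  proof (rule subgroupI)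
    show "?K \<noteq> {}" by (auto simp: in_Euclidean_space intro!: exI[of _ "\<lambda>_. 0"])
    show "inv\<^bsub>screw_group\<^esub> x \<in> ?K" if "x \<in> ?K" for x
    proof -
      have "rinv x 2 = 0" using that by (simp add: rinv_def)
      then show ?thesis using that by (simp add: screw_inv)
    qed
    show "x \<otimes>\<^bsub>screw_group\<^esub> y \<in> ?K" if "x \<in> ?K" "y \<in> ?K" for x y
    proof -
      have "rmult x y 2 = 0" using that by (simp add: rmult_def)
      then show ?thesis by simp
    qed
  qed auto
  have comm: "derived screw_group ?K = {\<one>\<^bsub>screw_group\<^esub>}"
  proof (rule derived_singleton_one)
    fix x y assume "x \<in> ?K" "y \<in> ?K"
    then show "x \<otimes>\<^bsub>screw_group\<^esub> y = y \<otimes>\<^bsub>screw_group\<^esub> x"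
      by (auto simp: rmult_def fun_eq_iff)
  qed auto
  have "derived_set screw_group (carrier screw_group) \<subseteq> ?K"
  proof
    fix z assume "z \<in> derived_set screw_group (carrier screw_group)"
    then obtain x y where xy: "x \<in> carrier screw_group" "y \<in> carrier screw_group"
      "z = x \<otimes>\<^bsub>screw_group\<^esub> y \<otimes>\<^bsub>screw_group\<^esub> inv\<^bsub>screw_group\<^esub> x \<otimes>\<^bsub>screw_group\<^esub> inv\<^bsub>screw_group\<^esub> y" by auto
    then have "z \<in> carrier screw_group" by simp
    moreover have "z 2 = 0" using xy by (simp add: screw_inv) (simp add: rmult_def rinv_def)
    ultimately show "z \<in> ?K" by simp
  qed
  then have "derived screw_group (carrier screw_group) \<subseteq> ?K"
    unfolding derived_def by (rule generate_subgroup_incl[OF _ K])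
  from mono_derived[OF this]
  have "derived screw_group (derived screw_group (carrier screw_group)) \<subseteq> {\<one>\<^bsub>screw_group\<^esub>}"
    by (simp only: comm)
  moreover have "\<one>\<^bsub>screw_group\<^esub> \<in> derived screw_group (derived screw_group (carrier screw_group))"
    by (intro subgroup.one_closed derived_is_subgroup derived_in_carrier) auto
  ultimately have "(derived screw_group ^^ 2) (carrier screw_group) = {\<one>\<^bsub>screw_group\<^esub>}"
    by (auto simp: numeral_2_eq_2)
  then show ?thesis using solvable_iff_trivial_derived_seq by blast
qed

theorem solvmanifold_infinite_length:
  "\<exists>M :: (nat \<Rightarrow> real) set topology. closed_solvmanifold M \<and> iterated_length M = \<infinity>"
proof -
  interpret coordinate_lie_group screw_group 3 "carrier screw_group" "topspace (Euclidean_space 3)" id id rinv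
    by (rule coordinate_lie_group_screw_group)
  let ?T = "Euclidean_space 3"
  let ?M = "coset_space screw_group ?T screw_lattice"
  have T: "top_of_set (carrier screw_group) = ?T"
    by (simp add: Euclidean_space_eq)
  have q: "quotient_map (Euclidean_space (Suc 2)) ?M (\<lambda>g. g <#\<^bsub>screw_group\<^esub> screw_lattice)"
    unfolding coset_space_def using quotient_map_quotient_topology by (simp add: numeral_3_eq_3)
  have fib: "x <#\<^bsub>screw_group\<^esub> screw_lattice = y <#\<^bsub>screw_group\<^esub> screw_lattice \<longleftrightarrow> flat_rel 2 x y"
    if "x \<in> topspace (Euclidean_space (Suc 2))" "y \<in> topspace (Euclidean_space (Suc 2))" for x y
    using that by (intro screw_coset_eq) (simp_all add: numeral_3_eq_3)
  have "subtopology ?T screw_lattice = discrete_topology screw_lattice"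
    unfolding T[symmetric]
  proof (rule discrete_subtopology_integral[where N = 3])
    fix a b assume a: "a \<in> screw_lattice" and b: "b \<in> screw_lattice"
    show "a i \<in> \<int>" if "i < 3" for i
    proof -
      have "i = 0 \<or> i = 1 \<or> i = 2" using that by linarith
      then show ?thesis using a by auto
    qed
    show "a = b" if "\<And>i. i < 3 \<Longrightarrow> a i = b i"
      using a b that by (intro screw_eqI) auto
  qed auto
  then have "cocompact_lattice screw_group ?T screw_lattice"
    using screw_lattice_subgroup compact_space_flat_quotient[OF q fib] by (simp add: cocompact_lattice_def)
  then have "closed_solvmanifold ?M"
    unfolding closed_solvmanifold_def
    using lie_group_tcharts[unfolded T] simply_connected_Euclidean_space solvable_screw_group by blast
  moreover have "iterated_length ?M = \<infinity>" by (rule flat_quotient_length[OF q _ fib]) simp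
  ultimately show ?thesis by blast
qed

section \<open>The locally homogeneous space\<close>

text \<open>Coordinate \<open>j\<close> of the quaternion product of the quaternion stored in
  \<open>x\<close> from index \<open>k\<close> on with the one stored in \<open>y\<close> from index
  5 on, imaginary parts first. The offset 0 gives \<open>v p\<close>, the offset 5 gives
  \<open>q p\<close>.\<close>

definition qprod :: "nat \<Rightarrow> (nat \<Rightarrow> real) \<Rightarrow> (nat \<Rightarrow> real) \<Rightarrow> nat \<Rightarrow> real" where
  "qprod k x y j =
    (if j = 0 then x (k + 3) * y 5 + x k * y 8 + x (k + 1) * y 7 - x (k + 2) * y 6
     else if j = 1 then x (k + 3) * y 6 - x k * y 7 + x (k + 1) * y 8 + x (k + 2) * y 5
     else if j = 2 then x (k + 3) * y 7 + x k * y 6 - x (k + 1) * y 5 + x (k + 2) * y 8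
     else x (k + 3) * y 8 - x k * y 5 - x (k + 1) * y 6 - x (k + 2) * y 7)"

definition gmult :: "(nat \<Rightarrow> real) \<Rightarrow> (nat \<Rightarrow> real) \<Rightarrow> nat \<Rightarrow> real" where
  "gmult x y = (\<lambda>i. if i < 4 then qprod 0 x y i + y i else if i = 4 then x 4 + y 4
     else if i < 9 then qprod 5 x y (i - 5) else 0)"

text \<open>The inverse of \<open>(v, s, q)\<close> is \<open>(-v q', -s, q')\<close> with
  \<open>q'\<close> the conjugate quaternion of \<open>q\<close>.\<close>

definition ginv :: "(nat \<Rightarrow> real) \<Rightarrow> nat \<Rightarrow> real" where
  "ginv x = (\<lambda>i. if i = 0 then x 3 * x 5 - x 0 * x 8 + x 1 * x 7 - x 2 * x 6
     else if i = 1 then x 3 * x 6 - x 0 * x 7 - x 1 * x 8 + x 2 * x 5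
     else if i = 2 then x 3 * x 7 + x 0 * x 6 - x 1 * x 5 - x 2 * x 8
     else if i = 3 then - x 3 * x 8 - x 0 * x 5 - x 1 * x 6 - x 2 * x 7
     else if i = 4 then - x 4 else if i < 8 then - x i else if i = 8 then x 8 else 0)"

lemma gmult_coords:
  "gmult x y 0 = x 3 * y 5 + x 0 * y 8 + x 1 * y 7 - x 2 * y 6 + y 0"
  "gmult x y 1 = x 3 * y 6 - x 0 * y 7 + x 1 * y 8 + x 2 * y 5 + y 1"
  "gmult x y 2 = x 3 * y 7 + x 0 * y 6 - x 1 * y 5 + x 2 * y 8 + y 2"
  "gmult x y 3 = x 3 * y 8 - x 0 * y 5 - x 1 * y 6 - x 2 * y 7 + y 3"
  "gmult x y 4 = x 4 + y 4"
  "gmult x y 5 = x 8 * y 5 + x 5 * y 8 + x 6 * y 7 - x 7 * y 6"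
  "gmult x y 6 = x 8 * y 6 - x 5 * y 7 + x 6 * y 8 + x 7 * y 5"
  "gmult x y 7 = x 8 * y 7 + x 5 * y 6 - x 6 * y 5 + x 7 * y 8"
  "gmult x y 8 = x 8 * y 8 - x 5 * y 5 - x 6 * y 6 - x 7 * y 7"
  by (simp_all add: gmult_def qprod_def numeral_2_eq_2)

lemma ginv_coords:
  "ginv x 0 = x 3 * x 5 - x 0 * x 8 + x 1 * x 7 - x 2 * x 6"
  "ginv x 1 = x 3 * x 6 - x 0 * x 7 - x 1 * x 8 + x 2 * x 5"
  "ginv x 2 = x 3 * x 7 + x 0 * x 6 - x 1 * x 5 - x 2 * x 8"
  "ginv x 3 = - x 3 * x 8 - x 0 * x 5 - x 1 * x 6 - x 2 * x 7"
  "ginv x 4 = - x 4" "ginv x 5 = - x 5" "ginv x 6 = - x 6" "ginv x 7 = - x 7" "ginv x 8 = x 8"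
  by (simp_all add: ginv_def)

text \<open>The simplifier turns the index \<open>1\<close> into \<open>Suc 0\<close>, so the rules
  are stored in that form.\<close>

lemmas gcoords = gmult_coords[unfolded One_nat_def] ginv_coords[unfolded One_nat_def]

text \<open>The group \<open>(\<H> \<times> \<real>) \<rtimes> S\<^sup>3\<close> with \<open>(v, s, q) (w, r, p) = (v p + w, s + r, q p)\<close>. The quaternions \<open>v\<close>
  and \<open>q\<close> occupy the coordinates 0 to 3 and 5 to 8, with the real part last.\<close>

definition sphere_group :: "(nat \<Rightarrow> real) monoid" where
  "sphere_group = \<lparr>carrier = {x. (\<forall>i\<ge>9. x i = 0) \<and> (x 5)\<^sup>2 + (x 6)\<^sup>2 + (x 7)\<^sup>2 + (x 8)\<^sup>2 = 1},
     mult = gmult, one = (\<lambda>i. if i = 8 then 1 else 0)\<rparr>"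

abbreviation "GC \<equiv> carrier sphere_group"

lemma in_GC: "x \<in> GC \<longleftrightarrow> (\<forall>i\<ge>9. x i = 0) \<and> (x 5)\<^sup>2 + (x 6)\<^sup>2 + (x 7)\<^sup>2 + (x 8)\<^sup>2 = 1"
  and sphere_group_simps [simp]: "mult sphere_group = gmult"
    "one sphere_group = (\<lambda>i. if i = 8 then 1 else 0)"
  by (simp_all add: sphere_group_def)

lemma less_9_cases: "(i::nat) < 9 \<Longrightarrow> i = 0 \<or> i = 1 \<or> i = 2 \<or> i = 3 \<or> i = 4 \<or> i = 5 \<or> i = 6 \<or> i = 7 \<or> i = 8"
  by presburger

lemma seq9_eqI:
  fixes x y :: "nat \<Rightarrow> real"
  assumes "\<forall>i\<ge>9. x i = 0" "\<forall>i\<ge>9. y i = 0"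
    and "x 0 = y 0" "x 1 = y 1" "x 2 = y 2" "x 3 = y 3" "x 4 = y 4"
      "x 5 = y 5" "x 6 = y 6" "x 7 = y 7" "x 8 = y 8"
  shows "x = y"
proof
  fix i show "x i = y i"
    by (cases "i < 9") (use assms less_9_cases[of i] in auto)
qed

lemma gmult_supp: "\<forall>i\<ge>9. gmult x y i = 0" and ginv_supp: "\<forall>i\<ge>9. ginv x i = 0"
  by (auto simp: gmult_def ginv_def)

text \<open>Euler's four-square identity: the quaternion norm is multiplicative.\<close>

lemma gmult_in: "x \<in> GC \<Longrightarrow> y \<in> GC \<Longrightarrow> gmult x y \<in> GC"
proof -
  assume x: "x \<in> GC" and y: "y \<in> GC"
  have "(gmult x y 5)\<^sup>2 + (gmult x y 6)\<^sup>2 + (gmult x y 7)\<^sup>2 + (gmult x y 8)\<^sup>2 =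
     ((x 5)\<^sup>2 + (x 6)\<^sup>2 + (x 7)\<^sup>2 + (x 8)\<^sup>2) * ((y 5)\<^sup>2 + (y 6)\<^sup>2 + (y 7)\<^sup>2 + (y 8)\<^sup>2)"
    unfolding gcoords by algebra
  then show ?thesis using x y gmult_supp by (simp add: in_GC)
qed

lemma ginv_in: "x \<in> GC \<Longrightarrow> ginv x \<in> GC"
  using ginv_supp by (simp add: in_GC gcoords)

lemma ginv_mult: "x \<in> GC \<Longrightarrow> gmult (ginv x) x = (\<lambda>i. if i = 8 then 1 else 0)"
proof -
  assume x: "x \<in> GC"
  then have "x 5 * x 5 + x 6 * x 6 + x 7 * x 7 + x 8 * x 8 = 1" by (simp add: in_GC power2_eq_square)
  \<comment> \<open>The norm equation is oriented as a rewrite rule that eliminates the square of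
    the real part.\<close>
  then have n: "x 8 * x 8 = 1 - x 5 * x 5 - x 6 * x 6 - x 7 * x 7" by linarith
  show ?thesis
    by (rule seq9_eqI[OF gmult_supp]) (simp_all add: gcoords n algebra_simps)
qed

lemma gmult_assoc: "gmult (gmult x y) z = gmult x (gmult y z)"
  by (rule seq9_eqI[OF gmult_supp gmult_supp]) (simp_all add: gcoords algebra_simps)

lemma gone_mult: "\<forall>i\<ge>9. x i = 0 \<Longrightarrow> gmult (\<lambda>i. if i = 8 then 1 else 0) x = x"
  by (rule seq9_eqI[OF gmult_supp]) (simp_all add: gcoords)

lemma group_sphere_group: "group sphere_group"
proof (rule groupI)
  show "\<one>\<^bsub>sphere_group\<^esub> \<in> GC" by (simp add: in_GC)
  fix x assume x: "x \<in> GC"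
  then show "\<exists>y\<in>GC. y \<otimes>\<^bsub>sphere_group\<^esub> x = \<one>\<^bsub>sphere_group\<^esub>"
    using ginv_in ginv_mult by (intro bexI[of _ "ginv x"]) simp_all
  show "\<one>\<^bsub>sphere_group\<^esub> \<otimes>\<^bsub>sphere_group\<^esub> x = x"
    using x gone_mult by (simp add: in_GC)
qed (simp_all add: gmult_in gmult_assoc)

lemma sphere_inv: "x \<in> GC \<Longrightarrow> inv\<^bsub>sphere_group\<^esub> x = ginv x"
  by (intro group.inv_equality[OF group_sphere_group]) (simp_all add: ginv_in ginv_mult)

section \<open>The hemisphere chart and connectedness\<close>

definition chart_dom where "chart_dom = {x \<in> GC. 0 < x 8}"
definition chart_cod where
  "chart_cod = {y \<in> topspace (Euclidean_space 8). (y 5)\<^sup>2 + (y 6)\<^sup>2 + (y 7)\<^sup>2 < 1}"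
text \<open>On the open hemisphere of positive real part, the imaginary part of the unit quaternion
  is a coordinate; \<open>lift8\<close> recovers the real part as a positive root.\<close>

definition drop8 :: "(nat \<Rightarrow> real) \<Rightarrow> nat \<Rightarrow> real" where
  "drop8 x = (\<lambda>i. if i = 8 then 0 else x i)"
text \<open>Squares are written as products so that \<open>smooth_fun_mult\<close> applies.\<close>

definition lift8 :: "(nat \<Rightarrow> real) \<Rightarrow> nat \<Rightarrow> real" where
  "lift8 y = (\<lambda>i. if i = 8 then sqrt (1 - (y 5 * y 5 + y 6 * y 6 + y 7 * y 7)) else y i)"

lemma coordinate_lie_group_sphere_group:
  "coordinate_lie_group sphere_group 8 chart_dom chart_cod drop8 lift8 ginv"
proof (intro coordinate_lie_group.intro group_sphere_group coordinate_lie_group_axioms.intro)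
  show "continuous_on (GC \<times> GC) (\<lambda>(x, y). x \<otimes>\<^bsub>sphere_group\<^esub> y)"
    unfolding sphere_group_simps case_prod_unfold gmult_def qprod_def
    by (rule continuous_on_coordinatewise_then_product) (intro coord_continuous_intros)
  show "continuous_on GC ginv"
    unfolding ginv_def
    by (rule continuous_on_coordinatewise_then_product) (intro coord_continuous_intros)
  show "continuous_on chart_dom drop8"
    unfolding drop8_def
    by (rule continuous_on_coordinatewise_then_product) (intro coord_continuous_intros)
  show "inv\<^bsub>sphere_group\<^esub> x = ginv x" if "x \<in> GC" for x
    using sphere_inv that .
  have "open {x::nat\<Rightarrow>real. 0 < x 8}"
    by (intro open_Collect_less continuous_intros)
  then show "openin (top_of_set GC) chart_dom"
    unfolding chart_dom_def by (auto simp: openin_open)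
  have "open {y::nat\<Rightarrow>real. (y 5)\<^sup>2 + (y 6)\<^sup>2 + (y 7)\<^sup>2 < 1}"
    by (intro open_Collect_less continuous_intros)
  then show "openin (Euclidean_space 8) chart_cod"
    unfolding chart_cod_def by (auto simp: openin_open Euclidean_space_eq)
  show "\<one>\<^bsub>sphere_group\<^esub> \<in> chart_dom" by (simp add: chart_dom_def in_GC)
  show "drop8 x \<in> chart_cod" if "x \<in> chart_dom" for x
  proof -
    have "(x 8)\<^sup>2 > 0" "(x 5)\<^sup>2 + (x 6)\<^sup>2 + (x 7)\<^sup>2 + (x 8)\<^sup>2 = 1"
      using that by (simp_all add: chart_dom_def in_GC)
    then have "(x 5)\<^sup>2 + (x 6)\<^sup>2 + (x 7)\<^sup>2 < 1" by linarith
    moreover have "drop8 x i = 0" if "i \<ge> 8" for i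
      using \<open>x \<in> chart_dom\<close> that by (cases "i = 8") (auto simp: chart_dom_def in_GC drop8_def)
    ultimately show ?thesis
      by (simp add: chart_cod_def drop8_def in_Euclidean_space)
  qed
  show "lift8 y \<in> chart_dom" if "y \<in> chart_cod" for y
    using that by (auto simp: chart_dom_def chart_cod_def in_GC lift8_def in_Euclidean_space power2_eq_square)
  show "lift8 (drop8 x) = x" if "x \<in> chart_dom" for x
  proof -
    have "1 - (x 5 * x 5 + x 6 * x 6 + x 7 * x 7) = (x 8)\<^sup>2" "x 8 > 0"
      using that by (auto simp: chart_dom_def in_GC power2_eq_square)
    then show ?thesis by (auto simp: lift8_def drop8_def)
  qed
  show "drop8 (lift8 y) = y" if "y \<in> chart_cod" for y
    using that by (auto simp: chart_cod_def lift8_def drop8_def in_Euclidean_space)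
  fix m W and f g :: "(nat \<Rightarrow> real) \<Rightarrow> nat \<Rightarrow> real"
  assume f: "smooth_coords m W f"
  have W: "openin (Euclidean_space m) W" using f smooth_fun_openin by blast
  note f' = f[rule_format]
  show "smooth_coords m W (\<lambda>z. ginv (f z))"
    unfolding ginv_def by (intro allI smooth_intros f' W)
  show "smooth_coords m W (\<lambda>z. drop8 (f z))"
    unfolding drop8_def by (intro allI smooth_intros f' W)
  show "smooth_coords m W (\<lambda>z. lift8 (f z))" if "f ` W \<subseteq> chart_cod"
    unfolding lift8_def
    by (intro allI smooth_intros smooth_fun_sqrt f' W)
       (use that in \<open>auto simp: chart_cod_def power2_eq_square\<close>)
  assume g: "smooth_coords m W g"
  note g' = g[rule_format]
  show "smooth_coords m W (\<lambda>z. f z \<otimes>\<^bsub>sphere_group\<^esub> g z)"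
    unfolding sphere_group_simps gmult_def qprod_def
    by (intro allI smooth_intros f' g' W)
qed

text \<open>The carrier is the continuous image of the product of a 5-dimensional Euclidean space
  with the unit sphere of \<open>complex \<times> complex\<close>, both connected.\<close>

lemma connected_GC: "connected GC"
proof -
  let ?E = "{x::nat\<Rightarrow>real. \<forall>i\<ge>5. x i = 0}"
  define F :: "(nat \<Rightarrow> real) \<times> complex \<times> complex \<Rightarrow> nat \<Rightarrow> real" where
    "F = (\<lambda>p i. if i < 5 then fst p i else if i = 5 then Re (fst (snd p)) else if i = 6 then Im (fst (snd p))
       else if i = 7 then Re (snd (snd p)) else if i = 8 then Im (snd (snd p)) else 0)"
  have "connected ?E"
    using connected_Euclidean_space[of 5] by (simp add: Euclidean_space_eq connectedin_def flip: connectedin_iff_connected)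
  moreover have "connected (sphere (0 :: complex \<times> complex) 1)"
    by (rule connected_sphere) simp
  ultimately have "connected (?E \<times> sphere (0 :: complex \<times> complex) 1)"
    by (rule connected_Times)
  moreover have "continuous_on (?E \<times> sphere (0 :: complex \<times> complex) 1) F"
    unfolding F_def
    by (rule continuous_on_coordinatewise_then_product)
       (intro continuous_on_If_const continuous_on_fst_coord continuous_on_Re continuous_on_Im
          continuous_on_fst continuous_on_snd continuous_on_id continuous_on_const)
  ultimately have "connected (F ` (?E \<times> sphere 0 1))"
    using connected_continuous_image by blast
  moreover have "F ` (?E \<times> sphere 0 1) = GC"
  proof
    show "F ` (?E \<times> sphere 0 1) \<subseteq> GC"
      by (auto simp: F_def in_GC norm_Pair cmod_def)
    show "GC \<subseteq> F ` (?E \<times> sphere 0 1)"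
    proof
      fix x assume x: "x \<in> GC"
      let ?p = "(\<lambda>i. if i < 5 then x i else 0, Complex (x 5) (x 6), Complex (x 7) (x 8))"
      have "x = F ?p"
        by (rule seq9_eqI) (use x in \<open>auto simp: F_def in_GC\<close>)
      moreover have "?p \<in> ?E \<times> sphere 0 1"
        using x by (auto simp: in_GC norm_Pair cmod_def)
      ultimately show "x \<in> F ` (?E \<times> sphere 0 1)" by (rule image_eqI)
    qed
  qed
  ultimately show ?thesis by simp
qed

section \<open>The compact subgroup, the lattice and the translations\<close>

definition rot_subgroup :: "(nat \<Rightarrow> real) set" where
  "rot_subgroup = {x \<in> GC. \<forall>i<5. x i = 0}"

text \<open>Coordinates 4 and 8 are coupled as in the powers of \<open>t = (0, 1, -1)\<close>; the
  first four coordinates carry the integral translations.\<close>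

definition sphere_lattice :: "(nat \<Rightarrow> real) set" where
  "sphere_lattice = {x \<in> GC. (\<forall>i<4. x i \<in> \<int>) \<and> x 5 = 0 \<and> x 6 = 0 \<and> x 7 = 0 \<and>
     (\<exists>n::int. x 4 = of_int n \<and> x 8 = (if even n then 1 else - 1))}"

text \<open>A unit quaternion of real part 1 equals 1, so this is the kernel of the projection to
  the 3-sphere.\<close>

definition translation_subgroup :: "(nat \<Rightarrow> real) set" where
  "translation_subgroup = {x \<in> GC. x 8 = 1}"

lemma less_5_cases: "(i::nat) < 5 \<Longrightarrow> i = 0 \<or> i = 1 \<or> i = 2 \<or> i = 3 \<or> i = 4"
  by presburger

lemma all_less_5: "(\<forall>i<5. P i) \<longleftrightarrow> P 0 \<and> P (Suc 0) \<and> P 2 \<and> P 3 \<and> P (4::nat)"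
  by (auto simp: eval_nat_numeral All_less_Suc)

lemma all_less_4: "(\<forall>i<4. P i) \<longleftrightarrow> P 0 \<and> P (Suc 0) \<and> P 2 \<and> P (3::nat)"
  by (auto simp: eval_nat_numeral All_less_Suc)

lemma unit_real_part_im:
  assumes "x \<in> GC" "(x 8)\<^sup>2 = 1" shows "x 5 = 0" "x 6 = 0" "x 7 = 0"
proof -
  have "(x 5)\<^sup>2 + (x 6)\<^sup>2 + (x 7)\<^sup>2 = 0" using assms by (simp add: in_GC)
  then have "(x 5)\<^sup>2 = 0 \<and> (x 6)\<^sup>2 = 0 \<and> (x 7)\<^sup>2 = 0"
    using zero_le_power2[of "x 5"] zero_le_power2[of "x 6"] zero_le_power2[of "x 7"] by linarith
  then show "x 5 = 0" "x 6 = 0" "x 7 = 0" by simp_all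
qed

text \<open>Left multiplication by \<open>(0, 0, q)\<close> leaves \<open>v\<close> and
  \<open>s\<close> alone, and the quotient of two elements that agree in \<open>v\<close> and
  \<open>s\<close> has this form. So a coset of the compact subgroup is a point of the 5-dimensional
  translation space.\<close>

lemma same_translation_part:
  assumes "x \<in> GC" "y \<in> GC"
  shows "(\<forall>i<5. x i = y i) \<longleftrightarrow> (\<exists>h\<in>rot_subgroup. y = gmult h x)"
proof
  interpret group sphere_group by (rule group_sphere_group)
  assume eq: "\<forall>i<5. x i = y i"
  have "gmult (gmult y (ginv x)) x = gmult y (gmult (ginv x) x)" by (rule gmult_assoc)
  also have "\<dots> = y"
    using r_one[OF assms(2)] ginv_mult[OF assms(1)] by simp
  finally have "y = gmult (gmult y (ginv x)) x" by simp
  moreover have "gmult y (ginv x) \<in> rot_subgroup"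
    using eq gmult_in ginv_in assms
    by (simp add: rot_subgroup_def all_less_5 gcoords)
  ultimately show "\<exists>h\<in>rot_subgroup. y = gmult h x" by blast
next
  assume "\<exists>h\<in>rot_subgroup. y = gmult h x"
  then obtain h where "h \<in> rot_subgroup" "y = gmult h x" by blast
  then show "\<forall>i<5. x i = y i"
    by (simp add: rot_subgroup_def all_less_5 gcoords)
qed

text \<open>On the translation part, a lattice element acts by the sign in coordinate 8, an integral
  translation and a shift by \<open>n\<close> of coordinate 4.\<close>

lemma lattice_orbit:
  "flat_rel 4 x y \<longleftrightarrow> (\<exists>h\<in>sphere_lattice. \<forall>i<5. gmult x h i = y i)"
proof
  assume "flat_rel 4 x y"
  then obtain n where n: "y 4 = x 4 + of_int n" "\<forall>j<4. y j - (if even n then x j else - x j) \<in> \<int>"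
    by (auto simp: flat_rel_def)
  define h where "h = (\<lambda>i. if i < 4 then y i - (if even n then x i else - x i)
     else if i = 4 then of_int n else if i = 8 then (if even n then 1 else - 1) else (0::real))"
  have "h \<in> sphere_lattice"
    using n(2) by (auto simp: sphere_lattice_def in_GC h_def)
  moreover have "\<forall>i<5. gmult x h i = y i"
    using n(1) by (simp add: all_less_5 gcoords h_def)
  ultimately show "\<exists>h\<in>sphere_lattice. \<forall>i<5. gmult x h i = y i" by blast
next
  assume "\<exists>h\<in>sphere_lattice. \<forall>i<5. gmult x h i = y i"
  then obtain h n where h: "h \<in> GC" "\<forall>i<4. h i \<in> \<int>" "h 5 = 0" "h 6 = 0" "h 7 = 0"
      "h 4 = of_int n" "h 8 = (if even n then 1 else - 1)" and eq: "\<forall>i<5. gmult x h i = y i"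
    unfolding sphere_lattice_def by blast
  have "y 4 = x 4 + of_int n" using eq h by (simp add: all_less_5 gcoords)
  moreover have "\<forall>j<4. y j - (if even n then x j else - x j) = h j"
    using eq h by (auto simp: all_less_5 all_less_4 gcoords)
  then have "\<forall>j<4. y j - (if even n then x j else - x j) \<in> \<int>" using h(2) by simp
  ultimately show "flat_rel 4 x y" unfolding flat_rel_def by blast
qed

lemma rot_subgroup_subgroup: "subgroup rot_subgroup sphere_group"
proof (rule group.subgroupI[OF group_sphere_group])
  show "rot_subgroup \<noteq> {}"
    by (auto simp: rot_subgroup_def in_GC intro!: exI[of _ "\<lambda>i. if i = 8 then 1 else 0"])
  show "inv\<^bsub>sphere_group\<^esub> x \<in> rot_subgroup" if "x \<in> rot_subgroup" for x
    using that ginv_in by (simp add: rot_subgroup_def sphere_inv all_less_5 gcoords)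
  show "x \<otimes>\<^bsub>sphere_group\<^esub> y \<in> rot_subgroup" if "x \<in> rot_subgroup" "y \<in> rot_subgroup" for x y
    using that gmult_in by (simp add: rot_subgroup_def all_less_5 gcoords)
qed (auto simp: rot_subgroup_def)

lemma sphere_lattice_subgroup: "subgroup sphere_lattice sphere_group"
proof (rule group.subgroupI[OF group_sphere_group])
  show "sphere_lattice \<noteq> {}"
    by (auto simp: sphere_lattice_def in_GC intro!: exI[of _ "\<lambda>i. if i = 8 then 1 else 0"] exI[of _ 0])
  show "sphere_lattice \<subseteq> GC" by (auto simp: sphere_lattice_def)
next
  fix x assume "x \<in> sphere_lattice"
  then obtain n where x: "x \<in> GC" "\<forall>i<4. x i \<in> \<int>" "x 5 = 0" "x 6 = 0" "x 7 = 0"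
      "x 4 = of_int n" "x 8 = (if even n then 1 else - 1)"
    by (auto simp: sphere_lattice_def)
  have "ginv x 4 = of_int (- n)" "ginv x 8 = (if even (- n) then 1 else - 1)"
    using x by (simp_all add: gcoords)
  moreover have "ginv x \<in> GC" "\<forall>i<4. ginv x i \<in> \<int>" "ginv x 5 = 0" "ginv x 6 = 0" "ginv x 7 = 0"
    using x ginv_in by (auto simp: all_less_4 gcoords)
  ultimately show "inv\<^bsub>sphere_group\<^esub> x \<in> sphere_lattice"
    unfolding sphere_inv[OF x(1)] sphere_lattice_def by blast
next
  fix x y assume "x \<in> sphere_lattice" "y \<in> sphere_lattice"
  then obtain n m where x: "x \<in> GC" "\<forall>i<4. x i \<in> \<int>" "x 5 = 0" "x 6 = 0" "x 7 = 0"
      "x 4 = of_int n" "x 8 = (if even n then 1 else - 1)"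
    and y: "y \<in> GC" "\<forall>i<4. y i \<in> \<int>" "y 5 = 0" "y 6 = 0" "y 7 = 0"
      "y 4 = of_int m" "y 8 = (if even m then 1 else - 1)"
    by (auto simp: sphere_lattice_def)
  have "gmult x y 4 = of_int (n + m)" "gmult x y 8 = (if even (n + m) then 1 else - 1)"
    using x y by (simp_all add: gcoords)
  moreover have "gmult x y \<in> GC" "\<forall>i<4. gmult x y i \<in> \<int>"
      "gmult x y 5 = 0" "gmult x y 6 = 0" "gmult x y 7 = 0"
    using x y gmult_in by (auto simp: all_less_4 gcoords)
  ultimately show "x \<otimes>\<^bsub>sphere_group\<^esub> y \<in> sphere_lattice"
    unfolding sphere_group_simps sphere_lattice_def by blast
qed

lemma (in group) double_coset_eq_iff:
  assumes H: "subgroup H G" and K: "subgroup K G" and x: "x \<in> carrier G" and y: "y \<in> carrier G"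
  shows "H <#> (x <# K) = H <#> (y <# K) \<longleftrightarrow> (\<exists>h\<in>H. \<exists>k\<in>K. y = h \<otimes> (x \<otimes> k))"
proof -
  note Hc = subgroup.mem_carrier[OF H] and Kc = subgroup.mem_carrier[OF K]
  have elem: "z \<in> H <#> (u <# K) \<longleftrightarrow> (\<exists>h\<in>H. \<exists>k\<in>K. z = h \<otimes> (u \<otimes> k))" for z u
    by (auto simp: set_mult_def l_coset_def)
  \<comment> \<open>The reverse inclusion follows from the same statement, applied to
    \<open>x\<close> expressed through \<open>y\<close> by the inverses of \<open>h\<close> and
    \<open>k\<close>.\<close>
  have sub: "H <#> (v <# K) \<subseteq> H <#> (u <# K)"
    if u: "u \<in> carrier G" and h: "h \<in> H" and k: "k \<in> K" and v: "v = h \<otimes> (u \<otimes> k)" for u v h k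
  proof
    fix z assume "z \<in> H <#> (v <# K)"
    then obtain h' k' where z: "h' \<in> H" "k' \<in> K" "z = h' \<otimes> (v \<otimes> k')" unfolding elem by blast
    then have "z = (h' \<otimes> h) \<otimes> (u \<otimes> (k \<otimes> k'))"
      using u Hc Kc h k by (simp add: v m_assoc)
    then show "z \<in> H <#> (u <# K)"
      unfolding elem using subgroup.m_closed[OF H z(1) h] subgroup.m_closed[OF K k z(2)] by blast
  qed
  show ?thesis
  proof
    assume eq: "H <#> (x <# K) = H <#> (y <# K)"
    have "y = \<one> \<otimes> (y \<otimes> \<one>)" using y by simp
    then have "y \<in> H <#> (y <# K)"
      unfolding elem using subgroup.one_closed[OF H] subgroup.one_closed[OF K] by blast
    then show "\<exists>h\<in>H. \<exists>k\<in>K. y = h \<otimes> (x \<otimes> k)" unfolding eq[symmetric] elem .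
  next
    assume "\<exists>h\<in>H. \<exists>k\<in>K. y = h \<otimes> (x \<otimes> k)"
    then obtain h k where hk: "h \<in> H" "k \<in> K" "y = h \<otimes> (x \<otimes> k)" by blast
    have "inv h \<otimes> (y \<otimes> inv k) = inv h \<otimes> (h \<otimes> (x \<otimes> (k \<otimes> inv k)))"
      using x Hc[OF hk(1)] Kc[OF hk(2)] by (simp only: hk(3) m_assoc m_closed inv_closed)
    also have "\<dots> = (inv h \<otimes> h) \<otimes> x"
      using x Hc[OF hk(1)] Kc[OF hk(2)] by (simp only: m_assoc r_inv r_one inv_closed)
    also have "\<dots> = x" using x Hc[OF hk(1)] by simp
    finally have "x = inv h \<otimes> (y \<otimes> inv k)" by simp
    then show "H <#> (x <# K) = H <#> (y <# K)"
      using sub[OF x hk] sub[OF y subgroup.m_inv_closed[OF H hk(1)] subgroup.m_inv_closed[OF K hk(2)]]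
      by blast
  qed
qed

text \<open>Coordinate 4 is additive, so it vanishes on a torsion element. Its parity then makes the
  sign 1, after which the other translation coordinates are additive on powers as well.\<close>

lemma torsion_free_sphere_lattice: "torsion_free sphere_group sphere_lattice"
  unfolding torsion_free_def
proof (intro ballI allI impI)
  interpret group sphere_group by (rule group_sphere_group)
  fix x and k :: nat
  assume "x \<in> sphere_lattice" and k: "k > 0 \<and> x [^]\<^bsub>sphere_group\<^esub> k = \<one>\<^bsub>sphere_group\<^esub>"
  then obtain n where x: "x \<in> GC" "x 5 = 0" "x 6 = 0" "x 7 = 0"
      "x 4 = of_int n" "x 8 = (if even n then 1 else - 1)"
    by (auto simp: sphere_lattice_def)
  have "(x [^]\<^bsub>sphere_group\<^esub> j) 4 = real j * x 4" for j :: nat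
    by (induction j) (simp_all add: gcoords algebra_simps)
  from this[of k] have "x 4 = 0" using k by simp
  then have x8: "x 8 = 1" using x by simp
  have "\<forall>i<4. (x [^]\<^bsub>sphere_group\<^esub> j) i = real j * x i" for j :: nat
    by (induction j) (simp_all add: gcoords all_less_4 x(2-4) x8 algebra_simps)
  from this[of k] have "\<forall>i<4. x i = 0" using k by auto
  then show "x = \<one>\<^bsub>sphere_group\<^esub>"
    using x x8 \<open>x 4 = 0\<close> by (intro seq9_eqI) (auto simp: in_GC all_less_4)
qed

text \<open>For \<open>b = 0\<close> this set is the compact subgroup, for \<open>b = 1\<close> it
  contains representatives of all lattice cosets.\<close>

lemma compact_norm_box:
  "compact {x \<in> GC. \<forall>i<5. 0 \<le> x i \<and> x i \<le> b}" (is "compact ?C")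
proof -
  let ?B = "{x::nat\<Rightarrow>real. \<forall>i. (if i < 5 then 0 else if i < 9 then - 1 else 0) \<le> x i \<and>
      x i \<le> (if i < 5 then b else if i < 9 then 1 else 0)}"
  have bound: "\<bar>x i\<bar> \<le> 1" if "x \<in> GC" "\<not> i < 5" "i < 9" for x i
  proof -
    have "i = 5 \<or> i = 6 \<or> i = 7 \<or> i = 8" using that by presburger
    moreover have "(x 5)\<^sup>2 + (x 6)\<^sup>2 + (x 7)\<^sup>2 + (x 8)\<^sup>2 = 1" using that by (simp add: in_GC)
    moreover from this have "(x 5)\<^sup>2 \<le> 1" "(x 6)\<^sup>2 \<le> 1" "(x 7)\<^sup>2 \<le> 1" "(x 8)\<^sup>2 \<le> 1"
      using zero_le_power2[of "x 5"] zero_le_power2[of "x 6"] zero_le_power2[of "x 7"]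
        zero_le_power2[of "x 8"] by linarith+
    ultimately have "(x i)\<^sup>2 \<le> 1" by metis
    then show ?thesis by (simp add: abs_square_le_1)
  qed
  have "?C = ?B \<inter> {x. (x 5)\<^sup>2 + (x 6)\<^sup>2 + (x 7)\<^sup>2 + (x 8)\<^sup>2 = 1}" (is "_ = ?R")
  proof
    show "?C \<subseteq> ?R"
    proof
      fix x assume x: "x \<in> ?C"
      have "(if i < 5 then 0 else if i < 9 then - 1 else 0) \<le> x i \<and>
         x i \<le> (if i < 5 then b else if i < 9 then 1 else 0)" for i
        using x bound[of x i] by (auto simp: in_GC abs_le_iff)
      then show "x \<in> ?R" using x by (simp add: in_GC)
    qed
    show "?R \<subseteq> ?C"
    proof
      fix x assume x: "x \<in> ?R"
      then have B: "(if i < 5 then 0 else if i < 9 then - 1 else 0) \<le> x i \<and>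
         x i \<le> (if i < 5 then b else if i < 9 then 1 else 0)" for i by blast
      have "x i = 0" if "i \<ge> 9" for i using B[of i] that by simp
      moreover have "0 \<le> x i \<and> x i \<le> b" if "i < 5" for i using B[of i] that by simp
      ultimately show "x \<in> ?C" using x by (simp add: in_GC)
    qed
  qed
  moreover have "compact ?R"
    by (intro compact_Int_closed compact_box_seq closed_Collect_eq continuous_intros)
  ultimately show ?thesis by (simp only:)
qed

abbreviation "sphere_topology \<equiv> top_of_set GC"

lemma compact_rot_subgroup: "compact rot_subgroup"
proof -
  have "rot_subgroup = {x \<in> GC. \<forall>i<5. 0 \<le> x i \<and> x i \<le> 0}"
    by (auto simp: rot_subgroup_def intro: order_antisym)
  then show ?thesis using compact_norm_box[of 0] by simp
qed

text \<open>A larger subgroup contains a nonzero pure translation, whose powers grow linearly and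
  leave every compact set.\<close>

lemma maximal_compact_rot_subgroup: "maximal_compact_subgroup sphere_group sphere_topology rot_subgroup"
  unfolding maximal_compact_subgroup_def
proof (intro conjI allI impI rot_subgroup_subgroup; (elim conjE)?)
  interpret group sphere_group by (rule group_sphere_group)
  show "compactin sphere_topology rot_subgroup"
    using compact_rot_subgroup by (auto simp: compactin_subtopology rot_subgroup_def)
  fix K assume K: "subgroup K sphere_group" "compactin sphere_topology K" "rot_subgroup \<subseteq> K"
  have "x i = 0" if x: "x \<in> K" and i: "i < 5" for x i
  proof -
    have xG: "x \<in> GC" using x subgroup.mem_carrier[OF K(1)] by blast
    \<comment> \<open>The translation part of \<open>x\<close>, which lies in \<open>K\<close>
      because it differs from \<open>x\<close> by a left factor in
      \<open>rot_subgroup\<close>.\<close>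
    define a where "a = (\<lambda>i. if i < 5 then x i else if i = 8 then 1 else 0)"
    have aG: "a \<in> GC" by (simp add: a_def in_GC)
    have "\<forall>i<5. x i = a i" by (simp add: a_def)
    then obtain h where "h \<in> rot_subgroup" "a = gmult h x"
      using same_translation_part[OF xG aG] by blast
    then have a: "a \<in> K" using K(3) x subgroup.m_closed[OF K(1), of h x] by auto
    have pow_in: "a [^]\<^bsub>sphere_group\<^esub> k \<in> K" for k :: nat
      using a subgroup.m_closed[OF K(1)] subgroup.one_closed[OF K(1)] by (induction k) simp_all
    have pow: "\<forall>i<5. (a [^]\<^bsub>sphere_group\<^esub> k) i = real k * a i" for k :: nat
      by (induction k) (simp_all add: all_less_5 gcoords a_def algebra_simps)
    have "compact K" using K(2) by (simp add: compactin_subtopology)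
    then have "bounded ((\<lambda>x. x i) ` K)"
      by (intro compact_imp_bounded compact_continuous_image continuous_intros)
    then obtain B where B: "\<And>y. y \<in> K \<Longrightarrow> \<bar>y i\<bar> \<le> B" by (auto simp: bounded_iff)
    have le: "real k * \<bar>x i\<bar> \<le> B" for k
      using B[OF pow_in[of k]] pow[of k] i by (simp add: a_def abs_mult)
    show "x i = 0"
    proof (rule ccontr)
      assume "x i \<noteq> 0"
      then obtain k :: nat where "B < real k * \<bar>x i\<bar>" using reals_Archimedean3 by (metis zero_less_abs_iff)
      then show False using le[of k] by simp
    qed
  qed
  then have "K \<subseteq> rot_subgroup"
    using subgroup.subset[OF K(1)] by (auto simp: rot_subgroup_def)
  then show "K = rot_subgroup" using K(3) by blast
qed

lemma cocompact_sphere_lattice: "cocompact_lattice sphere_group sphere_topology sphere_lattice"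
  unfolding cocompact_lattice_def
proof (intro conjI sphere_lattice_subgroup)
  interpret group sphere_group by (rule group_sphere_group)
  show "subtopology sphere_topology sphere_lattice = discrete_topology sphere_lattice"
  proof (rule discrete_subtopology_integral[where N = 5])
    show "a i \<in> \<int>" if "a \<in> sphere_lattice" "i < 5" for a i
      using that less_5_cases[OF that(2)] by (auto simp: sphere_lattice_def)
    fix a b assume a: "a \<in> sphere_lattice" and b: "b \<in> sphere_lattice"
      and eq: "\<And>i. i < 5 \<Longrightarrow> a i = b i"
    have "a 4 = b 4" using eq by simp
    \<comment> \<open>The parity of coordinate 4 determines the sign in coordinate 8.\<close>
    then have "a 8 = b 8" using a b by (auto simp: sphere_lattice_def)
    then show "a = b"
      using a b eq by (intro seq9_eqI) (auto simp: sphere_lattice_def in_GC)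
  qed (auto simp: sphere_lattice_def)
  let ?q = "\<lambda>g. g <#\<^bsub>sphere_group\<^esub> sphere_lattice"
  let ?C = "{x \<in> GC. \<forall>i<5. 0 \<le> x i \<and> x i \<le> 1}"
  have q: "quotient_map sphere_topology (coset_space sphere_group sphere_topology sphere_lattice) ?q"
    unfolding coset_space_def by (rule quotient_map_quotient_topology)
  have "compactin sphere_topology ?C" using compact_norm_box[of 1] by (auto simp: compactin_subtopology)
  then have c: "compactin (coset_space sphere_group sphere_topology sphere_lattice) (?q ` ?C)"
    using image_compactin quotient_imp_continuous_map[OF q] by blast
  have "topspace (coset_space sphere_group sphere_topology sphere_lattice) \<subseteq> ?q ` ?C"
  proof
    fix z assume "z \<in> topspace (coset_space sphere_group sphere_topology sphere_lattice)"
    then obtain x where x: "x \<in> GC" "z = ?q x" using quotient_imp_surjective_map[OF q] by auto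
    obtain c where c: "flat_rel 4 x c" "\<forall>i. 0 \<le> c i \<and> c i \<le> (if i \<le> 4 then 1 else 0)"
      using flat_rel_fundamental_domain by blast
    then obtain h where h: "h \<in> sphere_lattice" "\<forall>i<5. gmult x h i = c i"
      unfolding lattice_orbit by blast
    have hG: "h \<in> GC" using h(1) by (simp add: sphere_lattice_def)
    have "?q x = ?q (gmult x h)"
      using l_coset_eq_iff[OF sphere_lattice_subgroup x(1) gmult_in[OF x(1) hG]] h(1) by auto
    moreover have "0 \<le> gmult x h i \<and> gmult x h i \<le> 1" if "i < 5" for i
    proof -
      have "gmult x h i = c i" using h(2) that by blast
      moreover have "0 \<le> c i \<and> c i \<le> (if i \<le> 4 then 1 else 0)" using c(2) by blast
      ultimately show ?thesis using that by simp
    qed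
    then have "gmult x h \<in> ?C" using gmult_in[OF x(1) hG] by blast
    ultimately show "z \<in> ?q ` ?C" using x(2) by blast
  qed
  then have "topspace (coset_space sphere_group sphere_topology sphere_lattice) = ?q ` ?C"
    by (intro subset_antisym compactin_subset_topspace[OF c])
  then show "compact_space (coset_space sphere_group sphere_topology sphere_lattice)"
    using c by (simp only: compact_space_def)
qed

text \<open>Double cosets depend only on the translation part, so the space is a quotient of the
  5-dimensional Euclidean space, embedded by \<open>s\<close> with unit quaternion 1.\<close>

lemma double_coset_flat_quotient:
  obtains \<pi> where
    "quotient_map (Euclidean_space (Suc 4))
       (double_coset_space sphere_group sphere_topology rot_subgroup sphere_lattice) \<pi>"
    "\<And>x y. x \<in> topspace (Euclidean_space (Suc 4)) \<Longrightarrow> y \<in> topspace (Euclidean_space (Suc 4)) \<Longrightarrow>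
       \<pi> x = \<pi> y \<longleftrightarrow> flat_rel 4 x y"
proof -
  interpret group sphere_group by (rule group_sphere_group)
  let ?M = "double_coset_space sphere_group sphere_topology rot_subgroup sphere_lattice"
  let ?E = "Euclidean_space (Suc 4)"
  define dc where "dc = (\<lambda>g. rot_subgroup <#>\<^bsub>sphere_group\<^esub> (g <#\<^bsub>sphere_group\<^esub> sphere_lattice))"
  define s where "s = (\<lambda>(x::nat\<Rightarrow>real) i. if i < 5 then x i else if i = 8 then 1 else (0::real))"
  define r where "r = (\<lambda>(x::nat\<Rightarrow>real) i. if i < 5 then x i else (0::real))"
  have s_in: "s x \<in> GC" for x by (simp add: s_def in_GC)
  have r_in: "r x \<in> topspace ?E" for x by (simp add: r_def in_Euclidean_space)
  have dc_eq: "dc x = dc y \<longleftrightarrow> flat_rel 4 x y" if x: "x \<in> GC" and y: "y \<in> GC" for x y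
  proof -
    have "dc x = dc y \<longleftrightarrow> (\<exists>k\<in>sphere_lattice. \<exists>h\<in>rot_subgroup. y = gmult h (gmult x k))"
      unfolding dc_def double_coset_eq_iff[OF rot_subgroup_subgroup sphere_lattice_subgroup x y]
      by auto
    also have "\<dots> \<longleftrightarrow> (\<exists>k\<in>sphere_lattice. \<forall>i<5. gmult x k i = y i)"
      by (intro bex_cong refl same_translation_part[symmetric] gmult_in x y) (simp add: sphere_lattice_def)
    finally show ?thesis unfolding lattice_orbit .
  qed
  have q: "quotient_map sphere_topology ?M dc"
    unfolding double_coset_space_def dc_def by (rule quotient_map_quotient_topology)
  have s_cont: "continuous_map ?E sphere_topology s"
  proof -
    have "continuous_on (topspace ?E) s"
      unfolding s_def by (rule continuous_on_coordinatewise_then_product) (intro coord_continuous_intros)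
    then show ?thesis using s_in by (auto simp: Euclidean_space_eq)
  qed
  have r_cont: "continuous_map sphere_topology ?E r"
  proof -
    have "continuous_on GC r"
      unfolding r_def by (rule continuous_on_coordinatewise_then_product) (intro coord_continuous_intros)
    then show ?thesis using r_in by (auto simp: Euclidean_space_eq)
  qed
  have refl4: "flat_rel 4 x y" if "\<forall>i<5. x i = y i" for x y
    unfolding flat_rel_def by (rule exI[of _ 0]) (use that in auto)
  have flat_cong: "flat_rel 4 (s x) (s y) \<longleftrightarrow> flat_rel 4 x y" for x y
    unfolding flat_rel_def by (simp add: s_def)
  \<comment> \<open>Replacing the unit quaternion by 1 stays in the same double coset, so
    \<open>dc\<close> equals \<open>dc \<circ> s \<circ> r\<close> and the quotient property passes
    to \<open>dc \<circ> s\<close>.\<close>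
  have "quotient_map ?E ?M (dc \<circ> s)"
  proof (rule quotient_map_from_composition[OF r_cont])
    show "continuous_map ?E ?M (dc \<circ> s)"
      using s_cont q continuous_map_compose quotient_imp_continuous_map by blast
    show "quotient_map sphere_topology ?M (dc \<circ> s \<circ> r)"
    proof (rule quotient_map_eq[OF q])
      fix x assume "x \<in> topspace sphere_topology"
      moreover have "flat_rel 4 (s (r x)) x" by (rule refl4) (simp add: s_def r_def)
      ultimately have "dc (s (r x)) = dc x" using dc_eq[OF s_in] by simp
      then show "dc x = (dc \<circ> s \<circ> r) x" by simp
    qed
  qed
  then show ?thesis
    by (rule that) (simp add: dc_eq s_in flat_cong)
qed

section \<open>The solvable radical\<close>

lemma translation_subgroup_im:
  "x \<in> translation_subgroup \<Longrightarrow> x \<in> GC \<and> x 5 = 0 \<and> x 6 = 0 \<and> x 7 = 0 \<and> x 8 = 1"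
  using unit_real_part_im[of x] by (simp add: translation_subgroup_def)

lemma translation_subgroup_subgroup: "subgroup translation_subgroup sphere_group"
proof (rule group.subgroupI[OF group_sphere_group])
  show "translation_subgroup \<noteq> {}"
    by (auto simp: translation_subgroup_def in_GC intro!: exI[of _ "\<lambda>i. if i = 8 then 1 else 0"])
  show "inv\<^bsub>sphere_group\<^esub> x \<in> translation_subgroup" if "x \<in> translation_subgroup" for x
    using that ginv_in by (simp add: translation_subgroup_def sphere_inv gcoords)
  show "x \<otimes>\<^bsub>sphere_group\<^esub> y \<in> translation_subgroup"
    if "x \<in> translation_subgroup" "y \<in> translation_subgroup" for x y
    using translation_subgroup_im[OF that(1)] translation_subgroup_im[OF that(2)] gmult_in
    by (simp add: translation_subgroup_def gcoords)
qed (auto simp: translation_subgroup_def)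

lemma translation_subgroup_commute:
  assumes "x \<in> translation_subgroup" "y \<in> translation_subgroup"
  shows "gmult x y = gmult y x"
  using translation_subgroup_im[OF assms(1)] translation_subgroup_im[OF assms(2)]
  by (intro seq9_eqI[OF gmult_supp gmult_supp]) (simp_all add: gcoords)

lemma comm_group_translation_subgroup: "comm_group (sphere_group\<lparr>carrier := translation_subgroup\<rparr>)"
proof (rule group.group_comm_groupI)
  show "group (sphere_group\<lparr>carrier := translation_subgroup\<rparr>)"
    by (rule subgroup.subgroup_is_group[OF translation_subgroup_subgroup group_sphere_group])
qed (simp add: translation_subgroup_commute)

lemma (in comm_group) solvable: "solvable G"
proof -
  have "(derived G ^^ 1) (carrier G) = {\<one>}" using derived_eq_singleton[of "carrier G"] by simp
  then show ?thesis using solvable_iff_trivial_derived_seq by blast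
qed

lemma connected_translation_subgroup: "connected translation_subgroup"
proof -
  let ?E = "{x::nat\<Rightarrow>real. \<forall>i\<ge>5. x i = 0}"
  define s where "s = (\<lambda>(x::nat\<Rightarrow>real) i. if i < 5 then x i else if i = 8 then 1 else (0::real))"
  have "connected ?E"
    using connected_Euclidean_space[of 5]
    by (simp add: Euclidean_space_eq connectedin_def flip: connectedin_iff_connected)
  moreover have "continuous_on ?E s"
    unfolding s_def by (rule continuous_on_coordinatewise_then_product) (intro coord_continuous_intros)
  ultimately have "connected (s ` ?E)" by (intro connected_continuous_image)
  moreover have "s ` ?E = translation_subgroup"
  proof
    show "s ` ?E \<subseteq> translation_subgroup" by (auto simp: s_def translation_subgroup_def in_GC)
    show "translation_subgroup \<subseteq> s ` ?E"
    proof
      fix x assume x: "x \<in> translation_subgroup"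
      have "x = s (\<lambda>i. if i < 5 then x i else 0)"
        by (rule seq9_eqI) (use translation_subgroup_im[OF x] in \<open>auto simp: s_def in_GC\<close>)
      moreover have "(\<lambda>i. if i < 5 then x i else 0) \<in> ?E" by simp
      ultimately show "x \<in> s ` ?E" by (rule image_eqI)
    qed
  qed
  ultimately show ?thesis by simp
qed

lemma connected_normal_solvable_translation_subgroup:
  "connected_normal_solvable sphere_group sphere_topology translation_subgroup"
  unfolding connected_normal_solvable_def
proof (intro conjI)
  show "translation_subgroup \<lhd> sphere_group"
  proof (rule group.normal_invI[OF group_sphere_group translation_subgroup_subgroup])
    fix x h assume x: "x \<in> GC" and h: "h \<in> translation_subgroup"
    note h' = translation_subgroup_im[OF h]
    \<comment> \<open>Conjugating the unit quaternion 1 gives its conjugator's squared norm, which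
      is 1.\<close>
    have "gmult (gmult x h) (ginv x) 8 = 1"
      using h' x by (simp add: gcoords in_GC power2_eq_square add.commute add.left_commute)
    then show "x \<otimes>\<^bsub>sphere_group\<^esub> h \<otimes>\<^bsub>sphere_group\<^esub> inv\<^bsub>sphere_group\<^esub> x \<in> translation_subgroup"
      using h' x gmult_in ginv_in by (simp add: translation_subgroup_def sphere_inv)
  qed
  have "closed {x::nat\<Rightarrow>real. x 8 = 1}" by (intro closed_Collect_eq continuous_intros)
  then show "closedin sphere_topology translation_subgroup"
    by (auto simp: closedin_closed translation_subgroup_def)
  show "connectedin sphere_topology translation_subgroup"
    using connected_translation_subgroup by (auto simp: connectedin_subtopology translation_subgroup_def)
  show "solvable (sphere_group\<lparr>carrier := translation_subgroup\<rparr>)"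
    by (rule comm_group.solvable[OF comm_group_translation_subgroup])
qed

text \<open>For a quaternion with real part \<open>a\<close> and imaginary part \<open>(b, c, d)\<close>, the vector \<open>(b, C, D)\<close> below is
  the imaginary part rotated about the first axis by the angle with cosine \<open>7/25\<close>. As this angle is
  acute and nonzero, the rotated quaternion neither commutes nor anticommutes with the original one.\<close>

lemma rotated_quaternion_noncommuting:
  fixes a b c d e :: real
  defines "C \<equiv> (7 * c - 24 * d) / 25" and "D \<equiv> (24 * c + 7 * d) / 25"
  assumes nz: "c \<noteq> 0 \<or> d \<noteq> 0" and e: "e\<^sup>2 = 1"
    and i: "e * (a * b + b * a + C * d - D * c) = a * b + b * a + c * D - d * C"
    and j: "e * (a * c - b * d + C * a + D * b) = a * C - b * D + c * a + d * b"
    and k: "e * (a * d + b * c - C * b + D * a) = a * D + b * C - c * b + d * a"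
    and r: "e * (a * a - b * b - C * c - D * d) = a * a - b * b - c * C - d * D"
  shows False
proof -
  have pos: "0 < c * c + d * d" using nz sum_squares_gt_zero_iff by blast
  \<comment> \<open>The sine \<open>24/25\<close> excludes \<open>e = 1\<close>; the positive cosine
    \<open>7/25\<close> excludes \<open>e = - 1\<close>.\<close>
  have cross: "C * d - D * c = - (24 / 25) * (c * c + d * d)"
    and inner: "C * c + D * d = (7 / 25) * (c * c + d * d)"
    by (simp_all add: C_def D_def field_simps)
  have "e = 1 \<or> e = - 1" using e by (simp add: power2_eq_1_iff)
  then show False
  proof
    assume "e = 1"
    then have "C * d - D * c = 0" using i by (simp add: algebra_simps)
    then show False using cross pos by simp
  next
    assume e: "e = - 1"
    have "a * a = b * b + (C * c + D * d)" using r e by (simp add: algebra_simps)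
    moreover have "C * c + D * d > 0" using inner pos by simp
    ultimately have "a * a > 0" using zero_le_square[of b] by linarith
    then have "a \<noteq> 0" by auto
    have "a * (c + C) = 0" "a * (d + D) = 0" using j k e by (simp_all add: algebra_simps)
    then have "c + C = 0" "d + D = 0" using \<open>a \<noteq> 0\<close> by simp_all
    then have "32 * c = 24 * d" "32 * d = - 24 * c" by (simp_all add: C_def D_def field_simps)
    then have "c = 0" "d = 0" by linarith+
    then show False using nz by blast
  qed
qed

lemma central_gmult:
  assumes "c 5 = 0" "c 6 = 0" "c 7 = 0"
  shows "gmult c w 5 = c 8 * w 5" "gmult c w 6 = c 8 * w 6" "gmult c w 7 = c 8 * w 7"
    "gmult c w 8 = c 8 * w 8"
  using assms by (simp_all add: gcoords)

text \<open>Conjugation by the unit quaternion \<open>4/5 + 3/5 i\<close> rotates imaginary parts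
  about the first axis by the angle with cosine \<open>7/25\<close>. If the imaginary part lies off
  that axis, \<open>y\<close> and its conjugate do not commute even up to sign.\<close>

lemma noncentral_conjugate:
  assumes nc: "\<not> (y 5 = 0 \<and> y 6 = 0 \<and> y 7 = 0)"
  shows "\<exists>h\<in>GC. \<forall>c. c 5 = 0 \<and> c 6 = 0 \<and> c 7 = 0 \<and> (c 8)\<^sup>2 = 1 \<longrightarrow>
      gmult c (gmult (gmult (gmult h y) (ginv h)) y) \<noteq> gmult y (gmult (gmult h y) (ginv h))"
proof (cases "y 6 \<noteq> 0 \<or> y 7 \<noteq> 0")
  case True
  define h where "h = (\<lambda>i::nat. if i = 5 then 3/5 else if i = 8 then 4/5 else (0::real))"
  have h: "h \<in> GC" by (simp add: in_GC h_def power2_eq_square)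
  define z where "z = gmult (gmult h y) (ginv h)"
  have z: "z 5 = y 5" "z 6 = (7 * y 6 - 24 * y 7) / 25" "z 7 = (24 * y 6 + 7 * y 7) / 25" "z 8 = y 8"
    by (simp_all add: z_def gcoords h_def field_simps)
  have "gmult c (gmult z y) \<noteq> gmult y z"
    if c: "c 5 = 0" "c 6 = 0" "c 7 = 0" "(c 8)\<^sup>2 = 1" for c
  proof
    assume eq: "gmult c (gmult z y) = gmult y z"
    note eqs = central_gmult[OF c(1-3), of "gmult z y", unfolded eq gmult_coords z, symmetric]
    show False
      by (rule rotated_quaternion_noncommuting[OF True c(4), of "y 8" "y 5"])
         (use eqs in \<open>simp_all only:\<close>)
  qed
  then show ?thesis using h unfolding z_def by blast
next
  case False
  \<comment> \<open>On the first axis the second axis is used for the rotation; the imaginary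
    coordinates are permuted cyclically.\<close>
  then have y: "y 7 \<noteq> 0 \<or> y 5 \<noteq> 0" using nc by blast
  define h where "h = (\<lambda>i::nat. if i = 6 then 3/5 else if i = 8 then 4/5 else (0::real))"
  have h: "h \<in> GC" by (simp add: in_GC h_def power2_eq_square)
  define z where "z = gmult (gmult h y) (ginv h)"
  have z: "z 6 = y 6" "z 7 = (7 * y 7 - 24 * y 5) / 25" "z 5 = (24 * y 7 + 7 * y 5) / 25" "z 8 = y 8"
    by (simp_all add: z_def gcoords h_def field_simps)
  have "gmult c (gmult z y) \<noteq> gmult y z"
    if c: "c 5 = 0" "c 6 = 0" "c 7 = 0" "(c 8)\<^sup>2 = 1" for c
  proof
    assume eq: "gmult c (gmult z y) = gmult y z"
    note eqs = central_gmult[OF c(1-3), of "gmult z y", unfolded eq gmult_coords z, symmetric]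
    show False
      by (rule rotated_quaternion_noncommuting[OF y c(4), of "y 8" "y 6"])
         (use eqs in \<open>simp_all only: algebra_simps\<close>)
  qed
  then show ?thesis using h unfolding z_def by blast
qed

text \<open>Normality puts the conjugate \<open>z\<close> of \<open>y\<close> into \<open>K\<close>.
  A commutator of \<open>y\<close> and \<open>z\<close> with central quaternion part would make them
  commute up to sign.\<close>

lemma derived_noncentral:
  assumes K: "K \<lhd> sphere_group" and y: "y \<in> K" "\<not> (y 5 = 0 \<and> y 6 = 0 \<and> y 7 = 0)"
  shows "\<exists>x\<in>derived sphere_group K. \<not> (x 5 = 0 \<and> x 6 = 0 \<and> x 7 = 0)"
proof -
  interpret K: normal K sphere_group by fact
  have yG: "y \<in> GC" using y K.mem_carrier by blast
  obtain h where h: "h \<in> GC" and nc: "\<And>c. c 5 = 0 \<Longrightarrow> c 6 = 0 \<Longrightarrow> c 7 = 0 \<Longrightarrow> (c 8)\<^sup>2 = 1 \<Longrightarrow>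
      gmult c (gmult (gmult (gmult h y) (ginv h)) y) \<noteq> gmult y (gmult (gmult h y) (ginv h))"
    using noncentral_conjugate[of y] y(2) by blast
  define z where "z = gmult (gmult h y) (ginv h)"
  have zK: "z \<in> K"
    using K.inv_op_closed2[OF h y(1)] h by (simp add: z_def sphere_inv)
  have zG: "z \<in> GC" using zK K.mem_carrier by blast
  define c where "c = y \<otimes>\<^bsub>sphere_group\<^esub> z \<otimes>\<^bsub>sphere_group\<^esub> inv\<^bsub>sphere_group\<^esub> y \<otimes>\<^bsub>sphere_group\<^esub> inv\<^bsub>sphere_group\<^esub> z"
  have cG: "c \<in> GC" unfolding c_def using yG zG by (intro K.m_closed K.inv_closed)
  have "c \<otimes>\<^bsub>sphere_group\<^esub> (z \<otimes>\<^bsub>sphere_group\<^esub> y) = y \<otimes>\<^bsub>sphere_group\<^esub> z"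
  proof -
    have "inv\<^bsub>sphere_group\<^esub> z \<otimes>\<^bsub>sphere_group\<^esub> (z \<otimes>\<^bsub>sphere_group\<^esub> y) = y"
      using yG zG by (metis K.inv_closed K.l_inv K.l_one K.m_assoc)
    then show ?thesis
      unfolding c_def using yG zG
      by (metis K.inv_closed K.l_inv K.m_assoc K.m_closed K.r_one)
  qed
  then have eq: "gmult c (gmult z y) = gmult y z" by simp
  have "\<not> (c 5 = 0 \<and> c 6 = 0 \<and> c 7 = 0)"
  proof
    assume c0: "c 5 = 0 \<and> c 6 = 0 \<and> c 7 = 0"
    then have "(c 8)\<^sup>2 = 1" using cG by (simp add: in_GC)
    then show False using nc[of c] c0 eq by (simp add: z_def)
  qed
  moreover have "c \<in> derived sphere_group K"
    unfolding derived_def c_def using y(1) zK by (intro generate.incl) blast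
  ultimately show ?thesis by blast
qed

text \<open>Every member of the derived series stays normal and keeps a noncentral quaternion part,
  so the series never becomes trivial.\<close>

lemma solvable_normal_central:
  assumes N: "N \<lhd> sphere_group" and solv: "solvable (sphere_group\<lparr>carrier := N\<rparr>)" and x: "x \<in> N"
  shows "x 5 = 0 \<and> x 6 = 0 \<and> x 7 = 0"
proof (rule ccontr)
  assume nc: "\<not> (x 5 = 0 \<and> x 6 = 0 \<and> x 7 = 0)"
  interpret group sphere_group by (rule group_sphere_group)
  have sub: "subgroup N sphere_group" using N by (rule normal_imp_subgroup)
  interpret inc: group_hom "sphere_group\<lparr>carrier := N\<rparr>" sphere_group id
    by (rule canonical_inj_is_hom[OF sub])
  \<comment> \<open>The inclusion moves the derived series of \<open>N\<close> into the whole group,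
    where normality of its members can be stated.\<close>
  have "solvable_seq sphere_group (id ` N)"
    by (rule inc.solvable_imp_solvable_img) (use solv in \<open>simp add: solvable_def\<close>)
  then obtain n where n: "(derived sphere_group ^^ n) N = {\<one>\<^bsub>sphere_group\<^esub>}"
    using solvable_imp_trivial_derived_seq by auto
  have "(derived sphere_group ^^ k) N \<lhd> sphere_group \<and>
      (\<exists>y\<in>(derived sphere_group ^^ k) N. \<not> (y 5 = 0 \<and> y 6 = 0 \<and> y 7 = 0))" for k
  proof (induction k)
    case 0
    then show ?case using N x nc by auto
  next
    case (Suc k)
    then obtain y where "y \<in> (derived sphere_group ^^ k) N" "\<not> (y 5 = 0 \<and> y 6 = 0 \<and> y 7 = 0)"
      by blast
    then show ?case
      using derived_is_normal derived_noncentral Suc by simp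
  qed
  from this[of n] n show False by simp
qed

text \<open>Elements of \<open>N\<close> have quaternion part 1 or -1; as \<open>N\<close> is
  connected and contains the identity, the value -1 is excluded.\<close>

lemma solvable_radical_sphere_group:
  "is_solvable_radical sphere_group sphere_topology translation_subgroup"
  unfolding is_solvable_radical_def
proof (intro conjI allI impI connected_normal_solvable_translation_subgroup)
  fix N assume "connected_normal_solvable sphere_group sphere_topology N"
  then have N: "N \<lhd> sphere_group" and conn: "connectedin sphere_topology N"
    and solv: "solvable (sphere_group\<lparr>carrier := N\<rparr>)"
    by (auto simp: connected_normal_solvable_def)
  have sub: "subgroup N sphere_group" using N by (rule normal_imp_subgroup)
  have NG: "N \<subseteq> GC" using subgroup.subset[OF sub] .
  have vals: "x 8 = 1 \<or> x 8 = - 1" if "x \<in> N" for x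
    using solvable_normal_central[OF N solv that] NG that by (auto simp: in_GC power2_eq_1_iff)
  have "connected ((\<lambda>x. x 8) ` N)"
    using conn by (intro connected_continuous_image continuous_intros) (simp add: connectedin_subtopology)
  moreover have "(1::real) \<in> (\<lambda>x. x 8) ` N"
    using subgroup.one_closed[OF sub] by (auto intro!: image_eqI[where x = "\<lambda>i. if i = 8 then 1 else 0"])
  moreover have "(\<lambda>x. x 8) ` N \<subseteq> {1, - 1}" using vals by auto
  ultimately have "(- 1::real) \<notin> (\<lambda>x. x 8) ` N"
  proof (intro notI)
    assume c: "connected ((\<lambda>x::nat\<Rightarrow>real. x 8) ` N)" and "(1::real) \<in> (\<lambda>x. x 8) ` N"
      and s: "(\<lambda>x::nat\<Rightarrow>real. x 8) ` N \<subseteq> {1, - 1}" and "(- 1::real) \<in> (\<lambda>x. x 8) ` N"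
    then have "(0::real) \<in> (\<lambda>x. x 8) ` N"
      using connectedD_interval[OF c, of "-1" 1 0] by simp
    then show False using s by auto
  qed
  then show "N \<subseteq> translation_subgroup"
    using vals NG by (auto simp: translation_subgroup_def) (metis image_eqI)
qed

theorem locally_homogeneous_infinite_length:
  "\<exists>(G :: (nat \<Rightarrow> real) monoid) T H \<Gamma> S.
      aspherical_locally_homogeneous G T H \<Gamma> \<and>
      connected_space (double_coset_space G T H \<Gamma>) \<and>
      is_solvable_radical G T S \<and> comm_group (G\<lparr>carrier := S\<rparr>) \<and>
      iterated_length (double_coset_space G T H \<Gamma>) = \<infinity>"
proof -
  interpret coordinate_lie_group sphere_group 8 chart_dom chart_cod drop8 lift8 ginv
    by (rule coordinate_lie_group_sphere_group)
  let ?M = "double_coset_space sphere_group sphere_topology rot_subgroup sphere_lattice"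
  obtain \<pi> where q: "quotient_map (Euclidean_space (Suc 4)) ?M \<pi>"
    and fib: "\<And>x y. x \<in> topspace (Euclidean_space (Suc 4)) \<Longrightarrow> y \<in> topspace (Euclidean_space (Suc 4)) \<Longrightarrow>
       \<pi> x = \<pi> y \<longleftrightarrow> flat_rel 4 x y"
    using double_coset_flat_quotient by blast
  have "connected_space sphere_topology"
    using connected_GC by (simp add: connectedin_def flip: connectedin_iff_connected)
  then have "aspherical_locally_homogeneous sphere_group sphere_topology rot_subgroup sphere_lattice"
    unfolding aspherical_locally_homogeneous_def
    using lie_group_tcharts maximal_compact_rot_subgroup cocompact_sphere_lattice
      torsion_free_sphere_lattice by blast
  moreover have "connected_space ?M"
    by (rule connected_space_quotient_map_image[OF q connected_Euclidean_space])
  moreover have "iterated_length ?M = \<infinity>" by (rule flat_quotient_length[OF q _ fib]) simp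
  ultimately show ?thesis
    using solvable_radical_sphere_group comm_group_translation_subgroup by blast
qed

theorem theorem1p13:
  shows "(\<exists>M :: (nat \<Rightarrow> real) set topology.
            closed_solvmanifold M \<and> iterated_length M = \<infinity>) \<and>
         (\<exists>(G :: (nat \<Rightarrow> real) monoid) T H \<Gamma> S.
            aspherical_locally_homogeneous G T H \<Gamma> \<and>
            connected_space (double_coset_space G T H \<Gamma>) \<and>
            is_solvable_radical G T S \<and> comm_group (G\<lparr>carrier := S\<rparr>) \<and>
            iterated_length (double_coset_space G T H \<Gamma>) = \<infinity>)"
  using solvmanifold_infinite_length locally_homogeneous_infinite_length by (rule conjI)

end
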